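(* Let $(M,g)$ be an oriented four-dimensional Riemannian manifold, $\mathscr{P}=\mathcal{Z}_+\times_M\mathcal{Z}_-$ the product bundle over $M$ of its positive and negative twistor spaces, and $\mathcal{K}_1,\dots,\mathcal{K}_4$ the four almost product structures on $\mathscr{P}$ defined in the context. Then the almost product structures $\mathcal{K}_\nu$, $\nu=1,2,3,4$, are never integrable; i.e. for every such $(M,g)$ and every $\nu$, the Nijenhuis tensor of $\mathcal{K}_\nu$ does not vanish identically.
   Context: Setting. $(M,g)$ is an oriented Riemannian manifold of dimension four with Levi-Civita connection $\nabla$; $\Lambda^2TM$ carries the induced connection (also $\nabla$) and the metric $g(v_1\wedge v_2,v_3\wedge v_4)=\frac12\det[g(v_i,v_j)]$. $\Lambda^2_\pm TM$ are the $(\pm1)$-eigenbundles of the Hodge star operator; both are preserved by $\nabla$. For $a\in\Lambda^2T_pM$, $K_a$ is the skew-symmetric endomorphism of $T_pM$ with $g(K_aX,Y)=2g(a,X\wedge Y)$. The twistor spaces $\mathcal{Z}_\pm$ are the unit sphere subbundles of $\Lambda^2_\pm TM$. $\mathscr{P}=\{(\sigma^+,\sigma^-):\sigma^\pm\in\mathcal{Z}_\pm$ over the same point of $M\}$, with projection $\pi:\mathscr{P}\to M$; it is a submanifold of $\Lambda^2_+TM\oplus\Lambda^2_-TM$. The horizontal space of $\nabla$ on $\Lambda^2_+TM\oplus\Lambda^2_-TM$ at $\varkappa=(\sigma^+,\sigma^-)\in\mathscr{P}$ is tangent to $\mathscr{P}$, so $T_\varkappa\mathscr{P}=\mathcal{H}_\varkappa\oplus\mathcal{V}_\varkappa$,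 where $\mathcal{H}_\varkappa$ is this horizontal space and $\mathcal{V}_\varkappa=\{(V^+,V^-):V^\pm\in\Lambda^2_\pm T_{\pi(\varkappa)}M,\ V^\pm\perp\sigma^\pm\}$ is the tangent space to the fibre. $X^h_\varkappa\in\mathcal{H}_\varkappa$ is the horizontal lift of $X\in T_{\pi(\varkappa)}M$. Almost product structures: $\mathcal{K}_\nu X^h_\varkappa=(K_{\sigma^+}K_{\sigma^-}X)^h_\varkappa$ for all $\nu$, and on $\mathcal{V}_\varkappa$: $\mathcal{K}_1(V^+,V^-)=(V^+,V^-)$, $\mathcal{K}_2(V^+,V^-)=(V^+,-V^-)$, $\mathcal{K}_3(V^+,V^-)=-(V^+,V^-)$, $\mathcal{K}_4(V^+,V^-)=(-V^+,V^-)$. One has $\mathcal{K}_\nu^2=\mathrm{Id}$. The Nijenhuis tensor of an endomorphism field $P$ with $P^2=\mathrm{Id}$ is $\mathcal{N}_P(A,B)=[A,B]+[PA,PB]-P[PA,B]-P[A,PB]$; $P$ is integrable if $\mathcal{N}_P=0$. *)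

theory Defs
  imports "HOL-Analysis.Analysis" "HOL-Library.Function_Algebras"
begin

text \<open>
  Tangent vectors, bivectors and tangent vectors of bundles are represented by the families of
  their components in all charts, i.e. by functions on charts; these form a real vector space
  under the pointwise operations.
\<close>

instantiation "fun" :: (type, real_vector) real_vector
begin

definition scaleR_fun :: "real \<Rightarrow> ('a \<Rightarrow> 'b) \<Rightarrow> 'a \<Rightarrow> 'b" where
  "scaleR_fun r f = (\<lambda>x. r *\<^sub>R f x)"

instance
  by standard (auto simp: scaleR_fun_def fun_eq_iff scaleR_add_right scaleR_add_left)

end

definition linear_on_set :: "'a::real_vector set \<Rightarrow> ('a \<Rightarrow> 'b::real_vector) \<Rightarrow> bool" where
  "linear_on_set S f \<longleftrightarrow>
     (\<forall>x\<in>S. \<forall>y\<in>S. f (x + y) = f x + f y) \<and> (\<forall>r. \<forall>x\<in>S. f (r *\<^sub>R x) = r *\<^sub>R f x)"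

definition bilinear_on_set :: "'a::real_vector set \<Rightarrow> ('a \<Rightarrow> 'a \<Rightarrow> real) \<Rightarrow> bool" where
  "bilinear_on_set S B \<longleftrightarrow>
     (\<forall>x\<in>S. linear_on_set S (B x)) \<and> (\<forall>y\<in>S. linear_on_set S (\<lambda>x. B x y))"


section \<open>Smooth maps between Euclidean spaces\<close>

primrec Ck_on :: "nat \<Rightarrow> ('a::euclidean_space \<Rightarrow> 'b::real_normed_vector) \<Rightarrow> 'a set \<Rightarrow> bool" where
  "Ck_on 0 f S \<longleftrightarrow> continuous_on S f"
| "Ck_on (Suc n) f S \<longleftrightarrow>
     (\<forall>x\<in>S. f differentiable (at x)) \<and> (\<forall>v. Ck_on n (\<lambda>x. frechet_derivative f (at x) v) S)"

text \<open>This is only used for open \<open>S\<close>.\<close>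

definition smooth_on :: "('a::euclidean_space \<Rightarrow> 'b::real_normed_vector) \<Rightarrow> 'a set \<Rightarrow> bool" where
  "smooth_on f S \<longleftrightarrow> (\<forall>n. Ck_on n f S)"

text \<open>Smoothness on an arbitrary subset, such as a submanifold: local smooth extendability.\<close>

definition smooth_on_subset :: "('a::euclidean_space \<Rightarrow> 'b::real_normed_vector) \<Rightarrow> 'a set \<Rightarrow> bool" where
  "smooth_on_subset f S \<longleftrightarrow>
     (\<forall>z\<in>S. \<exists>W F. open W \<and> z \<in> W \<and> smooth_on F W \<and> (\<forall>y\<in>S \<inter> W. f y = F y))"


section \<open>Oriented four-dimensional manifolds\<close>

text \<open>A chart is a domain together with a coordinate map (only relevant on the domain).\<close>

type_synonym 'm chart = "'m set \<times> ('m \<Rightarrow> real^4)"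

definition inv_chart :: "'m chart \<Rightarrow> real^4 \<Rightarrow> 'm" where
  "inv_chart c = inv_into (fst c) (snd c)"

definition transition :: "'m chart \<Rightarrow> 'm chart \<Rightarrow> real^4 \<Rightarrow> real^4" where
  "transition c d = snd d \<circ> inv_chart c"

definition smooth_atlas :: "'m set \<Rightarrow> 'm chart set \<Rightarrow> bool" where
  "smooth_atlas M \<A> \<longleftrightarrow>
     (\<Union>c\<in>\<A>. fst c) = M \<and>
     (\<forall>c\<in>\<A>. inj_on (snd c) (fst c) \<and> open (snd c ` fst c)) \<and>
     (\<forall>c\<in>\<A>. \<forall>d\<in>\<A>. open (snd c ` (fst c \<inter> fst d)) \<and>
                  smooth_on (transition c d) (snd c ` (fst c \<inter> fst d)))"

definition manifold_topology :: "'m set \<Rightarrow> 'm chart set \<Rightarrow> 'm topology" where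
  "manifold_topology M \<A> = topology (\<lambda>W. W \<subseteq> M \<and> (\<forall>c\<in>\<A>. open (snd c ` (W \<inter> fst c))))"

definition jacobian :: "'m chart \<Rightarrow> 'm chart \<Rightarrow> 'm \<Rightarrow> real^4^4" where
  "jacobian c d p = matrix (frechet_derivative (transition c d) (at (snd c p)))"

definition oriented_manifold :: "'m set \<Rightarrow> 'm chart set \<Rightarrow> bool" where
  "oriented_manifold M \<A> \<longleftrightarrow>
     M \<noteq> {} \<and> smooth_atlas M \<A> \<and>
     Hausdorff_space (manifold_topology M \<A>) \<and> second_countable (manifold_topology M \<A>) \<and>
     (\<forall>c\<in>\<A>. \<forall>d\<in>\<A>. \<forall>p\<in>fst c \<inter> fst d. det (jacobian c d p) > 0)"

definition tangent_space :: "'m chart set \<Rightarrow> 'm \<Rightarrow> ('m chart \<Rightarrow> real^4) set" where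
  "tangent_space \<A> p =
     {v. (\<forall>c\<in>\<A>. \<forall>d\<in>\<A>. p \<in> fst c \<inter> fst d \<longrightarrow> v d = jacobian c d p *v v c) \<and>
         (\<forall>c. \<not> (c \<in> \<A> \<and> p \<in> fst c) \<longrightarrow> v c = 0)}"

text \<open>The tangent vector at \<open>p\<close> with components \<open>u\<close> in the chart \<open>c\<close>, and the coordinate fields.\<close>

definition coord_vec :: "'m chart set \<Rightarrow> 'm chart \<Rightarrow> 'm \<Rightarrow> real^4 \<Rightarrow> 'm chart \<Rightarrow> real^4" where
  "coord_vec \<A> c p u = (\<lambda>d. if d \<in> \<A> \<and> p \<in> fst d then jacobian c d p *v u else 0)"

definition coord_field :: "'m chart set \<Rightarrow> 'm chart \<Rightarrow> 4 \<Rightarrow> 'm \<Rightarrow> 'm chart \<Rightarrow> real^4" where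
  "coord_field \<A> c j = (\<lambda>p. coord_vec \<A> c p (axis j 1))"

definition smooth_function :: "'m chart set \<Rightarrow> 'm set \<Rightarrow> ('m \<Rightarrow> real) \<Rightarrow> bool" where
  "smooth_function \<A> U f \<longleftrightarrow> (\<forall>c\<in>\<A>. smooth_on (f \<circ> inv_chart c) (snd c ` (U \<inter> fst c)))"

definition vector_field :: "'m chart set \<Rightarrow> 'm set \<Rightarrow> ('m \<Rightarrow> 'm chart \<Rightarrow> real^4) \<Rightarrow> bool" where
  "vector_field \<A> U X \<longleftrightarrow>
     (\<forall>p\<in>U. X p \<in> tangent_space \<A> p) \<and>
     (\<forall>c\<in>\<A>. smooth_on (\<lambda>x. X (inv_chart c x) c) (snd c ` (U \<inter> fst c)))"

text \<open>The derivative \<open>v f\<close> at \<open>p\<close>, computed in the chart \<open>c\<close>, and the Lie bracket.\<close>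

definition dir_deriv :: "'m chart \<Rightarrow> 'm \<Rightarrow> ('m chart \<Rightarrow> real^4) \<Rightarrow> ('m \<Rightarrow> real) \<Rightarrow> real" where
  "dir_deriv c p v f = frechet_derivative (f \<circ> inv_chart c) (at (snd c p)) (v c)"

definition lie_bracket :: "'m chart set \<Rightarrow> ('m \<Rightarrow> 'm chart \<Rightarrow> real^4) \<Rightarrow> ('m \<Rightarrow> 'm chart \<Rightarrow> real^4)
    \<Rightarrow> 'm \<Rightarrow> 'm chart \<Rightarrow> real^4" where
  "lie_bracket \<A> X Y p = (\<lambda>c. if c \<in> \<A> \<and> p \<in> fst c
     then frechet_derivative (\<lambda>x. Y (inv_chart c x) c) (at (snd c p)) (X p c)
        - frechet_derivative (\<lambda>x. X (inv_chart c x) c) (at (snd c p)) (Y p c)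
     else 0)"


section \<open>Riemannian metrics and the Levi-Civita connection\<close>

type_synonym 'm metric = "'m \<Rightarrow> ('m chart \<Rightarrow> real^4) \<Rightarrow> ('m chart \<Rightarrow> real^4) \<Rightarrow> real"

definition riemannian_metric :: "'m set \<Rightarrow> 'm chart set \<Rightarrow> 'm metric \<Rightarrow> bool" where
  "riemannian_metric M \<A> g \<longleftrightarrow>
     (\<forall>p\<in>M. bilinear_on_set (tangent_space \<A> p) (g p) \<and>
        (\<forall>v\<in>tangent_space \<A> p. \<forall>w\<in>tangent_space \<A> p. g p v w = g p w v) \<and>
        (\<forall>v\<in>tangent_space \<A> p. v \<noteq> 0 \<longrightarrow> g p v v > 0)) \<and>
     (\<forall>U X Y. openin (manifold_topology M \<A>) U \<and> vector_field \<A> U X \<and> vector_field \<A> U Y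
        \<longrightarrow> smooth_function \<A> U (\<lambda>p. g p (X p) (Y p)))"

text \<open>
  A connection \<open>D\<close> assigns to \<open>p\<close>, a tangent vector \<open>v\<close> at \<open>p\<close> and a vector field \<open>Y\<close> defined near
  \<open>p\<close> the covariant derivative of \<open>Y\<close> at \<open>p\<close> in the direction \<open>v\<close>.
\<close>

type_synonym 'm connection =
  "'m \<Rightarrow> ('m chart \<Rightarrow> real^4) \<Rightarrow> ('m \<Rightarrow> 'm chart \<Rightarrow> real^4) \<Rightarrow> ('m chart \<Rightarrow> real^4)"

definition affine_connection :: "'m set \<Rightarrow> 'm chart set \<Rightarrow> 'm connection \<Rightarrow> bool" where
  "affine_connection M \<A> D \<longleftrightarrow>
     (\<forall>U. openin (manifold_topology M \<A>) U \<longrightarrow>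
       (\<forall>p\<in>U. \<forall>Y. vector_field \<A> U Y \<longrightarrow>
          linear_on_set (tangent_space \<A> p) (\<lambda>v. D p v Y) \<and>
          (\<forall>v\<in>tangent_space \<A> p.
             D p v Y \<in> tangent_space \<A> p \<and>
             (\<forall>Z. vector_field \<A> U Z \<longrightarrow> D p v (\<lambda>q. Y q + Z q) = D p v Y + D p v Z) \<and>
             (\<forall>f. smooth_function \<A> U f \<longrightarrow> (\<forall>c\<in>\<A>. p \<in> fst c \<longrightarrow>
                D p v (\<lambda>q. f q *\<^sub>R Y q) = dir_deriv c p v f *\<^sub>R Y p + f p *\<^sub>R D p v Y)) \<and>
             (\<forall>Z. (\<forall>q\<in>U. Z q = Y q) \<longrightarrow> D p v Z = D p v Y))) \<and>
       (\<forall>X Y. vector_field \<A> U X \<and> vector_field \<A> U Y \<longrightarrow>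
          vector_field \<A> U (\<lambda>p. D p (X p) Y)))"

definition levi_civita_connection :: "'m set \<Rightarrow> 'm chart set \<Rightarrow> 'm metric \<Rightarrow> 'm connection \<Rightarrow> bool" where
  "levi_civita_connection M \<A> g D \<longleftrightarrow>
     affine_connection M \<A> D \<and>
     (\<forall>U X Y Z. openin (manifold_topology M \<A>) U \<and>
        vector_field \<A> U X \<and> vector_field \<A> U Y \<and> vector_field \<A> U Z \<longrightarrow>
        (\<forall>p\<in>U. D p (X p) Y - D p (Y p) X = lie_bracket \<A> X Y p \<and>
           (\<forall>c\<in>\<A>. p \<in> fst c \<longrightarrow>
              dir_deriv c p (X p) (\<lambda>q. g q (Y q) (Z q))
                = g p (D p (X p) Y) (Z p) + g p (Y p) (D p (X p) Z))))"


section \<open>Bivectors, Hodge star and twistor spaces\<close>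

text \<open>
  \<open>\<Lambda>\<^sup>2 T\<^sub>p M\<close> is realised inside \<open>T\<^sub>p M \<otimes> T\<^sub>p M\<close> as the space of skew-symmetric contravariant
  2-tensors, with \<open>v \<and> w = v \<otimes> w - w \<otimes> v\<close>.
\<close>

type_synonym 'm tensor2 = "'m chart \<Rightarrow> real^4^4"

definition bivectors :: "'m chart set \<Rightarrow> 'm \<Rightarrow> 'm tensor2 set" where
  "bivectors \<A> p =
     {a. (\<forall>c\<in>\<A>. \<forall>d\<in>\<A>. p \<in> fst c \<inter> fst d \<longrightarrow>
            a d = jacobian c d p ** a c ** transpose (jacobian c d p)) \<and>
         (\<forall>c. transpose (a c) = - a c) \<and>
         (\<forall>c. \<not> (c \<in> \<A> \<and> p \<in> fst c) \<longrightarrow> a c = 0)}"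

definition wedge :: "('m chart \<Rightarrow> real^4) \<Rightarrow> ('m chart \<Rightarrow> real^4) \<Rightarrow> 'm tensor2" where
  "wedge v w = (\<lambda>c. \<chi> i j. v c $ i * w c $ j - v c $ j * w c $ i)"

text \<open>
  The inner product on \<open>\<Lambda>\<^sup>2 T\<^sub>p M\<close>: the unique bilinear form whose value on
  \<open>v1 \<and> v2\<close>, \<open>v3 \<and> v4\<close> is one half of the determinant of the Gram matrix of
  \<open>(v1, v2)\<close> against \<open>(v3, v4)\<close>.
\<close>

definition bivector_metric :: "'m chart set \<Rightarrow> 'm metric \<Rightarrow> 'm \<Rightarrow> 'm tensor2 \<Rightarrow> 'm tensor2 \<Rightarrow> real" where
  "bivector_metric \<A> g p a b = (THE r. \<forall>B.
     bilinear_on_set (bivectors \<A> p) B \<and>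
     (\<forall>v1\<in>tangent_space \<A> p. \<forall>v2\<in>tangent_space \<A> p.
      \<forall>v3\<in>tangent_space \<A> p. \<forall>v4\<in>tangent_space \<A> p.
        B (wedge v1 v2) (wedge v3 v4) = (g p v1 v3 * g p v2 v4 - g p v1 v4 * g p v2 v3) / 2)
     \<longrightarrow> r = B a b)"

definition oriented_orthonormal_basis ::
    "'m chart set \<Rightarrow> 'm metric \<Rightarrow> 'm \<Rightarrow> (4 \<Rightarrow> 'm chart \<Rightarrow> real^4) \<Rightarrow> bool" where
  "oriented_orthonormal_basis \<A> g p e \<longleftrightarrow>
     (\<forall>i. e i \<in> tangent_space \<A> p) \<and>
     (\<forall>i j. g p (e i) (e j) = (if i = j then 1 else 0)) \<and>
     (\<forall>c\<in>\<A>. p \<in> fst c \<longrightarrow> det (\<chi> i. e i c) > 0)"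

text \<open>
  The Hodge star: the unique linear map of \<open>\<Lambda>\<^sup>2 T\<^sub>p M\<close> sending \<open>e1 \<and> e2\<close> to \<open>e3 \<and> e4\<close> for all
  oriented orthonormal bases. The basis is indexed by the type \<open>4\<close>, in which \<open>4 = 0\<close>.
\<close>

definition hodge_star :: "'m chart set \<Rightarrow> 'm metric \<Rightarrow> 'm \<Rightarrow> 'm tensor2 \<Rightarrow> 'm tensor2" where
  "hodge_star \<A> g p a = (THE b. \<forall>F.
     linear_on_set (bivectors \<A> p) F \<and>
     (\<forall>e. oriented_orthonormal_basis \<A> g p e \<longrightarrow> F (wedge (e 1) (e 2)) = wedge (e 3) (e 4))
     \<longrightarrow> b = F a)"

definition hodge_eigenspace :: "'m chart set \<Rightarrow> 'm metric \<Rightarrow> real \<Rightarrow> 'm \<Rightarrow> 'm tensor2 set" where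
  "hodge_eigenspace \<A> g s p = {a \<in> bivectors \<A> p. hodge_star \<A> g p a = s *\<^sub>R a}"

definition twistor_fibre :: "'m chart set \<Rightarrow> 'm metric \<Rightarrow> real \<Rightarrow> 'm \<Rightarrow> 'm tensor2 set" where
  "twistor_fibre \<A> g s p = {a \<in> hodge_eigenspace \<A> g s p. bivector_metric \<A> g p a a = 1}"

definition K_endo :: "'m chart set \<Rightarrow> 'm metric \<Rightarrow> 'm \<Rightarrow> 'm tensor2
    \<Rightarrow> ('m chart \<Rightarrow> real^4) \<Rightarrow> ('m chart \<Rightarrow> real^4)" where
  "K_endo \<A> g p a X = (THE Z. Z \<in> tangent_space \<A> p \<and>
     (\<forall>Y\<in>tangent_space \<A> p. g p Z Y = 2 * bivector_metric \<A> g p a (wedge X Y)))"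


section \<open>The product of the twistor spaces\<close>

type_synonym 'm twistor_point = "'m \<times> 'm tensor2 \<times> 'm tensor2"

definition twistor_product :: "'m set \<Rightarrow> 'm chart set \<Rightarrow> 'm metric \<Rightarrow> 'm twistor_point set" where
  "twistor_product M \<A> g =
     {(p, a, b). p \<in> M \<and> a \<in> twistor_fibre \<A> g 1 p \<and> b \<in> twistor_fibre \<A> g (-1) p}"

text \<open>
  A chart \<open>c\<close> of \<open>M\<close> induces a bundle chart on pairs of 2-tensors over its domain. Tangent vectors
  at a point of this bundle are given by the families of their components in the induced charts;
  the first component is the image under the differential of the bundle projection.
\<close>

type_synonym 'm bundle_vec = "'m chart \<Rightarrow> (real^4) \<times> (real^4^4) \<times> (real^4^4)"

definition bundle_chart :: "'m chart \<Rightarrow> 'm twistor_point \<Rightarrow> (real^4) \<times> (real^4^4) \<times> (real^4^4)" where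
  "bundle_chart c = (\<lambda>(p, a, b). (snd c p, a c, b c))"

definition base_part :: "'m bundle_vec \<Rightarrow> 'm chart \<Rightarrow> real^4" where
  "base_part \<xi> = (\<lambda>c. fst (\<xi> c))"

definition vert :: "'m tensor2 \<Rightarrow> 'm tensor2 \<Rightarrow> 'm bundle_vec" where
  "vert V W = (\<lambda>c. (0, V c, W c))"

text \<open>
  The connection matrix in the chart \<open>c\<close>: its column \<open>j\<close> holds the components of the covariant
  derivative of the \<open>j\<close>-th coordinate field in the direction \<open>v\<close>.
\<close>

definition connection_matrix :: "'m chart set \<Rightarrow> 'm connection \<Rightarrow> 'm chart \<Rightarrow> 'm
    \<Rightarrow> ('m chart \<Rightarrow> real^4) \<Rightarrow> real^4^4" where
  "connection_matrix \<A> D c p v = (\<chi> k j. D p v (coord_field \<A> c j) c $ k)"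

text \<open>
  By the Leibniz rule, the induced connection on 2-tensors \<open>\<Sum> a\<^sup>i\<^sup>j \<partial>\<^sub>i \<otimes> \<partial>\<^sub>j\<close> has components
  \<open>v(a) + \<omega>(v) a + a \<omega>(v)\<^sup>T\<close>, where \<open>\<omega>\<close> is the connection matrix. Hence the horizontal lift of \<open>X\<close> at
  the tensor \<open>a\<close>, i.e. the velocity of a section through \<open>a\<close> that is parallel in the direction \<open>X\<close>,
  has fibre component \<open>-(\<omega>(X) a + a \<omega>(X)\<^sup>T)\<close>.
\<close>

definition horizontal_component :: "real^4^4 \<Rightarrow> real^4^4 \<Rightarrow> real^4^4" where
  "horizontal_component \<omega> a = - (\<omega> ** a + a ** transpose \<omega>)"

definition hlift :: "'m chart set \<Rightarrow> 'm connection \<Rightarrow> 'm twistor_point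
    \<Rightarrow> ('m chart \<Rightarrow> real^4) \<Rightarrow> 'm bundle_vec" where
  "hlift \<A> D = (\<lambda>(p, a, b) X c. if c \<in> \<A> \<and> p \<in> fst c
     then (X c, horizontal_component (connection_matrix \<A> D c p X) (a c),
                horizontal_component (connection_matrix \<A> D c p X) (b c))
     else 0)"

definition horizontal_space :: "'m chart set \<Rightarrow> 'm connection \<Rightarrow> 'm twistor_point \<Rightarrow> 'm bundle_vec set" where
  "horizontal_space \<A> D \<kappa> = hlift \<A> D \<kappa> ` tangent_space \<A> (fst \<kappa>)"

definition vertical_space :: "'m chart set \<Rightarrow> 'm metric \<Rightarrow> 'm twistor_point \<Rightarrow> 'm bundle_vec set" where
  "vertical_space \<A> g = (\<lambda>(p, a, b).
     {vert V W |V W.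
        V \<in> hodge_eigenspace \<A> g 1 p \<and> bivector_metric \<A> g p V a = 0 \<and>
        W \<in> hodge_eigenspace \<A> g (-1) p \<and> bivector_metric \<A> g p W b = 0})"

definition twistor_tangent_space ::
    "'m chart set \<Rightarrow> 'm metric \<Rightarrow> 'm connection \<Rightarrow> 'm twistor_point \<Rightarrow> 'm bundle_vec set" where
  "twistor_tangent_space \<A> g D \<kappa> =
     {h + v |h v. h \<in> horizontal_space \<A> D \<kappa> \<and> v \<in> vertical_space \<A> g \<kappa>}"

text \<open>The twistor product in the chart induced by \<open>c\<close>, and the inverse of this chart on it.\<close>

definition twistor_dom :: "'m set \<Rightarrow> 'm chart set \<Rightarrow> 'm metric \<Rightarrow> 'm chart \<Rightarrow> 'm twistor_point set" where
  "twistor_dom M \<A> g c = {\<kappa> \<in> twistor_product M \<A> g. fst \<kappa> \<in> fst c}"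

definition twistor_image ::
    "'m set \<Rightarrow> 'm chart set \<Rightarrow> 'm metric \<Rightarrow> 'm chart \<Rightarrow> ((real^4) \<times> (real^4^4) \<times> (real^4^4)) set" where
  "twistor_image M \<A> g c = bundle_chart c ` twistor_dom M \<A> g c"

definition twistor_inv :: "'m set \<Rightarrow> 'm chart set \<Rightarrow> 'm metric \<Rightarrow> 'm chart
    \<Rightarrow> (real^4) \<times> (real^4^4) \<times> (real^4^4) \<Rightarrow> 'm twistor_point" where
  "twistor_inv M \<A> g c = inv_into (twistor_dom M \<A> g c) (bundle_chart c)"

definition twistor_vector_field :: "'m set \<Rightarrow> 'm chart set \<Rightarrow> 'm metric \<Rightarrow> 'm connection
    \<Rightarrow> ('m twistor_point \<Rightarrow> 'm bundle_vec) \<Rightarrow> bool" where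
  "twistor_vector_field M \<A> g D A \<longleftrightarrow>
     (\<forall>\<kappa>\<in>twistor_product M \<A> g. A \<kappa> \<in> twistor_tangent_space \<A> g D \<kappa>) \<and>
     (\<forall>c\<in>\<A>. smooth_on_subset (\<lambda>z. A (twistor_inv M \<A> g c z) c) (twistor_image M \<A> g c))"

text \<open>
  The Lie bracket of vector fields on the submanifold, in the induced charts. The derivatives are
  taken within the submanifold; they are applied only to vectors tangent to it, on which the
  derivative within the submanifold is uniquely determined.
\<close>

definition twistor_lie_bracket :: "'m set \<Rightarrow> 'm chart set \<Rightarrow> 'm metric
    \<Rightarrow> ('m twistor_point \<Rightarrow> 'm bundle_vec) \<Rightarrow> ('m twistor_point \<Rightarrow> 'm bundle_vec)
    \<Rightarrow> 'm twistor_point \<Rightarrow> 'm bundle_vec" where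
  "twistor_lie_bracket M \<A> g A B \<kappa> = (\<lambda>c. if c \<in> \<A> \<and> fst \<kappa> \<in> fst c
     then frechet_derivative (\<lambda>z. B (twistor_inv M \<A> g c z) c)
            (at (bundle_chart c \<kappa>) within twistor_image M \<A> g c) (A \<kappa> c)
        - frechet_derivative (\<lambda>z. A (twistor_inv M \<A> g c z) c)
            (at (bundle_chart c \<kappa>) within twistor_image M \<A> g c) (B \<kappa> c)
     else 0)"

definition nijenhuis :: "'m set \<Rightarrow> 'm chart set \<Rightarrow> 'm metric
    \<Rightarrow> ('m twistor_point \<Rightarrow> 'm bundle_vec \<Rightarrow> 'm bundle_vec)
    \<Rightarrow> ('m twistor_point \<Rightarrow> 'm bundle_vec) \<Rightarrow> ('m twistor_point \<Rightarrow> 'm bundle_vec)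
    \<Rightarrow> 'm twistor_point \<Rightarrow> 'm bundle_vec" where
  "nijenhuis M \<A> g P A B \<kappa> =
     twistor_lie_bracket M \<A> g A B \<kappa>
     + twistor_lie_bracket M \<A> g (\<lambda>\<tau>. P \<tau> (A \<tau>)) (\<lambda>\<tau>. P \<tau> (B \<tau>)) \<kappa>
     - P \<kappa> (twistor_lie_bracket M \<A> g (\<lambda>\<tau>. P \<tau> (A \<tau>)) B \<kappa>)
     - P \<kappa> (twistor_lie_bracket M \<A> g A (\<lambda>\<tau>. P \<tau> (B \<tau>)) \<kappa>)"

definition integrable_structure :: "'m set \<Rightarrow> 'm chart set \<Rightarrow> 'm metric \<Rightarrow> 'm connection
    \<Rightarrow> ('m twistor_point \<Rightarrow> 'm bundle_vec \<Rightarrow> 'm bundle_vec) \<Rightarrow> bool" where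
  "integrable_structure M \<A> g D P \<longleftrightarrow>
     (\<forall>A B. twistor_vector_field M \<A> g D A \<and> twistor_vector_field M \<A> g D B \<longrightarrow>
        (\<forall>\<kappa>\<in>twistor_product M \<A> g. nijenhuis M \<A> g P A B \<kappa> = 0))"

definition vertical_signs :: "nat \<Rightarrow> real \<times> real" where
  "vertical_signs \<nu> =
     (if \<nu> = 1 then (1, 1) else if \<nu> = 2 then (1, -1) else if \<nu> = 3 then (-1, -1) else (-1, 1))"

text \<open>
  The almost product structures, computed on \<open>\<xi>\<close> by splitting it into the horizontal lift of
  its base part and a vertical remainder; cf. the lemma below.
\<close>

definition almost_product :: "'m chart set \<Rightarrow> 'm metric \<Rightarrow> 'm connection \<Rightarrow> nat
    \<Rightarrow> 'm twistor_point \<Rightarrow> 'm bundle_vec \<Rightarrow> 'm bundle_vec" where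
  "almost_product \<A> g D \<nu> \<kappa> \<xi> =
     (let (p, a, b) = \<kappa>; X = base_part \<xi>; v = \<xi> - hlift \<A> D \<kappa> X
      in hlift \<A> D \<kappa> (K_endo \<A> g p a (K_endo \<A> g p b X))
         + vert (\<lambda>c. fst (vertical_signs \<nu>) *\<^sub>R fst (snd (v c)))
                (\<lambda>c. snd (vertical_signs \<nu>) *\<^sub>R snd (snd (v c))))"

lemma almost_product_hlift_vert:
  assumes "X \<in> tangent_space \<A> p"
  shows "almost_product \<A> g D \<nu> (p, a, b) (hlift \<A> D (p, a, b) X + vert V W) =
    hlift \<A> D (p, a, b) (K_endo \<A> g p a (K_endo \<A> g p b X))
    + vert (fst (vertical_signs \<nu>) *\<^sub>R V) (snd (vertical_signs \<nu>) *\<^sub>R W)"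
proof -
  have "base_part (hlift \<A> D (p, a, b) X + vert V W) = X"
    using assms by (auto simp: base_part_def hlift_def vert_def tangent_space_def fun_eq_iff)
  then show ?thesis
    by (simp add: almost_product_def Let_def vert_def scaleR_fun_def)
qed

end

theory Submission
  imports Defs "HOL-Computational_Algebra.Polynomial"
begin

text \<open>
  The mixed components of the Nijenhuis tensor never vanish, and no curvature is involved. Let
  \<open>V \<perp> \<sigma>\<^sup>+\<close> be vertical in the first factor, on which the structure acts by a sign \<open>\<epsilon>\<close>, and let
  \<open>Q = K\<^sub>\<sigma>\<^sub>+ K\<^sub>\<sigma>\<^sub>-\<close>. For the horizontal lift of \<open>X\<close> the horizontal part of \<open>N(V, X\<^sup>h)\<close> is
  \<open>(\<epsilon> - Q) K\<^sub>V K\<^sub>\<sigma>\<^sub>- X\<close>. Since \<open>K\<^sub>V K\<^sub>\<sigma>\<^sub>-\<close> is invertible for \<open>V \<noteq> 0\<close>, vanishing for all \<open>X\<close> would force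
  \<open>Q = \<epsilon>\<close>, whereas \<open>K\<^sub>\<sigma>\<^sub>+\<close> and \<open>K\<^sub>\<sigma>\<^sub>-\<close> lie in complementary ideals of the rotation algebra.
  Metric compatibility of the connection is used only to see that horizontal lifts are velocities of
  curves in the product of the twistor spaces.
\<close>

section \<open>Smooth maps\<close>

text \<open>The bracket is formed with derivatives within the image of the twistor product, and
  these are determined only on velocities of curves that stay in that image. So each vector fed into
  such a derivative needs a curve. The curves come from moving frames: a bivector with constant
  coefficients in a moving oriented orthonormal frame never leaves the twistor fibres, so it is
  enough to produce frames with a prescribed first-order motion (\<open>isometric_at\<close>).
  Integrability is tested on globally defined smooth fields, although the argument is pointwise.
  Vectors on \<open>M\<close> are therefore extended from a chart by a bump function. The vertical
  direction is written as the commutator of \<open>a\<close> with a bivector field from the base,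
  which is tangent to all fibres at once. The metric on bivectors, the Hodge star and
  \<open>K_endo\<close> are definite descriptions; existence and uniqueness are settled by matrix
  formulas in one chart before anything is computed.\<close>

lemma has_frechet_derivative:
  "f differentiable (at x) \<Longrightarrow> (f has_derivative frechet_derivative f (at x)) (at x)"
  by (simp add: frechet_derivative_works)

lemma Ck_on_subset: "Ck_on n f S \<Longrightarrow> T \<subseteq> S \<Longrightarrow> Ck_on n f T"
proof (induction n arbitrary: f)
  case 0 then show ?case by (auto intro: continuous_on_subset)
next
  case (Suc n) then show ?case by (simp; blast)
qed

text \<open>On an open set the values near a point fix the derivative there, so equality of the
  functions passes to \<open>frechet_derivative\<close> and the induction goes through.\<close>

lemma Ck_on_cong:
  assumes "open S" "\<And>x. x \<in> S \<Longrightarrow> f x = g x" "Ck_on n f S"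
  shows "Ck_on n g S"
  using assms(2,3)
proof (induction n arbitrary: f g)
  case 0 then show ?case using continuous_on_cong[of S S f g] by simp
next
  case (Suc n)
  have d: "(g has_derivative frechet_derivative f (at x)) (at x)" if "x \<in> S" for x
    using has_derivative_transform_within_open[OF _ \<open>open S\<close> that, of f "frechet_derivative f (at x)" UNIV g]
      Suc.prems that by (auto intro: has_frechet_derivative)
  have e: "frechet_derivative g (at x) = frechet_derivative f (at x)" if "x \<in> S" for x
    using frechet_derivative_at[OF d[OF that]] by simp
  have "Ck_on n (\<lambda>x. frechet_derivative g (at x) v) S" for v
    by (rule Suc.IH[of "\<lambda>x. frechet_derivative f (at x) v"]) (use Suc.prems in \<open>auto simp: e\<close>)
  with d show ?case by (auto simp: differentiable_def)
qed

text \<open>By uniqueness of derivatives an explicit formula may replace the choice made by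
  \<open>frechet_derivative\<close>. The rules for sums, products and compositions are proved in
  this form.\<close>

lemma Ck_on_SucI:
  assumes "open S" "\<And>x. x \<in> S \<Longrightarrow> (f has_derivative f' x) (at x)"
    and "\<And>v. Ck_on n (\<lambda>x. f' x v) S"
  shows "Ck_on (Suc n) f S"
proof -
  have "Ck_on n (\<lambda>x. frechet_derivative f (at x) v) S" for v
    by (rule Ck_on_cong[OF assms(1) _ assms(3)[of v]]) (simp flip: frechet_derivative_at[OF assms(2)])
  with assms(2) show ?thesis by (auto simp: differentiable_def)
qed

lemma Ck_on_continuous: "Ck_on n f S \<Longrightarrow> continuous_on S f"
  by (cases n)
    (auto intro!: continuous_at_imp_continuous_on differentiable_imp_continuous_within)

lemma Ck_on_Suc: "Ck_on (Suc n) f S \<Longrightarrow> Ck_on n f S"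
proof (induction n arbitrary: f)
  case 0 then show ?case using Ck_on_continuous[of "Suc 0"] by simp
next
  case (Suc n) then show ?case by (metis Ck_on.simps(2))
qed

lemma Ck_on_const: "Ck_on n (\<lambda>x. c) S"
  by (induction n arbitrary: c) auto

lemma Ck_on_add:
  assumes "open S" "Ck_on n f S" "Ck_on n g S"
  shows "Ck_on n (\<lambda>x. f x + g x) S"
  using assms(2,3)
proof (induction n arbitrary: f g)
  case 0 then show ?case by (auto intro: continuous_intros)
next
  case (Suc n)
  show ?case
    using Suc.prems
    by (intro Ck_on_SucI[where f'="\<lambda>x v. frechet_derivative f (at x) v + frechet_derivative g (at x) v"]
        \<open>open S\<close> Suc.IH) (auto intro!: has_derivative_add has_frechet_derivative)
qed

text \<open>The Leibniz rule gives two summands, each with an undifferentiated factor of one order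
  more than required; \<open>Ck_on_Suc\<close> lowers it. Matrix products, scalar multiples and
  inner products are instances.\<close>

lemma Ck_on_bilinear:
  assumes "bounded_bilinear b" "open S" "Ck_on n f S" "Ck_on n g S"
  shows "Ck_on n (\<lambda>x. b (f x) (g x)) S"
  using assms(3,4)
proof (induction n arbitrary: f g)
  case 0 then show ?case using bounded_bilinear.continuous_on[OF assms(1)] by simp
next
  case (Suc n)
  show ?case
  proof (rule Ck_on_SucI[OF \<open>open S\<close>])
    fix x assume "x \<in> S"
    with Suc.prems show "((\<lambda>x. b (f x) (g x)) has_derivative
      (\<lambda>v. b (f x) (frechet_derivative g (at x) v) + b (frechet_derivative f (at x) v) (g x))) (at x)"
      by (auto intro!: bounded_bilinear.FDERIV[OF assms(1)] has_frechet_derivative)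
  next
    fix v
    show "Ck_on n (\<lambda>x. b (f x) (frechet_derivative g (at x) v) + b (frechet_derivative f (at x) v) (g x)) S"
      using Suc.prems Ck_on_Suc[of n f S] Ck_on_Suc[of n g S]
      by (intro Ck_on_add \<open>open S\<close> Suc.IH) auto
  qed
qed

lemma Ck_on_linear:
  assumes "bounded_linear L" "open S" "Ck_on n f S"
  shows "Ck_on n (\<lambda>x. L (f x)) S"
  using assms(3)
proof (induction n arbitrary: f)
  case 0 then show ?case using bounded_linear.continuous_on[OF assms(1)] by simp
next
  case (Suc n)
  show ?case
    using Suc.prems
    by (intro Ck_on_SucI[where f'="\<lambda>x v. L (frechet_derivative f (at x) v)"] \<open>open S\<close> Suc.IH)
      (auto intro!: bounded_linear.has_derivative[OF assms(1)] has_frechet_derivative)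
qed

lemma Ck_on_ident: "open S \<Longrightarrow> Ck_on n (\<lambda>x. x) S"
proof (induction n)
  case (Suc n)
  then show ?case
    by (intro Ck_on_SucI[where f'="\<lambda>x v. v"]) (auto intro: Ck_on_const)
qed auto

lemma Ck_on_sum:
  assumes "open S" "\<And>i. i \<in> I \<Longrightarrow> Ck_on n (f i) S"
  shows "Ck_on n (\<lambda>x. \<Sum>i\<in>I. f i x) S"
  using assms(2)
  by (induction I rule: infinite_finite_induct) (auto intro: Ck_on_const Ck_on_add[OF assms(1)])

text \<open>The chain rule yields a linear map depending on \<open>x\<close>, evaluated at a vector
  depending on \<open>x\<close>. Expanding that vector in the basis turns this into a finite sum of
  scalar functions times directional derivatives of \<open>f\<close> composed with \<open>g\<close>,
  to which the induction hypothesis applies.\<close>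

lemma Ck_on_compose:
  assumes "open S" "open T" "g ` S \<subseteq> T" "Ck_on n f T" "Ck_on n g S"
  shows "Ck_on n (\<lambda>x. f (g x)) S"
  using assms(4,5)
proof (induction n arbitrary: f)
  case 0 then show ?case
    using continuous_on_compose2[of T f S g] assms(3) by auto
next
  case (Suc n)
  show ?case
  proof (rule Ck_on_SucI[OF \<open>open S\<close>])
    fix x assume "x \<in> S"
    then have gx: "(g has_derivative frechet_derivative g (at x)) (at x)"
      and fg: "(f has_derivative frechet_derivative f (at (g x))) (at (g x))"
      using Suc.prems assms(3) by (auto intro!: has_frechet_derivative)
    have lin: "linear (frechet_derivative f (at (g x)))"
      using fg has_derivative_linear by blast
    have eq: "frechet_derivative f (at (g x)) w
        = (\<Sum>b\<in>Basis. (w \<bullet> b) *\<^sub>R frechet_derivative f (at (g x)) b)" for w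
    proof -
      have "frechet_derivative f (at (g x)) w = frechet_derivative f (at (g x)) (\<Sum>b\<in>Basis. (w \<bullet> b) *\<^sub>R b)"
        by (simp only: euclidean_representation)
      also have "\<dots> = (\<Sum>b\<in>Basis. (w \<bullet> b) *\<^sub>R frechet_derivative f (at (g x)) b)"
        by (simp only: linear_sum[OF lin] linear_scale[OF lin])
      finally show ?thesis .
    qed
    have eq2: "(\<lambda>v. \<Sum>b\<in>Basis. (frechet_derivative g (at x) v \<bullet> b) *\<^sub>R frechet_derivative f (at (g x)) b)
        = frechet_derivative f (at (g x)) \<circ> frechet_derivative g (at x)"
      by (rule ext) (simp only: o_apply eq[symmetric])
    show "((\<lambda>x. f (g x)) has_derivative
      (\<lambda>v. \<Sum>b\<in>Basis. (frechet_derivative g (at x) v \<bullet> b) *\<^sub>R frechet_derivative f (at (g x)) b)) (at x)"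
      unfolding eq2 using diff_chain_at[OF gx fg] by (simp only: comp_def)
  next
    fix v
    have "Ck_on n (\<lambda>x. frechet_derivative g (at x) v \<bullet> b) S" for b
      using Suc.prems by (intro Ck_on_linear[OF bounded_linear_inner_left] \<open>open S\<close>) auto
    moreover have "Ck_on n (\<lambda>x. frechet_derivative f (at (g x)) b) S" for b
      by (rule Suc.IH) (use Suc.prems Ck_on_Suc[of n g S] in auto)
    ultimately show "Ck_on n (\<lambda>x. \<Sum>b\<in>Basis. (frechet_derivative g (at x) v \<bullet> b) *\<^sub>R
        frechet_derivative f (at (g x)) b) S"
      by (intro Ck_on_sum Ck_on_bilinear[OF bounded_bilinear_scaleR] \<open>open S\<close>)
  qed
qed

text \<open>Needed for fields extended by zero, whose smoothness is seen on different neighbourhoods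
  inside and outside the support.\<close>

lemma Ck_on_local:
  assumes "\<And>x. x \<in> S \<Longrightarrow> \<exists>W. open W \<and> x \<in> W \<and> Ck_on n f W"
  shows "Ck_on n f S"
  using assms
proof (induction n arbitrary: f)
  case 0
  have "continuous (at x) f" if x: "x \<in> S" for x
    using 0[OF x] continuous_on_eq_continuous_at by fastforce
  then show ?case by (auto intro: continuous_at_imp_continuous_on)
next
  case (Suc n)
  have *: "\<exists>W. open W \<and> x \<in> W \<and> f differentiable (at x) \<and>
      (\<forall>v. Ck_on n (\<lambda>x. frechet_derivative f (at x) v) W)" if x: "x \<in> S" for x
  proof -
    obtain W where "open W" "x \<in> W" "Ck_on (Suc n) f W" using Suc.prems[OF x] by blast
    then show ?thesis by (intro exI[of _ W]) simp
  qed
  have "Ck_on n (\<lambda>x. frechet_derivative f (at x) v) S" for v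
  proof (rule Suc.IH)
    fix x assume "x \<in> S"
    then show "\<exists>W. open W \<and> x \<in> W \<and> Ck_on n (\<lambda>x. frechet_derivative f (at x) v) W"
      using *[of x] by blast
  qed
  moreover have "f differentiable (at x)" if "x \<in> S" for x
    using *[OF that] by blast
  ultimately show ?case by simp
qed

lemma smooth_on_subset': "smooth_on f S \<Longrightarrow> T \<subseteq> S \<Longrightarrow> smooth_on f T"
  unfolding smooth_on_def using Ck_on_subset by blast

lemma smooth_on_cong:
  "open S \<Longrightarrow> (\<And>x. x \<in> S \<Longrightarrow> f x = g x) \<Longrightarrow> smooth_on f S \<Longrightarrow> smooth_on g S"
  unfolding smooth_on_def using Ck_on_cong by blast

lemma smooth_on_const: "smooth_on (\<lambda>x. c) S"
  unfolding smooth_on_def using Ck_on_const by blast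

lemma smooth_on_ident: "open S \<Longrightarrow> smooth_on (\<lambda>x. x) S"
  unfolding smooth_on_def using Ck_on_ident by blast

lemma smooth_on_add: "open S \<Longrightarrow> smooth_on f S \<Longrightarrow> smooth_on g S \<Longrightarrow> smooth_on (\<lambda>x. f x + g x) S"
  unfolding smooth_on_def using Ck_on_add by blast

lemma smooth_on_bilinear:
  "bounded_bilinear b \<Longrightarrow> open S \<Longrightarrow> smooth_on f S \<Longrightarrow> smooth_on g S \<Longrightarrow> smooth_on (\<lambda>x. b (f x) (g x)) S"
  unfolding smooth_on_def using Ck_on_bilinear by blast

lemma smooth_on_linear:
  "bounded_linear L \<Longrightarrow> open S \<Longrightarrow> smooth_on f S \<Longrightarrow> smooth_on (\<lambda>x. L (f x)) S"
  unfolding smooth_on_def using Ck_on_linear by blast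

lemma smooth_on_diff: "open S \<Longrightarrow> smooth_on f S \<Longrightarrow> smooth_on g S \<Longrightarrow> smooth_on (\<lambda>x. f x - g x) S"
  using smooth_on_add[of S f "\<lambda>x. - g x"] smooth_on_linear[of uminus S g]
  by (simp add: bounded_linear_minus bounded_linear_ident)

lemma smooth_on_sum:
  "open S \<Longrightarrow> (\<And>i. i \<in> I \<Longrightarrow> smooth_on (f i) S) \<Longrightarrow> smooth_on (\<lambda>x. \<Sum>i\<in>I. f i x) S"
  unfolding smooth_on_def by (rule allI, rule Ck_on_sum) simp_all

lemma smooth_on_compose:
  "open S \<Longrightarrow> open T \<Longrightarrow> g ` S \<subseteq> T \<Longrightarrow> smooth_on f T \<Longrightarrow> smooth_on g S \<Longrightarrow> smooth_on (\<lambda>x. f (g x)) S"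
  unfolding smooth_on_def by (rule allI, rule Ck_on_compose[of S T]) simp_all

lemma smooth_on_local:
  "(\<And>x. x \<in> S \<Longrightarrow> \<exists>W. open W \<and> x \<in> W \<and> smooth_on f W) \<Longrightarrow> smooth_on f S"
  unfolding smooth_on_def by (rule allI, rule Ck_on_local) blast

lemma smooth_on_differentiable: "smooth_on f S \<Longrightarrow> x \<in> S \<Longrightarrow> f differentiable (at x)"
  unfolding smooth_on_def by (metis Ck_on.simps(2))

lemma smooth_on_derivative: "smooth_on f S \<Longrightarrow> smooth_on (\<lambda>x. frechet_derivative f (at x) v) S"
  unfolding smooth_on_def by (metis Ck_on.simps(2))

lemma smooth_on_euclidean_iff:
  fixes f :: "'a::euclidean_space \<Rightarrow> 'b::euclidean_space"
  assumes "open S"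
  shows "smooth_on f S \<longleftrightarrow> (\<forall>b\<in>Basis. smooth_on (\<lambda>x. f x \<bullet> b) S)"
proof
  show "smooth_on f S \<Longrightarrow> \<forall>b\<in>Basis. smooth_on (\<lambda>x. f x \<bullet> b) S"
    by (rule ballI) (rule smooth_on_linear[OF bounded_linear_inner_left assms])
next
  assume "\<forall>b\<in>Basis. smooth_on (\<lambda>x. f x \<bullet> b) S"
  then have "smooth_on (\<lambda>x. \<Sum>b\<in>Basis. (f x \<bullet> b) *\<^sub>R b) S"
    by (intro smooth_on_sum[OF assms] smooth_on_bilinear[OF bounded_bilinear_scaleR assms] smooth_on_const) simp
  then show "smooth_on f S" by (simp add: euclidean_representation)
qed

lemma smooth_on_vec_iff:
  fixes f :: "'a::euclidean_space \<Rightarrow> 'b::euclidean_space ^ 'n"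
  assumes "open S"
  shows "smooth_on f S \<longleftrightarrow> (\<forall>i. smooth_on (\<lambda>x. f x $ i) S)"
proof -
  have "smooth_on (\<lambda>x. f x \<bullet> e) S" if e: "e \<in> Basis" and f: "\<forall>i. smooth_on (\<lambda>x. f x $ i) S" for e
  proof -
    obtain i b where ib: "e = axis i b" "b \<in> Basis"
      using e by (auto simp: Basis_vec_def)
    show ?thesis
      using f[rule_format, of i] ib smooth_on_euclidean_iff[OF assms, of "\<lambda>x. f x $ i"]
      by (simp add: inner_axis)
  qed
  then have "smooth_on f S" if "\<forall>i. smooth_on (\<lambda>x. f x $ i) S"
    using that smooth_on_euclidean_iff[OF assms, of f] by blast
  moreover have "smooth_on (\<lambda>x. f x $ i) S" if "smooth_on f S" for i
    by (rule smooth_on_linear[OF bounded_linear_vec_nth assms that])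
  ultimately show ?thesis by blast
qed

lemma smooth_on_Pair:
  assumes "open S" "smooth_on f S" "smooth_on g S"
  shows "smooth_on (\<lambda>x. (f x, g x)) S"
proof -
  have "smooth_on (\<lambda>x. (f x, 0) + (0, g x)) S"
    using assms by (intro smooth_on_add smooth_on_linear[of "\<lambda>y. (y, 0)"] smooth_on_linear[of "\<lambda>y. (0, y)"]
        bounded_linear_Pair bounded_linear_ident bounded_linear_zero)
  then show ?thesis by simp
qed

section \<open>Matrix operations as bounded linear and bilinear maps\<close>

lemma matrix_scaleR_left: "(r *\<^sub>R A) ** B = r *\<^sub>R (A ** (B :: real^'k^'n))" for A :: "real^'n^'m"
  by (simp add: matrix_matrix_mult_def vec_eq_iff sum_distrib_left mult.assoc)

lemma matrix_scaleR_right: "A ** (r *\<^sub>R B) = r *\<^sub>R (A ** (B :: real^'k^'n))" for A :: "real^'n^'m"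
  by (simp add: matrix_matrix_mult_def vec_eq_iff sum_distrib_left mult.left_commute)

lemma matrix_add_rdistrib': "(A + B) ** C = A ** C + B ** (C :: real^'k^'n)" for A :: "real^'n^'m"
  by (simp add: matrix_matrix_mult_def vec_eq_iff sum.distrib distrib_right)

lemma bounded_bilinear_matrix_mult:
  "bounded_bilinear (\<lambda>(A::real^'n^'m) (B::real^'k^'n). A ** B)"
proof -
  have "linear (\<lambda>B. A ** B)" for A :: "real^'n^'m" and B :: "real^'k^'n"
    by (rule linearI) (simp_all add: matrix_add_ldistrib matrix_scaleR_right)
  moreover have "linear (\<lambda>A. A ** B)" for A :: "real^'n^'m" and B :: "real^'k^'n"
    by (rule linearI) (simp_all add: matrix_add_rdistrib' matrix_scaleR_left)
  ultimately have "bilinear (\<lambda>(A::real^'n^'m) (B::real^'k^'n). A ** B)"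
    unfolding bilinear_def by blast
  then show ?thesis by (simp add: bilinear_conv_bounded_bilinear)
qed

lemma bounded_linear_transpose: "bounded_linear (transpose :: real^'n^'m \<Rightarrow> real^'m^'n)"
  unfolding linear_conv_bounded_linear[symmetric] by (rule linearI) (auto simp: transpose_def vec_eq_iff)

lemma bounded_bilinear_matrix_vector: "bounded_bilinear (\<lambda>(A::real^'n^'m) x. A *v x)"
proof -
  have "linear (\<lambda>x. A *v x)" for A :: "real^'n^'m"
    by (rule matrix_vector_mul_linear)
  moreover have "linear (\<lambda>A. A *v x)" for x :: "real^'n" and A :: "real^'n^'m"
    by (rule linearI) (simp_all add: matrix_vector_mult_add_rdistrib scaleR_matrix_vector_assoc[symmetric])
  ultimately have "bilinear (\<lambda>(A::real^'n^'m) x. A *v x)"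
    unfolding bilinear_def by blast
  then show ?thesis by (simp add: bilinear_conv_bounded_bilinear)
qed

lemmas smooth_on_mult = smooth_on_bilinear[OF bounded_bilinear_mult]
lemmas smooth_on_scaleR = smooth_on_bilinear[OF bounded_bilinear_scaleR]
lemmas smooth_on_matrix_mult = smooth_on_bilinear[OF bounded_bilinear_matrix_mult]
lemmas smooth_on_matrix_vector = smooth_on_bilinear[OF bounded_bilinear_matrix_vector]
lemmas smooth_on_transpose = smooth_on_linear[OF bounded_linear_transpose]

text \<open>Derivatives of \<open>exp (-1/t)\<close> stay in the class of functions \<open>p(1/t) exp (-1/t)\<close>.\<close>

definition flat :: "real poly \<Rightarrow> real \<Rightarrow> real" where
  "flat p t = (if t > 0 then poly p (1 / t) * exp (- (1 / t)) else 0)"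

lemma poly_exp_tendsto_0: "((\<lambda>x::real. poly p x * exp (- x)) \<longlongrightarrow> 0) at_top"
proof -
  have "((\<lambda>x. \<Sum>i\<le>degree p. coeff p i * (x ^ i / exp x)) \<longlongrightarrow> (\<Sum>i\<le>degree p. coeff p i * 0)) at_top"
    by (intro tendsto_intros tendsto_power_div_exp_0)
  then show ?thesis
    by (simp add: poly_altdef sum_distrib_right exp_minus divide_inverse mult.assoc)
qed

text \<open>From the right, the reciprocal of \<open>t\<close> turns the claim into the decay of a
  polynomial times an exponential at infinity; from the left the function is zero.\<close>

lemma flat_tendsto_0: "(flat p \<longlongrightarrow> 0) (at 0)"
proof -
  have "((\<lambda>t. poly p (inverse t) * exp (- inverse t)) \<longlongrightarrow> 0) (at_right 0)"
    by (rule filterlim_compose[OF poly_exp_tendsto_0 filterlim_inverse_at_top_right])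
  then have "(flat p \<longlongrightarrow> 0) (at_right 0)"
    by (rule Lim_transform_eventually) (auto simp: eventually_at_filter flat_def inverse_eq_divide)
  moreover have "(flat p \<longlongrightarrow> 0) (at_left 0)"
    by (rule Lim_transform_eventually[OF tendsto_const]) (auto simp: eventually_at_filter flat_def)
  ultimately show ?thesis by (simp add: filterlim_at_split)
qed

text \<open>The factor \<open>monom 1 2\<close> is the 1/t^2 common to the derivatives of
  \<open>poly p (1/t)\<close> and of the exponential. The former carries a minus sign and the latter
  does not, hence \<open>p - pderiv p\<close>.\<close>

lemma flat_has_derivative:
  "(flat p has_derivative (\<lambda>v. v * flat (monom 1 2 * (p - pderiv p)) t)) (at t)"
proof -
  consider "t > 0" | "t = 0" | "t < 0" by linarith
  then have "(flat p has_field_derivative flat (monom 1 2 * (p - pderiv p)) t) (at t)"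
  proof cases
    case 1
    have "((\<lambda>t. poly p (1 / t) * exp (- (1 / t))) has_field_derivative
        flat (monom 1 2 * (p - pderiv p)) t) (at t)"
    proof -
      have d: "((\<lambda>t. 1 / t) has_field_derivative - ((1 / t) ^ 2)) (at t)"
        using DERIV_inverse[of t UNIV] 1 by (simp add: inverse_eq_divide power2_eq_square)
      have "((\<lambda>t. poly p (1 / t) * exp (- (1 / t))) has_field_derivative
          poly (pderiv p) (1 / t) * (- ((1 / t) ^ 2)) * exp (- (1 / t))
          + exp (- (1 / t)) * (- (- ((1 / t) ^ 2))) * poly p (1 / t)) (at t)"
        by (rule DERIV_mult[OF DERIV_chain2[OF poly_DERIV d] DERIV_fun_exp[OF DERIV_minus[OF d]]])
      moreover have "poly (pderiv p) (1 / t) * (- ((1 / t) ^ 2)) * exp (- (1 / t))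
          + exp (- (1 / t)) * (- (- ((1 / t) ^ 2))) * poly p (1 / t) = flat (monom 1 2 * (p - pderiv p)) t"
        using 1 by (simp add: flat_def poly_monom algebra_simps)
      ultimately show ?thesis by simp
    qed
    then show ?thesis
      by (rule has_field_derivative_transform_within_open[where S="{0<..}"])
        (use 1 in \<open>auto simp: flat_def\<close>)
  next
    case 2
    \<comment> \<open>The difference quotient at 0 stays in the class: its polynomial is
      \<open>p\<close> multiplied by the variable.\<close>
    have "((\<lambda>h. flat p h / h) \<longlongrightarrow> 0) (at 0)"
      by (rule Lim_transform_eventually[OF flat_tendsto_0[of "pCons 0 p"]])
        (auto simp: eventually_at_filter flat_def)
    then show ?thesis using 2 by (simp add: DERIV_def flat_def)
  next
    case 3
    show ?thesis
      by (rule has_field_derivative_transform_within_open[where S="{..<0}" and f="\<lambda>_. 0"])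
        (use 3 in \<open>auto simp: flat_def\<close>)
  qed
  then show ?thesis by (simp add: has_field_derivative_def mult_commute_abs)
qed

lemma Ck_on_flat: "Ck_on n (flat p) UNIV"
proof (induction n arbitrary: p)
  case 0
  show ?case
    using has_derivative_continuous[OF flat_has_derivative] by (simp add: continuous_at_imp_continuous_on)
next
  case (Suc n)
  show ?case
    by (rule Ck_on_SucI[OF open_UNIV flat_has_derivative])
      (rule Ck_on_linear[OF bounded_linear_mult_right open_UNIV Suc.IH])
qed

lemma smooth_bump:
  fixes x0 :: "'a::euclidean_space"
  assumes "r > 0"
  obtains \<phi> :: "'a \<Rightarrow> real"
  where "smooth_on \<phi> UNIV" "\<phi> x0 = 1" "\<And>x. x \<notin> cball x0 r \<Longrightarrow> \<phi> x = 0"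
proof
  \<comment> \<open>Positive exactly on the open ball. The value at the centre is exp (-1/r^2),
    which explains the normalising factor below.\<close>
  let ?f = "\<lambda>x. flat 1 (r\<^sup>2 - (x - x0) \<bullet> (x - x0))"
  have "smooth_on (\<lambda>x. r\<^sup>2 - (x - x0) \<bullet> (x - x0)) UNIV"
    by (intro smooth_on_diff smooth_on_const smooth_on_bilinear[OF bounded_bilinear_inner]
        smooth_on_ident open_UNIV)
  then have f: "smooth_on ?f UNIV"
    using smooth_on_compose[OF open_UNIV open_UNIV subset_UNIV, of "flat 1"] Ck_on_flat
    unfolding smooth_on_def by blast
  show "smooth_on (\<lambda>x. inverse (exp (- (1 / r\<^sup>2))) * ?f x) UNIV"
    by (rule smooth_on_mult[OF open_UNIV smooth_on_const f])
  show "inverse (exp (- (1 / r\<^sup>2))) * ?f x0 = 1"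
    using assms by (simp add: flat_def)
  fix x assume "x \<notin> cball x0 r"
  then have "r < norm (x - x0)" by (simp add: dist_norm norm_minus_commute)
  with assms have "r\<^sup>2 < (norm (x - x0))\<^sup>2" by (intro power_strict_mono) auto
  then show "inverse (exp (- (1 / r\<^sup>2))) * ?f x = 0"
    by (simp add: flat_def power2_norm_eq_inner)
qed

section \<open>Linear algebra of skew matrices in dimension four\<close>

lemma inner_matrix_mult_left: "X \<bullet> (A ** Y) = (transpose A ** X) \<bullet> (Y :: real^'k^'n)" for A :: "real^'n^'m"
proof -
  have "X \<bullet> (A ** Y) = (\<Sum>i\<in>UNIV. \<Sum>j\<in>UNIV. \<Sum>k\<in>UNIV. X$i$j * (A$i$k * Y$k$j))"
    by (simp add: inner_vec_def matrix_matrix_mult_def sum_distrib_left)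
  also have "\<dots> = (\<Sum>j\<in>UNIV. \<Sum>k\<in>UNIV. \<Sum>i\<in>UNIV. X$i$j * (A$i$k * Y$k$j))"
    by (subst sum.swap, rule sum.cong[OF refl], rule sum.swap)
  also have "\<dots> = (\<Sum>k\<in>UNIV. \<Sum>j\<in>UNIV. \<Sum>i\<in>UNIV. X$i$j * (A$i$k * Y$k$j))"
    by (rule sum.swap)
  also have "\<dots> = (transpose A ** X) \<bullet> Y"
    by (simp add: inner_vec_def matrix_matrix_mult_def transpose_def sum_distrib_right sum_distrib_left mult_ac)
  finally show ?thesis .
qed

lemma inner_transpose: "transpose X \<bullet> transpose Y = X \<bullet> (Y :: real^'n^'m)"
  by (simp add: inner_vec_def transpose_def) (rule sum.swap)

lemma inner_matrix_mult_right: "X \<bullet> (Y ** B) = (X ** transpose B) \<bullet> (Y :: real^'n^'m)" for B :: "real^'k^'n"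
  using inner_matrix_mult_left[of "transpose X" "transpose B" "transpose Y"]
  by (simp add: inner_transpose flip: matrix_transpose_mul)
    (metis inner_transpose matrix_transpose_mul transpose_transpose)

lemma norm_transpose: "norm (transpose X) = norm (X :: real^'n^'m)"
  by (simp add: norm_eq_sqrt_inner inner_transpose)

lemma transpose_add: "transpose (X + Y) = transpose X + transpose (Y :: real^'n^'m)"
  by (simp add: transpose_def vec_eq_iff)

lemma transpose_diff: "transpose (X - Y) = transpose X - transpose (Y :: real^'n^'m)"
  by (simp add: transpose_def vec_eq_iff)

lemma transpose_minus: "transpose (- X) = - transpose (X :: real^'n^'m)"
  by (simp add: transpose_def vec_eq_iff)

lemma transpose_scaleR: "transpose (r *\<^sub>R X) = r *\<^sub>R transpose (X :: real^'n^'m)"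
  by (simp add: transpose_def vec_eq_iff)

lemma matrix_minus_left: "(- X) ** Y = - (X ** (Y :: real^'k^'n))" for X :: "real^'n^'m"
  by (simp add: matrix_matrix_mult_def vec_eq_iff sum_negf)

lemma matrix_minus_right: "X ** (- Y) = - (X ** (Y :: real^'k^'n))" for X :: "real^'n^'m"
  by (simp add: matrix_matrix_mult_def vec_eq_iff sum_negf)

lemma matrix_diff_left: "(X - Z) ** Y = X ** Y - Z ** (Y :: real^'k^'n)" for X :: "real^'n^'m"
  by (simp add: matrix_matrix_mult_def vec_eq_iff sum_subtractf left_diff_distrib)

lemma matrix_diff_right: "Y ** (X - Z) = Y ** X - Y ** (Z :: real^'k^'n)" for Y :: "real^'n^'m"
  by (simp add: matrix_matrix_mult_def vec_eq_iff sum_subtractf right_diff_distrib)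

lemmas matrix_linear_simps =
  matrix_add_ldistrib matrix_add_rdistrib' matrix_diff_left matrix_diff_right matrix_minus_left
  matrix_minus_right matrix_scaleR_left matrix_scaleR_right transpose_add transpose_diff
  transpose_minus transpose_scaleR matrix_transpose_mul matrix_mul_assoc

lemma matrix_eq_via_vectors: "(\<And>x. A *v x = B *v x) \<Longrightarrow> A = (B :: real^'n^'m)"
  by (simp add: matrix_eq)

text \<open>Expansion along the first row. The explicit polynomial serves an identity for the Hodge
  star, a change of sign in one column and the continuity of the determinant along a curve.\<close>

lemma det_4:
  "det (A::real^4^4) =
    A$1$1 * (A$2$2 * (A$3$3 * A$4$4 - A$3$4 * A$4$3) - A$2$3 * (A$3$2 * A$4$4 - A$3$4 * A$4$2)
      + A$2$4 * (A$3$2 * A$4$3 - A$3$3 * A$4$2))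
  - A$1$2 * (A$2$1 * (A$3$3 * A$4$4 - A$3$4 * A$4$3) - A$2$3 * (A$3$1 * A$4$4 - A$3$4 * A$4$1)
      + A$2$4 * (A$3$1 * A$4$3 - A$3$3 * A$4$1))
  + A$1$3 * (A$2$1 * (A$3$2 * A$4$4 - A$3$4 * A$4$2) - A$2$2 * (A$3$1 * A$4$4 - A$3$4 * A$4$1)
      + A$2$4 * (A$3$1 * A$4$2 - A$3$2 * A$4$1))
  - A$1$4 * (A$2$1 * (A$3$2 * A$4$3 - A$3$3 * A$4$2) - A$2$2 * (A$3$1 * A$4$3 - A$3$3 * A$4$1)
      + A$2$3 * (A$3$1 * A$4$2 - A$3$2 * A$4$1))"
proof -
  have f: "finite {2::4,3,4}" "1 \<notin> {2::4,3,4}"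
    "finite {3::4,4}" "2 \<notin> {3::4,4}" "finite {4::4}" "3 \<notin> {4::4}" by auto
  show ?thesis
    unfolding det_def UNIV_4
    unfolding sum_over_permutations_insert[OF f(1,2)]
    unfolding sum_over_permutations_insert[OF f(3,4)]
    unfolding sum_over_permutations_insert[OF f(5,6)]
    unfolding permutes_sing
    by (simp add: sign_swap_id permutation_swap_id permutation_compose sign_compose sign_id swap_id_eq algebra_simps)
qed

section \<open>The Hodge star of Euclidean four-space on skew matrices\<close>

definition wedge4 :: "real^4 \<Rightarrow> real^4 \<Rightarrow> real^4^4" where
  "wedge4 x y = (\<chi> i j. x$i * y$j - x$j * y$i)"

definition skew :: "real^4^4 \<Rightarrow> bool" where
  "skew a \<longleftrightarrow> transpose a = - a"

text \<open>Hodge star of the standard oriented basis: the coefficients in the pairs (12,34),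
  (13,42), (14,23) are exchanged. Below the diagonal the source indices are reversed, so skew
  matrices stay skew without explicit signs.\<close>

definition star4 :: "real^4^4 \<Rightarrow> real^4^4" where
  "star4 a = (\<chi> i j.
     if i = 1 then (if j = 1 then 0 else if j = 2 then a$3$4 else if j = 3 then a$4$2 else a$2$3)
     else if i = 2 then (if j = 1 then a$4$3 else if j = 2 then 0 else if j = 3 then a$1$4 else a$3$1)
     else if i = 3 then (if j = 1 then a$2$4 else if j = 2 then a$4$1 else if j = 3 then 0 else a$1$2)
     else (if j = 1 then a$3$2 else if j = 2 then a$1$3 else if j = 3 then a$2$1 else 0))"

lemma star4_nth:
  "star4 a $1$1 = 0" "star4 a $1$2 = a$3$4" "star4 a $1$3 = a$4$2" "star4 a $1$4 = a$2$3"
  "star4 a $2$1 = a$4$3" "star4 a $2$2 = 0" "star4 a $2$3 = a$1$4" "star4 a $2$4 = a$3$1"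
  "star4 a $3$1 = a$2$4" "star4 a $3$2 = a$4$1" "star4 a $3$3 = 0" "star4 a $3$4 = a$1$2"
  "star4 a $4$1 = a$3$2" "star4 a $4$2 = a$1$3" "star4 a $4$3 = a$2$1" "star4 a $4$4 = 0"
  by (simp_all add: star4_def)

lemma star4_add: "star4 (a + b) = star4 a + star4 b"
  by (simp add: star4_def vec_eq_iff)

lemma star4_scaleR: "star4 (r *\<^sub>R a) = r *\<^sub>R star4 a"
  by (simp add: star4_def vec_eq_iff)

lemma skew_iff: "skew a \<longleftrightarrow> (\<forall>i j. a$i$j = - a$j$i)"
  by (auto simp: skew_def transpose_def vec_eq_iff)

lemma skew_wedge4: "skew (wedge4 x y)"
  by (simp add: skew_iff wedge4_def)

lemma skew_conj: "skew a \<Longrightarrow> skew (A ** a ** transpose A)"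
  by (simp add: skew_def matrix_linear_simps)

lemma skew_zero: "skew 0" by (simp add: skew_iff)

lemma skew_commutator: "skew a \<Longrightarrow> skew b \<Longrightarrow> skew (a ** b - b ** a)"
  by (simp add: skew_def matrix_linear_simps)

lemma wedge4_conj: "A ** wedge4 x y ** transpose A = wedge4 (A *v x) (A *v y)"
proof -
  have "(A ** wedge4 x y ** transpose A) $ i $ j = wedge4 (A *v x) (A *v y) $ i $ j" for i j
    by (simp add: wedge4_def matrix_matrix_mult_def matrix_vector_mult_def transpose_def sum_4 algebra_simps)
  then show ?thesis by (simp add: vec_eq_iff)
qed

text \<open>The sum runs over ordered pairs, so each coordinate plane occurs twice; this accounts
  for the factor 1/2.\<close>

lemma skew_span:
  assumes "skew a"
  shows "a = (\<Sum>i\<in>UNIV. \<Sum>j\<in>UNIV. (a$i$j / 2) *\<^sub>R wedge4 (axis i 1) (axis j 1))" (is "a = ?s")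
proof -
  have "?s $ k $ l = a $ k $ l" for k l
  proof -
    have "?s $ k $ l = (\<Sum>i\<in>UNIV. \<Sum>j\<in>UNIV. (if j = l then if i = k then a$i$j / 2 else 0 else 0)
        - (if j = k then if i = l then a$i$j / 2 else 0 else 0))"
      by (simp add: sum_component wedge4_def axis_def) (intro sum.cong refl; auto)
    also have "\<dots> = a$k$l / 2 - a$l$k / 2"
      by (simp add: sum_subtractf)
    finally have "?s $ k $ l = a$k$l / 2 - a$l$k / 2" .
    moreover have "a$l$k = - a$k$l" using assms unfolding skew_iff by blast
    ultimately show ?thesis by linarith
  qed
  then show ?thesis by (simp add: vec_eq_iff)
qed

lemma skew_entries:
  assumes "skew a"
  shows "a$1$1 = 0" "a$2$2 = 0" "a$3$3 = 0" "a$4$4 = 0" "a$2$1 = - a$1$2" "a$3$1 = - a$1$3"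
    "a$4$1 = - a$1$4" "a$3$2 = - a$2$3" "a$2$4 = - a$4$2" "a$4$3 = - a$3$4"
proof -
  have "a$i$j = - a$j$i" for i j using assms unfolding skew_iff by blast
  from this[of 1 1] this[of 2 2] this[of 3 3] this[of 4 4] this[of 2 1] this[of 3 1] this[of 4 1] this[of 3 2]
    this[of 2 4] this[of 4 3]
  show "a$1$1 = 0" "a$2$2 = 0" "a$3$3 = 0" "a$4$4 = 0" "a$2$1 = - a$1$2" "a$3$1 = - a$1$3"
    "a$4$1 = - a$1$4" "a$3$2 = - a$2$3" "a$2$4 = - a$4$2" "a$4$3 = - a$3$4" by linarith+
qed

lemma skew_star4: "skew a \<Longrightarrow> skew (star4 a)"
  by (simp add: skew_iff[of "star4 a"] forall_4 star4_nth skew_entries)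

lemma gram_entry: "(transpose A ** b ** B) $ i $ j = column i A \<bullet> (b *v column j (B :: real^'m^'n))"
  for A :: "real^'k^'n"
  by (simp add: matrix_matrix_mult_def matrix_vector_mult_def transpose_def column_def
      inner_vec_def sum_distrib_left sum_distrib_right mult_ac) (subst sum.swap, simp add: mult_ac)

text \<open>The star of \<open>x \<and> y\<close> is skew and kills \<open>x\<close> and \<open>y\<close>, so it is a multiple of the wedge of two
  vectors completing them to a basis.\<close>

lemma star4_wedge4_kernel: "star4 (wedge4 x y) *v x = 0" "star4 (wedge4 x y) *v y = 0"
  by (simp_all add: vec_eq_iff forall_4 matrix_vector_mult_def sum_4 star4_nth wedge4_def algebra_simps)

text \<open>Evaluated on two further vectors, the star of a wedge is the volume of all four. This
  fixes the one coefficient that the kernel leaves open.\<close>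

lemma star4_wedge4_det:
  "column 3 A \<bullet> (star4 (wedge4 (column 1 A) (column 2 A)) *v column 4 A) = det A"
  by (simp add: det_4 inner_vec_def matrix_vector_mult_def sum_4 star4_nth wedge4_def column_def algebra_simps)

lemma star4_wedge4_rotation:
  assumes A: "transpose A ** A = mat 1" "det A = 1"
  shows "star4 (wedge4 (column 1 A) (column 2 A)) = wedge4 (column 3 A) (column 4 A)"
proof -
  define b where "b = star4 (wedge4 (column 1 A) (column 2 A))"
  \<comment> \<open>\<open>m\<close> holds the coefficients of the star in the basis of columns of
    \<open>A\<close>. Its first two columns vanish by the kernel, its first two rows by skewness,
    and the remaining coefficient is \<open>det A\<close>.\<close>
  define m where "m = transpose A ** b ** A"
  have sk: "skew b" unfolding b_def by (intro skew_star4 skew_wedge4)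
  have skm: "skew m" using skew_conj[OF sk, of "transpose A"] by (simp add: m_def)
  have m: "m $ i $ j = column i A \<bullet> (b *v column j A)" for i j
    by (simp add: m_def gram_entry)
  have z: "m $ i $ 1 = 0" "m $ i $ 2 = 0" for i
    using star4_wedge4_kernel by (simp_all add: m b_def)
  have "m $ 3 $ 4 = 1"
    using star4_wedge4_det[of A] A by (simp add: m b_def)
  with z skm have "m = wedge4 (axis 3 1) (axis 4 1)"
    by (simp add: vec_eq_iff forall_4 wedge4_def axis_def skew_iff)
  moreover have AA: "A ** transpose A = mat 1" using A(1) by (simp add: matrix_left_right_inverse)
  have "A ** m ** transpose A = (A ** transpose A) ** b ** (A ** transpose A)"
    by (simp add: m_def matrix_mul_assoc)
  ultimately have "b = A ** wedge4 (axis 3 1) (axis 4 1) ** transpose A"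
    by (simp add: AA)
  then show ?thesis by (simp add: b_def wedge4_conj matrix_vector_mul_component[symmetric] matrix_vector_mult_basis)
qed

section \<open>Oriented frames that are orthonormal for a given Gram matrix\<close>

definition frame4 :: "real^4^4 \<Rightarrow> real^4^4 \<Rightarrow> bool" where
  "frame4 G E \<longleftrightarrow> transpose E ** G ** E = mat 1 \<and> det E > 0"

text \<open>The inverse of \<open>E\<close> is \<open>transpose E ** G\<close>; the three forms are
  the cancellations that occur inside longer products.\<close>

lemma frame4_inverse:
  assumes "frame4 G E"
  shows "transpose E ** G ** E = mat 1" "E ** transpose E ** G = mat 1" "G ** E ** transpose E = mat 1"
proof -
  show 1: "transpose E ** G ** E = mat 1" using assms by (simp add: frame4_def)
  then have "E ** (transpose E ** G) = mat 1"
    by (simp add: matrix_left_right_inverse)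
  then show "E ** transpose E ** G = mat 1" by (simp add: matrix_mul_assoc)
  have "(G ** E) ** transpose E = mat 1"
    using 1 by (simp add: matrix_left_right_inverse[of _ "transpose E"] matrix_mul_assoc)
  then show "G ** E ** transpose E = mat 1" .
qed

text \<open>A frame forces \<open>G\<close> to be the inverse of the symmetric matrix
  \<open>E ** transpose E\<close>.\<close>

lemma frame4_sym:
  assumes "frame4 G E" shows "transpose G = G"
proof -
  note i = frame4_inverse[OF assms]
  have "transpose G = transpose G ** (E ** transpose E ** G)" by (simp add: i)
  also have "\<dots> = transpose (E ** transpose E ** G) ** G" by (simp add: matrix_linear_simps)
  finally show ?thesis by (simp add: i)
qed

text \<open>The Euclidean star carried over by \<open>E\<close>. For a frame \<open>E\<close> of
  \<open>G\<close> the inverse of \<open>E\<close> is \<open>transpose E ** G\<close>, so the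
  argument of \<open>star4\<close> lists the coefficients of \<open>a\<close> relative to the
  columns of \<open>E\<close>.\<close>

definition star_frame :: "real^4^4 \<Rightarrow> real^4^4 \<Rightarrow> real^4^4 \<Rightarrow> real^4^4" where
  "star_frame G E a = E ** star4 (transpose E ** G ** a ** G ** E) ** transpose E"

text \<open>The matrix \<open>A\<close> from one oriented orthonormal frame to the other is a
  rotation, to which \<open>star4_wedge4_rotation\<close> applies. Hence \<open>star_frame\<close>
  has the defining property of the Hodge star for every frame \<open>E'\<close>, not only for the
  frame that it is built from.\<close>

lemma star_frame_wedge4:
  assumes E: "frame4 G E" and E': "frame4 G E'"
  shows "star_frame G E (wedge4 (column 1 E') (column 2 E')) = wedge4 (column 3 E') (column 4 E')"
proof -
  define A where "A = transpose E ** G ** E'"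
  note i = frame4_inverse[OF E] and i' = frame4_inverse[OF E']
  have EA: "E ** A = E'"
    using i(2) by (simp add: A_def matrix_mul_assoc)
  have GT: "transpose G = G" by (rule frame4_sym[OF E])
  have AT: "transpose E' ** G ** E = transpose A" by (simp add: A_def matrix_linear_simps GT)
  have "transpose A ** A = transpose E' ** G ** (E ** A)"
    by (simp add: AT[symmetric] matrix_mul_assoc)
  then have A1: "transpose A ** A = mat 1" by (simp add: EA i')
  \<comment> \<open>Orthogonality leaves 1 or -1 for the determinant of \<open>A\<close>; the common
    orientation of the frames decides.\<close>
  have "det E' = det E * det A" using EA det_mul by metis
  then have "det A > 0" using E E' by (simp add: frame4_def zero_less_mult_iff)
  then have A2: "det A = 1"
    using det_orthogonal_matrix[of A] A1 by (auto simp: orthogonal_matrix)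
  have colA: "transpose E *v (G *v column k E') = column k A" for k
    by (simp add: A_def column_def matrix_vector_mult_def matrix_matrix_mult_def transpose_def vec_eq_iff
        sum_distrib_left sum_distrib_right mult.assoc) (rule allI, rule sum.swap)
  have colE: "E *v column k A = column k E'" for k
    by (simp add: EA[symmetric] column_def matrix_vector_mult_def matrix_matrix_mult_def)
  have "transpose E ** G ** wedge4 x y ** G ** E = wedge4 (transpose E *v (G *v x)) (transpose E *v (G *v y))" for x y
  proof -
    have "transpose E ** G ** wedge4 x y ** G ** E
      = transpose E ** (G ** wedge4 x y ** transpose G) ** transpose (transpose E)"
      by (simp add: GT matrix_mul_assoc)
    then show ?thesis by (simp only: wedge4_conj)
  qed
  then show ?thesis
    by (simp only: star_frame_def colA star4_wedge4_rotation[OF A1 A2] wedge4_conj colE)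
qed

subsection \<open>The two ideals of the rotation algebra\<close>

definition eigen4 :: "real \<Rightarrow> real^4^4 \<Rightarrow> bool" where
  "eigen4 s a \<longleftrightarrow> skew a \<and> star4 a = s *\<^sub>R a"

text \<open>An eigenvector is fixed by three entries of its first row. Rewriting with these
  equations turns the matrix identities of this subsection into polynomial identities in few
  variables.\<close>

lemma eigen4_entries:
  assumes "eigen4 s a"
  shows "a$1$1 = 0" "a$2$2 = 0" "a$3$3 = 0" "a$4$4 = 0" "a$2$1 = - a$1$2" "a$3$1 = - a$1$3"
    "a$4$1 = - a$1$4" "a$3$2 = - (s * a$1$4)" "a$2$4 = - (s * a$1$3)" "a$4$3 = - (s * a$1$2)"
    "a$2$3 = s * a$1$4" "a$4$2 = s * a$1$3" "a$3$4 = s * a$1$2"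
proof -
  have sk: "skew a" and "star4 a = s *\<^sub>R a" using assms by (auto simp: eigen4_def)
  then have e: "star4 a $ i $ j = s * a $ i $ j" for i j by simp
  have e': "a$2$3 = s * a$1$4" "a$4$2 = s * a$1$3" "a$3$4 = s * a$1$2"
    using e[of 1 2] e[of 1 3] e[of 1 4] by (simp_all only: star4_nth)
  note k = skew_entries[OF sk]
  show "a$1$1 = 0" "a$2$2 = 0" "a$3$3 = 0" "a$4$4 = 0" "a$2$1 = - a$1$2" "a$3$1 = - a$1$3"
    "a$4$1 = - a$1$4" by (fact k)+
  show "a$3$2 = - (s * a$1$4)" "a$2$4 = - (s * a$1$3)" "a$4$3 = - (s * a$1$2)"
    "a$2$3 = s * a$1$4" "a$4$2 = s * a$1$3" "a$3$4 = s * a$1$2"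
    by (simp_all only: e' k)
qed

text \<open>The eigenspaces of the star are ideals of the rotation algebra, and infinitesimal
  rotations move \<open>a\<close> orthogonally to itself. So every skew \<open>c\<close> yields a
  vertical direction at \<open>a\<close>. Both facts are verified entrywise.\<close>

lemma eigen4_commutator:
  assumes "skew c" "eigen4 s a" "s = 1 \<or> s = - 1"
  shows "eigen4 s (c ** a - a ** c)" "(c ** a - a ** c) \<bullet> a = 0"
proof -
  note c = skew_entries[OF assms(1)] and a = eigen4_entries[OF assms(2)]
  have "star4 (c ** a - a ** c) = s *\<^sub>R (c ** a - a ** c)"
    using assms(3)
    by (elim disjE; simp add: vec_eq_iff forall_4 star4_nth matrix_matrix_mult_def sum_4 a c)
  moreover have "skew a" using assms(2) by (simp add: eigen4_def)
  ultimately show "eigen4 s (c ** a - a ** c)"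
    using assms(1) by (simp add: eigen4_def skew_commutator)
  show "(c ** a - a ** c) \<bullet> a = 0"
    by (simp add: inner_vec_def matrix_matrix_mult_def sum_4 a c algebra_simps)
qed

text \<open>Four entries have modulus 1 and the others vanish. The value 4 means unit length, since
  in an orthonormal frame the metric on bivectors is a quarter of the entrywise inner
  product.\<close>

lemma standard_eigen4:
  fixes s :: real
  defines "\<alpha> \<equiv> wedge4 (axis 1 1) (axis 2 1) + s *\<^sub>R wedge4 (axis 3 1) (axis 4 1)"
  assumes "s = 1 \<or> s = - 1"
  shows "eigen4 s \<alpha>" "\<alpha> \<bullet> \<alpha> = 4"
proof -
  have "skew \<alpha>" by (simp add: \<alpha>_def skew_def transpose_def vec_eq_iff wedge4_def algebra_simps)
  moreover have "star4 \<alpha> = s *\<^sub>R \<alpha>"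
    using assms(2) by (auto simp: \<alpha>_def vec_eq_iff forall_4 star4_nth wedge4_def axis_def)
  ultimately show "eigen4 s \<alpha>" by (simp add: eigen4_def)
  show "\<alpha> \<bullet> \<alpha> = 4"
    using assms(2) by (auto simp: \<alpha>_def inner_vec_def sum_4 wedge4_def axis_def)
qed

text \<open>The two eigenspaces commute, like left and right multiplications by imaginary
  quaternions, and \<open>b ** b\<close> is minus the identity. If equality held for all
  \<open>u\<close>, then with v = [c, a] it would read a v = - e v b. The right side is symmetric,
  being a product of commuting skew matrices; the left side is skew, because \<open>a\<close> and
  the orthogonal v anticommute. So v would vanish for every \<open>c\<close>. Only wedges are used
  for \<open>c\<close>, because the vertical fields below are built from two vector fields.\<close>

lemma eigen4_obstruction:
  assumes a: "eigen4 1 a" "a \<bullet> a = 4" and b: "eigen4 (-1) b" "b \<bullet> b = 4" and e: "e = 1 \<or> e = - (1::real)"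
  obtains x y u where
    "e *\<^sub>R ((wedge4 x y ** a - a ** wedge4 x y) ** b *v u)
      \<noteq> a ** b ** (wedge4 x y ** a - a ** wedge4 x y) ** b *v u"
proof -
  define p q r where "p = a$1$2" and "q = a$1$3" and "r = a$1$4"
  note an = eigen4_entries[OF a(1), folded p_def q_def r_def, simplified] p_def[symmetric] q_def[symmetric] r_def[symmetric]
  define x y z where "x = b$1$2" and "y = b$1$3" and "z = b$1$4"
  note bn = eigen4_entries[OF b(1), folded x_def y_def z_def, simplified] x_def[symmetric] y_def[symmetric] z_def[symmetric]
  have pqr: "p^2 + q^2 + r^2 = 1"
    using a(2) by (simp add: inner_vec_def sum_4 an power2_eq_square)
  have xyz: "x^2 + y^2 + z^2 = 1"
    using b(2) by (simp add: inner_vec_def sum_4 bn power2_eq_square)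
  have ab: "a ** b = b ** a"
    by (simp add: vec_eq_iff forall_4 matrix_matrix_mult_def sum_4 an bn algebra_simps)
  have bb: "b ** b = - mat 1"
    using xyz
    by (simp add: vec_eq_iff forall_4 matrix_matrix_mult_def sum_4 bn mat_def algebra_simps power2_eq_square)
  have vb: "v ** b = b ** v" if "eigen4 1 v" for v
  proof -
    note vn = eigen4_entries[OF that, simplified]
    show ?thesis
      by (simp add: vec_eq_iff forall_4 matrix_matrix_mult_def sum_4 vn bn algebra_simps)
  qed
  define v where "v c = c ** a - a ** c" for c
  have main: "(a ** v c)$1$2 - (a ** v c)$2$1 = 0 \<and> (a ** v c)$1$3 - (a ** v c)$3$1 = 0"
    if "skew c" "\<And>u. e *\<^sub>R (v c ** b *v u) = a ** b ** v c ** b *v u" for c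
  proof -
    have v1: "eigen4 1 (v c)" unfolding v_def by (rule eigen4_commutator(1)[OF \<open>skew c\<close> a(1)]) simp
    have "e *\<^sub>R (v c ** b) = a ** b ** v c ** b"
      by (rule matrix_eq_via_vectors) (simp add: that(2) flip: scaleR_matrix_vector_assoc)
    also have "\<dots> = a ** (b ** v c ** b)" by (simp only: matrix_mul_assoc)
    also have "b ** v c ** b = v c ** (b ** b)" by (simp only: vb[OF v1, symmetric] matrix_mul_assoc)
    also have "a ** (v c ** (b ** b)) = - (a ** v c)" by (simp add: bb matrix_linear_simps)
    finally have av: "a ** v c = - (e *\<^sub>R (v c ** b))" by simp
    have "transpose (v c ** b) = v c ** b"
      using v1 b(1) vb[OF v1] by (simp add: eigen4_def skew_def matrix_linear_simps)
    then have "(v c ** b)$j$i = (v c ** b)$i$j" for i j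
    proof -
      have "(v c ** b)$j$i = transpose (v c ** b)$i$j" by (simp add: transpose_def)
      then show ?thesis by (simp only: \<open>transpose (v c ** b) = v c ** b\<close>)
    qed
    then show ?thesis by (simp add: av)
  qed
  have "\<exists>x y u. e *\<^sub>R (v (wedge4 x y) ** b *v u) \<noteq> a ** b ** v (wedge4 x y) ** b *v u"
  proof (rule ccontr)
    assume "\<not> ?thesis"
    then have n: "\<And>x y u. e *\<^sub>R (v (wedge4 x y) ** b *v u) = a ** b ** v (wedge4 x y) ** b *v u" by blast
    \<comment> \<open>One plane is not enough: the commutator vanishes if \<open>a\<close> is
      proportional to the self-dual part of that plane. The planes 12 and 13 cannot both be
      exceptional, since the two sums of squares would force all three entries of \<open>a\<close>
      to vanish.\<close>
    have "2 * (r * r) + 2 * (q * q) = 0" "2 * (r * r) + 2 * (p * p) = 0"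
      using main[OF skew_wedge4 n, of "axis 1 1" "axis 2 1", THEN conjunct1]
        main[OF skew_wedge4 n, of "axis 1 1" "axis 3 1", THEN conjunct2]
      unfolding v_def power2_eq_square
      by (simp_all add: matrix_matrix_mult_def sum_4 wedge4_def axis_def an)
    then have "q\<^sup>2 + r\<^sup>2 = 0" "p\<^sup>2 + r\<^sup>2 = 0"
      unfolding power2_eq_square by linarith+
    then show False using pqr by (simp add: sum_power2_eq_zero_iff)
  qed
  then show thesis using that unfolding v_def by blast
qed

subsection \<open>Orthonormal frames\<close>

text \<open>Near the identity, a Gram matrix \<open>P\<close> is normalised by \<open>P\<^sup>-\<^sup>1\<^sup>/\<^sup>2\<close>, which is found with the
  contraction principle and is as close to the identity as \<open>P\<close> is.\<close>

lemma inverse_sqrt_near_identity: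
  obtains r C where "r > 0"
    "\<And>P :: real^'n^'n. transpose P = P \<Longrightarrow> norm (P - mat 1) \<le> r \<Longrightarrow>
      \<exists>R. transpose R ** P ** R = mat 1 \<and> norm (R - mat 1) \<le> C * norm (P - mat 1)"
proof -
  have "\<exists>K>0. \<forall>(A :: real^'n^'n) (B :: real^'n^'n). norm (A ** B) \<le> norm A * norm B * K"
    by (rule bounded_bilinear.pos_bounded[OF bounded_bilinear_matrix_mult])
  then obtain K where K0: "K > 0" "\<forall>(A :: real^'n^'n) (B :: real^'n^'n). norm (A ** B) \<le> norm A * norm B * K"
    by (elim exE conjE)
  note K = K0(1) K0(2)[rule_format]
  \<comment> \<open>With this radius, multiplication by a matrix from the ball shrinks norms at
    least by the factor 4, whatever the constant \<open>K\<close> of the matrix product is.\<close>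
  define r where "r = 1 / (4 * K)"
  have r: "r > 0" "r * K = 1 / 4" using K by (auto simp: r_def)
  have small: "norm (A ** B) \<le> norm B / 4" "norm (B ** A) \<le> norm B / 4" if "norm A \<le> r" for A B :: "real^'n^'n"
  proof -
    have "norm A * norm B * K \<le> r * norm B * K"
      using that K by (intro mult_right_mono) auto
    also have "\<dots> = (r * K) * norm B" by (simp only: mult_ac)
    also have "\<dots> = norm B / 4" by (simp only: r(2))
    finally have le: "norm A * norm B * K \<le> norm B / 4" .
    from K(2)[of A B] le show "norm (A ** B) \<le> norm B / 4" by (rule order_trans)
    have "norm (B ** A) \<le> norm A * norm B * K" using K(2)[of B A] by (simp only: mult.commute[of "norm A"])
    from this le show "norm (B ** A) \<le> norm B / 4" by (rule order_trans)
  qed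
  have "\<exists>R. transpose R ** P ** R = mat 1 \<and>
      norm (R - mat 1) \<le> norm (mat 1 :: real^'n^'n) * K * 2 * norm (P - mat 1)"
    if P: "transpose P = P" "norm (P - mat 1) \<le> r" for P :: "real^'n^'n"
  proof -
    define M where "M = P - mat 1"
    \<comment> \<open>A fixed point \<open>S\<close> satisfies (1 + S)^2 = P.\<close>
    define f where "f S = (1/2) *\<^sub>R (M - S ** S)" for S :: "real^'n^'n"
    have "\<exists>!S. S \<in> cball 0 r \<and> f S = S"
    proof (rule Banach_fix[of _ "1/4"])
      show "f ` cball 0 r \<subseteq> cball 0 r"
      proof
        fix T assume "T \<in> f ` cball 0 r"
        then obtain S where S: "norm S \<le> r" "T = f S" by auto
        have "norm (M - S ** S) \<le> norm M + norm (S ** S)" by (rule norm_triangle_ineq4)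
        also have "\<dots> \<le> r + r" using P(2) small(1)[OF S(1), of S] S(1) r(1) unfolding M_def by linarith
        finally show "T \<in> cball 0 r" using S by (simp add: f_def)
      qed
      fix S T :: "real^'n^'n" assume "S \<in> cball 0 r" "T \<in> cball 0 r"
      then have ST: "norm S \<le> r" "norm T \<le> r" by auto
      have "f S - f T = - ((1/2) *\<^sub>R (S ** (S - T) + (S - T) ** T))"
        by (simp add: f_def matrix_linear_simps algebra_simps)
      then have "norm (f S - f T) = (1/2) * norm (S ** (S - T) + (S - T) ** T)" by simp
      also have "\<dots> \<le> (1/2) * (norm (S - T) / 4 + norm (S - T) / 4)"
        by (intro mult_left_mono norm_triangle_mono small ST) simp
      finally show "dist (f S) (f T) \<le> 1/4 * dist S T" by (simp add: dist_norm)
    qed (use r in \<open>simp_all add: compact_imp_complete\<close>)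
    then obtain S where S: "norm S \<le> r" "f S = S"
      and S_unique: "\<And>S'. norm S' \<le> r \<Longrightarrow> f S' = S' \<Longrightarrow> S' = S"
      unfolding Ex1_def mem_cball_0 by blast
    have "transpose M = M" using P(1) by (simp add: M_def transpose_diff)
    then have "f (transpose S) = transpose (f S)"
      by (simp add: f_def matrix_linear_simps)
    \<comment> \<open>Transposition preserves the ball and the fixed point equation, so uniqueness
      makes the square root symmetric. This is what cancels both factors of \<open>P\<close> in
      \<open>transpose R ** P ** R\<close>.\<close>
    then have ST: "transpose S = S" using S by (intro S_unique) (auto simp: norm_transpose)
    have "2 *\<^sub>R f S = M - S ** S" by (simp add: f_def)
    then have M: "M = S + S + S ** S" using S(2) by (simp add: scaleR_2)
    have norm_S: "norm S \<le> norm M"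
    proof -
      have "norm (2 *\<^sub>R S) \<le> norm M + norm (S ** S)"
        using norm_triangle_ineq4[of M "S ** S"] \<open>2 *\<^sub>R f S = _\<close> S(2) by simp
      then have "2 * norm S \<le> norm M + norm (S ** S)" by simp
      moreover have "s \<le> m" if "2 * s \<le> m + q" "q \<le> s / 4" "0 \<le> s" for s m q :: real
        using that by linarith
      ultimately show ?thesis using small(1)[OF S(1), of S] norm_ge_zero[of S] by blast
    qed
    define T where "T = mat 1 + S"
    have TT: "T ** T = P" using M by (simp add: T_def M_def matrix_linear_simps algebra_simps)
    have TT': "transpose T = T" by (simp add: T_def transpose_add ST)
    \<comment> \<open>\<open>R\<close> is the inverse of \<open>T\<close>, found as the fixed point
      of a contraction on the whole space.\<close>
    have "\<exists>!R. R \<in> UNIV \<and> mat 1 - S ** R = R"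
    proof (rule Banach_fix[of _ "1/4"])
      fix R R' :: "real^'n^'n"
      have "(mat 1 - S ** R) - (mat 1 - S ** R') = - (S ** (R - R'))"
        by (simp add: matrix_linear_simps)
      then show "dist (mat 1 - S ** R) (mat 1 - S ** R') \<le> 1/4 * dist R R'"
        using small(1)[OF S(1), of "R - R'"] by (simp add: dist_norm)
    qed (auto intro: complete_UNIV)
    then obtain R where R: "mat 1 - S ** R = R" by blast
    then have e: "mat 1 = R + S ** R" by (simp only: diff_eq_eq)
    have "T ** R = R + S ** R" by (simp add: T_def matrix_add_rdistrib')
    then have TR: "T ** R = mat 1" by (simp only: e[symmetric])
    then have RT: "transpose R ** T = mat 1"
      using TT' by (metis matrix_transpose_mul transpose_mat)
    have "transpose R ** P ** R = (transpose R ** T) ** (T ** R)"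
      by (simp add: TT[symmetric] matrix_mul_assoc)
    then have 1: "transpose R ** P ** R = mat 1" by (simp add: TR RT)
    have "S ** mat 1 + S ** (R - mat 1) = S ** R" by (simp add: matrix_diff_right)
    moreover have "R - mat 1 = - (S ** R)" by (subst e) simp
    ultimately have "R - mat 1 = - (S ** mat 1 + S ** (R - mat 1))" by simp
    then have "norm (R - mat 1) \<le> norm (S ** (mat 1 :: real^'n^'n)) + norm (S ** (R - mat 1))"
      by (metis norm_minus_cancel norm_triangle_ineq)
    also have "\<dots> \<le> norm S * norm (mat 1 :: real^'n^'n) * K + norm (R - mat 1) / 4"
      using K(2)[of S "mat 1"] small(1)[OF S(1), of "R - mat 1"] by (rule add_mono)
    finally have "norm (R - mat 1) \<le> norm S * norm (mat 1 :: real^'n^'n) * K + norm (R - mat 1) / 4" .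
    then have "norm (R - mat 1) \<le> 2 * (norm S * norm (mat 1 :: real^'n^'n) * K)"
    proof -
      have "s \<le> 2 * m" if "s \<le> m + s / 4" "0 \<le> s" for s m :: real
        using that by linarith
      then show ?thesis using \<open>norm (R - mat 1) \<le> norm S * norm (mat 1 :: real^'n^'n) * K + norm (R - mat 1) / 4\<close> norm_ge_zero by blast
    qed
    also have "\<dots> \<le> 2 * (norm M * norm (mat 1 :: real^'n^'n) * K)"
      using norm_S K(1) by (intro mult_left_mono mult_right_mono) auto
    finally have "norm (R - mat 1) \<le> norm (mat 1 :: real^'n^'n) * K * 2 * norm (P - mat 1)"
      by (simp add: M_def mult_ac)
    with 1 show ?thesis by blast
  qed
  with r(1) that show thesis by blast
qed

text \<open>Induction on the set of chosen vectors, without projections: the matrix whose rows are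
  \<open>G *v e j\<close> for these vectors, and zero otherwise, is singular, and a normalised
  vector of its kernel is the next member.\<close>

lemma orthonormal_basis_exists:
  fixes G :: "real^'n^'n"
  assumes sym: "transpose G = G" and pos: "\<And>x. x \<noteq> 0 \<Longrightarrow> x \<bullet> (G *v x) > 0"
  shows "\<exists>e :: 'n \<Rightarrow> real^'n. \<forall>i j. e i \<bullet> (G *v e j) = (if i = j then 1 else 0)"
proof -
  have "\<exists>e :: 'n \<Rightarrow> real^'n. \<forall>i\<in>I. \<forall>j\<in>I. e i \<bullet> (G *v e j) = (if i = j then 1 else 0)" if "finite I" for I :: "'n set"
    using that
  proof induction
    case (insert i I)
    then obtain e :: "'n \<Rightarrow> real^'n" where
      e: "\<And>i j. i \<in> I \<Longrightarrow> j \<in> I \<Longrightarrow> e i \<bullet> (G *v e j) = (if i = j then 1 else 0)" by blast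
    define N where "N = (\<chi> j. if j \<in> I then G *v e j else 0)"
    have "row i N = 0" using insert by (simp add: N_def row_def vec_eq_iff)
    then have "\<not> invertible N" using det_zero_row(2)[of i N] invertible_det_nz[of N] by auto
    then obtain v where v: "v \<noteq> 0" "N *v v = 0"
      using matrix_left_invertible_ker[of N] invertible_left_inverse[of N] by auto
    have ev: "e j \<bullet> (G *v v) = 0" if "j \<in> I" for j
    proof -
      have "(N *v v) $ j = (G *v e j) \<bullet> v"
        using that by (simp add: matrix_vector_mul_component N_def)
      then show ?thesis using v(2) sym by (metis dot_lmul_matrix transpose_matrix_vector zero_index)
    qed
    define w where "w = (1 / sqrt (v \<bullet> (G *v v))) *\<^sub>R v"
    have ww: "w \<bullet> (G *v w) = 1"
      using pos[OF v(1)] by (simp add: w_def matrix_vector_mult_scaleR)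
    have ew: "e j \<bullet> (G *v w) = 0" if "j \<in> I" for j
      using ev[OF that] by (simp add: w_def matrix_vector_mult_scaleR)
    have we: "w \<bullet> (G *v e j) = 0" if "j \<in> I" for j
      using ew[OF that] sym by (metis dot_lmul_matrix transpose_matrix_vector inner_commute)
    show ?case
      using insert.hyps e ww ew we by (intro exI[of _ "e(i := w)"]) auto
  qed simp
  from this[of UNIV] show ?thesis by simp
qed

text \<open>If the orientation is wrong, the last vector is reversed. The first three survive, which
  suffices because the star is prescribed on the wedge of the first two.\<close>

lemma orthonormal_frame4:
  assumes e: "\<And>i j. e i \<bullet> (G *v e j) = (if i = j then 1 else 0)"
  obtains E where "frame4 G E" "\<And>i. i \<noteq> 4 \<Longrightarrow> column i E = e i"
proof -
  define F where "F s = (\<chi> r i. (if i = 4 then s else 1) * e i $ r)" for s :: real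
  have col: "column i (F s) = (if i = 4 then s else 1) *\<^sub>R e i" for i s
    by (simp add: F_def column_def vec_eq_iff)
  have ortho: "transpose (F s) ** G ** F s = mat 1" if "s = 1 \<or> s = - 1" for s
  proof -
    have "(transpose (F s) ** G ** F s) $ i $ j = (if i = 4 then s else 1) * (if j = 4 then s else 1) * (e i \<bullet> (G *v e j))" for i j
      by (simp add: col gram_entry matrix_vector_mult_scaleR)
    then show ?thesis using that by (auto simp: vec_eq_iff e mat_def)
  qed
  have "det (F (-1)) = - det (F 1)"
    by (simp add: det_4 F_def algebra_simps)
  moreover have "det (F 1) \<noteq> 0"
  proof
    assume "det (F 1) = 0"
    then have "det (transpose (F 1) ** G ** F 1) = 0" by (simp add: det_mul)
    then show False by (simp add: ortho)
  qed
  ultimately consider "det (F 1) > 0" | "det (F (-1)) > 0" by linarith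
  then show thesis
    by cases (rule that[of "F 1"], simp_all add: frame4_def ortho col,
        rule that[of "F (-1)"], simp_all add: frame4_def ortho col)
qed

lemma frame4_exists:
  assumes "transpose G = G" and "\<And>x. x \<noteq> 0 \<Longrightarrow> x \<bullet> (G *v x) > 0"
  shows "\<exists>E. frame4 G E"
  using orthonormal_basis_exists[OF assms] orthonormal_frame4 by metis

section \<open>Charts and tensors\<close>

lemma scaleR_fun_apply [simp]: "(r *\<^sub>R f) x = r *\<^sub>R f x"
  by (simp add: scaleR_fun_def)

lemma sum_fun_apply [simp]: "(\<Sum>i\<in>I. f i) x = (\<Sum>i\<in>I. f i x)"
  by (induction I rule: infinite_finite_induct) simp_all

text \<open>Maps on the fibres are linear only on a subspace of all component families, so
  membership of the partial sums is carried along in the induction.\<close>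

lemma linear_on_set_sum:
  assumes f: "linear_on_set S f" and S: "0 \<in> S" "\<And>x y. x \<in> S \<Longrightarrow> y \<in> S \<Longrightarrow> x + y \<in> S"
    "\<And>r x. x \<in> S \<Longrightarrow> r *\<^sub>R x \<in> S"
    and v: "\<And>i. i \<in> I \<Longrightarrow> v i \<in> S"
  shows "f (\<Sum>i\<in>I. c i *\<^sub>R v i) = (\<Sum>i\<in>I. c i *\<^sub>R f (v i))"
proof -
  have "f (0 *\<^sub>R 0) = 0 *\<^sub>R f 0" using f S(1) unfolding linear_on_set_def by blast
  then have f0: "f 0 = 0" by simp
  have "f (\<Sum>i\<in>I. c i *\<^sub>R v i) = (\<Sum>i\<in>I. c i *\<^sub>R f (v i)) \<and> (\<Sum>i\<in>I. c i *\<^sub>R v i) \<in> S"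
    using v
  proof (induction I rule: infinite_finite_induct)
    case (insert i I)
    then have "f (c i *\<^sub>R v i + (\<Sum>i\<in>I. c i *\<^sub>R v i)) = f (c i *\<^sub>R v i) + f (\<Sum>i\<in>I. c i *\<^sub>R v i)"
      using f S unfolding linear_on_set_def by blast
    moreover have "f (c i *\<^sub>R v i) = c i *\<^sub>R f (v i)"
      using f insert unfolding linear_on_set_def by blast
    ultimately show ?case using insert S by simp
  qed (auto simp: f0 S)
  then show ?thesis ..
qed

locale oriented_manifold_charts =
  fixes M :: "'m set" and \<A> :: "'m chart set"
  assumes oriented: "oriented_manifold M \<A>"
begin

lemma atlas: "smooth_atlas M \<A>" using oriented by (simp add: oriented_manifold_def)

lemma chart_subset: "c \<in> \<A> \<Longrightarrow> fst c \<subseteq> M"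
  using atlas unfolding smooth_atlas_def by blast

lemma chart_exists: "p \<in> M \<Longrightarrow> \<exists>c\<in>\<A>. p \<in> fst c"
  using atlas unfolding smooth_atlas_def by blast

lemma chart_inj: "c \<in> \<A> \<Longrightarrow> inj_on (snd c) (fst c)"
  using atlas unfolding smooth_atlas_def by blast

lemma chart_open: "c \<in> \<A> \<Longrightarrow> open (snd c ` fst c)"
  using atlas unfolding smooth_atlas_def by blast

lemma overlap_open: "c \<in> \<A> \<Longrightarrow> d \<in> \<A> \<Longrightarrow> open (snd c ` (fst c \<inter> fst d))"
  using atlas unfolding smooth_atlas_def by blast

lemma transition_smooth: "c \<in> \<A> \<Longrightarrow> d \<in> \<A> \<Longrightarrow> smooth_on (transition c d) (snd c ` (fst c \<inter> fst d))"
  using atlas unfolding smooth_atlas_def by blast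

lemma inv_chart: "c \<in> \<A> \<Longrightarrow> p \<in> fst c \<Longrightarrow> inv_chart c (snd c p) = p"
  unfolding inv_chart_def using chart_inj by (rule inv_into_f_f)

lemma transition: "c \<in> \<A> \<Longrightarrow> p \<in> fst c \<Longrightarrow> transition c d (snd c p) = snd d p"
  by (simp add: transition_def inv_chart)

lemma openin_manifold:
  "openin (manifold_topology M \<A>) W \<longleftrightarrow> W \<subseteq> M \<and> (\<forall>c\<in>\<A>. open (snd c ` (W \<inter> fst c)))"
proof -
  have "istopology (\<lambda>W. W \<subseteq> M \<and> (\<forall>c\<in>\<A>. open (snd c ` (W \<inter> fst c))))"
    unfolding istopology_def
  proof (intro conjI allI impI ballI)
    fix V W c assume V: "V \<subseteq> M \<and> (\<forall>c\<in>\<A>. open (snd c ` (V \<inter> fst c)))"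
      and W: "W \<subseteq> M \<and> (\<forall>c\<in>\<A>. open (snd c ` (W \<inter> fst c)))"
    then show "V \<inter> W \<subseteq> M" by blast
    assume c: "c \<in> \<A>"
    have "snd c ` (V \<inter> W \<inter> fst c) = snd c ` (V \<inter> fst c) \<inter> snd c ` (W \<inter> fst c)"
      using chart_inj[OF c] unfolding inj_on_def by blast
    then show "open (snd c ` (V \<inter> W \<inter> fst c))" using V W c by auto
  next
    fix \<K> assume K: "\<forall>K\<in>\<K>. K \<subseteq> M \<and> (\<forall>c\<in>\<A>. open (snd c ` (K \<inter> fst c)))"
    then show "\<Union>\<K> \<subseteq> M" by blast
    fix c assume c: "c \<in> \<A>"
    have "snd c ` (\<Union>\<K> \<inter> fst c) = (\<Union>K\<in>\<K>. snd c ` (K \<inter> fst c))" by blast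
    then show "open (snd c ` (\<Union>\<K> \<inter> fst c))" using K c by auto
  qed
  then show ?thesis by (simp add: manifold_topology_def topology_inverse')
qed

lemma topspace_manifold: "topspace (manifold_topology M \<A>) = M"
proof -
  have "openin (manifold_topology M \<A>) M"
  proof -
    have "M \<inter> fst c = fst c" if "c \<in> \<A>" for c using chart_subset[OF that] by blast
    then show ?thesis by (simp add: openin_manifold chart_open)
  qed
  then show ?thesis
    using openin_manifold by (metis openin_subset openin_topspace subset_antisym)
qed

lemma openin_chart: "c \<in> \<A> \<Longrightarrow> openin (manifold_topology M \<A>) (fst c)"
  using overlap_open by (auto simp: openin_manifold chart_subset Int_commute)

text \<open>This is the only place where the Hausdorff property enters: it lets fields with compact
  support in a chart be extended by zero.\<close>

lemma chart_compact_complement: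
  assumes c: "c \<in> \<A>" and K: "compact K" "K \<subseteq> snd c ` fst c"
  shows "openin (manifold_topology M \<A>) (M - inv_chart c ` K)"
proof -
  have "continuous_map (top_of_set (snd c ` fst c)) (manifold_topology M \<A>) (inv_chart c)"
    unfolding continuous_map_def
  proof (intro conjI allI impI)
    show "inv_chart c \<in> topspace (top_of_set (snd c ` fst c)) \<rightarrow> topspace (manifold_topology M \<A>)"
      using inv_chart[OF c] chart_subset[OF c] by (auto simp: topspace_manifold)
    fix W assume W: "openin (manifold_topology M \<A>) W"
    have "{x \<in> topspace (top_of_set (snd c ` fst c)). inv_chart c x \<in> W} = snd c ` (W \<inter> fst c)"
      using inv_chart[OF c] by (auto simp: image_iff)
    moreover have "open (snd c ` (W \<inter> fst c))" using W c by (simp add: openin_manifold)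
    ultimately show "openin (top_of_set (snd c ` fst c))
        {x \<in> topspace (top_of_set (snd c ` fst c)). inv_chart c x \<in> W}"
      by (auto intro: open_subset)
  qed
  then have "compactin (manifold_topology M \<A>) (inv_chart c ` K)"
    using K by (intro image_compactin[where X="top_of_set (snd c ` fst c)"]) (auto simp: compactin_subtopology)
  moreover have "Hausdorff_space (manifold_topology M \<A>)"
    using oriented by (simp add: oriented_manifold_def)
  ultimately have "closedin (manifold_topology M \<A>) (inv_chart c ` K)"
    by (rule compactin_imp_closedin[rotated])
  then show ?thesis by (simp add: closedin_def topspace_manifold)
qed

lemma transition_differentiable:
  assumes "c \<in> \<A>" "d \<in> \<A>" "p \<in> fst c" "p \<in> fst d"
  shows "(transition c d has_derivative (\<lambda>v. jacobian c d p *v v)) (at (snd c p))"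
proof -
  have "transition c d differentiable (at (snd c p))"
    using transition_smooth[OF assms(1,2)] assms(3,4) by (auto intro: smooth_on_differentiable)
  then have *: "(transition c d has_derivative frechet_derivative (transition c d) (at (snd c p))) (at (snd c p))"
    by (rule has_frechet_derivative)
  then have "linear (frechet_derivative (transition c d) (at (snd c p)))"
    by (rule has_derivative_linear)
  then have "(\<lambda>v. jacobian c d p *v v) = frechet_derivative (transition c d) (at (snd c p))"
    unfolding jacobian_def by (simp add: matrix_works fun_eq_iff)
  with * show ?thesis by simp
qed

lemma jacobian_vector:
  assumes "c \<in> \<A>" "d \<in> \<A>" "p \<in> fst c" "p \<in> fst d"
  shows "jacobian c d p *v u = frechet_derivative (transition c d) (at (snd c p)) u"
  using frechet_derivative_at[OF transition_differentiable[OF assms]] by metis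

lemma jacobian_cocycle:
  assumes "c \<in> \<A>" "d \<in> \<A>" "e \<in> \<A>" "p \<in> fst c" "p \<in> fst d" "p \<in> fst e"
  shows "jacobian d e p ** jacobian c d p = jacobian c e p"
proof -
  have "(transition c d has_derivative (\<lambda>v. jacobian c d p *v v)) (at (snd c p))"
    using transition_differentiable assms by blast
  moreover have "(transition d e has_derivative (\<lambda>v. jacobian d e p *v v)) (at (transition c d (snd c p)))"
    using transition_differentiable assms by (simp add: transition)
  ultimately have "((transition d e \<circ> transition c d) has_derivative
      (\<lambda>v. jacobian d e p *v v) \<circ> (\<lambda>v. jacobian c d p *v v)) (at (snd c p))"
    by (rule diff_chain_at)
  moreover have "(transition d e \<circ> transition c d) y = transition c e y" if "y \<in> snd c ` (fst c \<inter> fst d)" for y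
    using that assms by (auto simp: transition)
  moreover have "snd c p \<in> snd c ` (fst c \<inter> fst d)" using assms by blast
  ultimately have "(transition c e has_derivative
      (\<lambda>v. jacobian d e p *v v) \<circ> (\<lambda>v. jacobian c d p *v v)) (at (snd c p))"
    using has_derivative_transform_within_open[OF _ overlap_open[OF assms(1,2)]] by blast
  then have "(\<lambda>v. jacobian d e p *v v) \<circ> (\<lambda>v. jacobian c d p *v v) = (\<lambda>v. jacobian c e p *v v)"
    using transition_differentiable assms has_derivative_unique by blast
  then have "jacobian d e p *v (jacobian c d p *v v) = jacobian c e p *v v" for v
    by (metis comp_apply)
  then show ?thesis by (intro matrix_eq_via_vectors) (simp add: matrix_vector_mul_assoc)
qed

lemma jacobian_self:
  assumes "c \<in> \<A>" "p \<in> fst c"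
  shows "jacobian c c p = mat 1"
proof -
  have "snd c p \<in> snd c ` fst c" using assms by blast
  then have "(transition c c has_derivative (\<lambda>v. v)) (at (snd c p))"
    by (rule has_derivative_transform_within_open[OF has_derivative_ident chart_open[OF assms(1)]])
      (auto simp: transition[OF assms(1)])
  then have "(\<lambda>v. jacobian c c p *v v) = (\<lambda>v. v)"
    using transition_differentiable assms has_derivative_unique by blast
  then have "jacobian c c p *v v = v" for v by metis
  then show ?thesis by (intro matrix_eq_via_vectors) simp
qed

text \<open>By the cocycle rule for Jacobians, the transformation law between any two charts follows
  from the law relative to one chart \<open>c\<close>.\<close>

lemma tangent_spaceI:
  assumes "\<And>d. d \<in> \<A> \<Longrightarrow> p \<in> fst d \<Longrightarrow> v d = jacobian c d p *v u"
    and "\<And>d. \<not> (d \<in> \<A> \<and> p \<in> fst d) \<Longrightarrow> v d = 0" and "c \<in> \<A>" "p \<in> fst c"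
  shows "v \<in> tangent_space \<A> p"
  unfolding tangent_space_def
proof (intro CollectI conjI ballI allI impI)
  fix d e assume "d \<in> \<A>" "e \<in> \<A>" "p \<in> fst d \<inter> fst e"
  then show "v e = jacobian d e p *v v d"
    using assms by (simp add: matrix_vector_mul_assoc jacobian_cocycle)
qed (use assms in blast)

lemma coord_vec_tangent: "c \<in> \<A> \<Longrightarrow> p \<in> fst c \<Longrightarrow> coord_vec \<A> c p u \<in> tangent_space \<A> p"
  by (rule tangent_spaceI[where c=c and u=u]) (auto simp: coord_vec_def)

lemma coord_vec_self: "c \<in> \<A> \<Longrightarrow> p \<in> fst c \<Longrightarrow> coord_vec \<A> c p u c = u"
  by (simp add: coord_vec_def jacobian_self)

lemma coord_field_tangent: "c \<in> \<A> \<Longrightarrow> p \<in> fst c \<Longrightarrow> coord_field \<A> c i p \<in> tangent_space \<A> p"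
  by (simp add: coord_field_def coord_vec_tangent)

lemma coord_field_self: "c \<in> \<A> \<Longrightarrow> p \<in> fst c \<Longrightarrow> coord_field \<A> c i p c = axis i 1"
  by (simp add: coord_field_def coord_vec_self)

lemma tangent_transform:
  "v \<in> tangent_space \<A> p \<Longrightarrow> c \<in> \<A> \<Longrightarrow> d \<in> \<A> \<Longrightarrow> p \<in> fst c \<Longrightarrow> p \<in> fst d \<Longrightarrow> v d = jacobian c d p *v v c"
  unfolding tangent_space_def by blast

lemma tangent_zero: "v \<in> tangent_space \<A> p \<Longrightarrow> \<not> (c \<in> \<A> \<and> p \<in> fst c) \<Longrightarrow> v c = 0"
  unfolding tangent_space_def by blast

lemma tangent_eqI:
  assumes "v \<in> tangent_space \<A> p" "w \<in> tangent_space \<A> p" "c \<in> \<A>" "p \<in> fst c" "v c = w c"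
  shows "v = w"
proof
  fix d show "v d = w d"
  proof (cases "d \<in> \<A> \<and> p \<in> fst d")
    case True
    then show ?thesis
      using tangent_transform[OF assms(1,3)] tangent_transform[OF assms(2,3)] assms(4,5) by metis
  next
    case False
    then show ?thesis using tangent_zero[OF assms(1)] tangent_zero[OF assms(2)] by metis
  qed
qed

lemma tangent_subspace:
  "0 \<in> tangent_space \<A> p" "v \<in> tangent_space \<A> p \<Longrightarrow> w \<in> tangent_space \<A> p \<Longrightarrow> v + w \<in> tangent_space \<A> p"
  "v \<in> tangent_space \<A> p \<Longrightarrow> r *\<^sub>R v \<in> tangent_space \<A> p"
proof -
  show "0 \<in> tangent_space \<A> p" by (simp add: tangent_space_def)
next
  assume v: "v \<in> tangent_space \<A> p" and w: "w \<in> tangent_space \<A> p"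
  show "v + w \<in> tangent_space \<A> p"
    unfolding tangent_space_def
  proof (intro CollectI conjI ballI allI impI)
    fix c d assume "c \<in> \<A>" "d \<in> \<A>" "p \<in> fst c \<inter> fst d"
    then show "(v + w) d = jacobian c d p *v (v + w) c"
      using tangent_transform[OF v, of c d] tangent_transform[OF w, of c d]
      by (simp add: matrix_vector_right_distrib)
  qed (simp add: tangent_zero[OF v] tangent_zero[OF w])
next
  assume v: "v \<in> tangent_space \<A> p"
  show "r *\<^sub>R v \<in> tangent_space \<A> p"
    unfolding tangent_space_def
  proof (intro CollectI conjI ballI allI impI)
    fix c d assume "c \<in> \<A>" "d \<in> \<A>" "p \<in> fst c \<inter> fst d"
    then show "(r *\<^sub>R v) d = jacobian c d p *v (r *\<^sub>R v) c"
      using tangent_transform[OF v, of c d] by (simp add: matrix_vector_mult_scaleR)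
  qed (simp add: tangent_zero[OF v])
qed

lemma tangent_sum: "(\<And>i. i \<in> I \<Longrightarrow> v i \<in> tangent_space \<A> p) \<Longrightarrow> (\<Sum>i\<in>I. v i) \<in> tangent_space \<A> p"
  by (induction I rule: infinite_finite_induct) (auto intro: tangent_subspace)

lemma tangent_basis:
  assumes "v \<in> tangent_space \<A> p" "c \<in> \<A>" "p \<in> fst c"
  shows "v = (\<Sum>i\<in>UNIV. (v c $ i) *\<^sub>R coord_field \<A> c i p)"
proof (rule tangent_eqI[OF assms(1) _ assms(2,3)])
  show "(\<Sum>i\<in>UNIV. (v c $ i) *\<^sub>R coord_field \<A> c i p) \<in> tangent_space \<A> p"
    using assms by (intro tangent_sum tangent_subspace coord_field_tangent)
  show "v c = (\<Sum>i\<in>UNIV. (v c $ i) *\<^sub>R coord_field \<A> c i p) c"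
    using assms basis_expansion[of "v c"] by (simp add: coord_field_self scalar_mult_eq_scaleR)
qed

section \<open>Bivectors as skew matrices in charts\<close>

definition bivec_of :: "'m chart \<Rightarrow> 'm \<Rightarrow> real^4^4 \<Rightarrow> 'm tensor2" where
  "bivec_of c p m = (\<lambda>d. if d \<in> \<A> \<and> p \<in> fst d then jacobian c d p ** m ** transpose (jacobian c d p) else 0)"

lemma bivector_skew: "a \<in> bivectors \<A> p \<Longrightarrow> skew (a c)"
  unfolding bivectors_def skew_def by blast

lemma bivector_zero: "a \<in> bivectors \<A> p \<Longrightarrow> \<not> (c \<in> \<A> \<and> p \<in> fst c) \<Longrightarrow> a c = 0"
  unfolding bivectors_def by blast

lemma bivectorsI:
  assumes "\<And>d. d \<in> \<A> \<Longrightarrow> p \<in> fst d \<Longrightarrow> a d = jacobian c d p ** m ** transpose (jacobian c d p)"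
    and "\<And>d. \<not> (d \<in> \<A> \<and> p \<in> fst d) \<Longrightarrow> a d = 0" and "c \<in> \<A>" "p \<in> fst c" "skew m"
  shows "a \<in> bivectors \<A> p"
  unfolding bivectors_def
proof (intro CollectI conjI ballI allI impI)
  fix d e assume de: "d \<in> \<A>" "e \<in> \<A>" "p \<in> fst d \<inter> fst e"
  have "a e = (jacobian d e p ** jacobian c d p) ** m ** transpose (jacobian d e p ** jacobian c d p)"
    using de assms by (simp add: jacobian_cocycle)
  then show "a e = jacobian d e p ** a d ** transpose (jacobian d e p)"
    using de assms by (simp add: matrix_linear_simps)
next
  fix d show "transpose (a d) = - a d"
    using skew_conj[OF assms(5), of "jacobian c d p"] skew_zero assms(1,2)[of d]
    unfolding skew_def by (cases "d \<in> \<A> \<and> p \<in> fst d") simp_all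
qed (use assms in blast)

lemma bivec_of_bivectors: "c \<in> \<A> \<Longrightarrow> p \<in> fst c \<Longrightarrow> skew m \<Longrightarrow> bivec_of c p m \<in> bivectors \<A> p"
  by (rule bivectorsI[where c=c and m=m]) (auto simp: bivec_of_def)

lemma bivec_of_self: "c \<in> \<A> \<Longrightarrow> p \<in> fst c \<Longrightarrow> bivec_of c p m c = m"
  by (simp add: bivec_of_def jacobian_self)

lemma bivector_transform:
  "a \<in> bivectors \<A> p \<Longrightarrow> c \<in> \<A> \<Longrightarrow> d \<in> \<A> \<Longrightarrow> p \<in> fst c \<Longrightarrow> p \<in> fst d \<Longrightarrow>
    a d = jacobian c d p ** a c ** transpose (jacobian c d p)"
  unfolding bivectors_def by blast

lemma bivector_eqI:
  assumes "a \<in> bivectors \<A> p" "b \<in> bivectors \<A> p" "c \<in> \<A>" "p \<in> fst c" "a c = b c"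
  shows "a = b"
proof
  fix d show "a d = b d"
  proof (cases "d \<in> \<A> \<and> p \<in> fst d")
    case True
    then show ?thesis
      using bivector_transform[OF assms(1,3)] bivector_transform[OF assms(2,3)] assms(4,5) by metis
  next
    case False
    then show ?thesis using bivector_zero[OF assms(1)] bivector_zero[OF assms(2)] by metis
  qed
qed

lemma bivector_subspace:
  "0 \<in> bivectors \<A> p" "a \<in> bivectors \<A> p \<Longrightarrow> b \<in> bivectors \<A> p \<Longrightarrow> a + b \<in> bivectors \<A> p"
  "a \<in> bivectors \<A> p \<Longrightarrow> r *\<^sub>R a \<in> bivectors \<A> p"
proof -
  show "0 \<in> bivectors \<A> p" by (simp add: bivectors_def transpose_def vec_eq_iff matrix_matrix_mult_def)
next
  assume v: "a \<in> bivectors \<A> p" and w: "b \<in> bivectors \<A> p"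
  show "a + b \<in> bivectors \<A> p"
    unfolding bivectors_def
  proof (intro CollectI conjI ballI allI impI)
    fix c d assume "c \<in> \<A>" "d \<in> \<A>" "p \<in> fst c \<inter> fst d"
    then show "(a + b) d = jacobian c d p ** (a + b) c ** transpose (jacobian c d p)"
      using bivector_transform[OF v, of c d] bivector_transform[OF w, of c d]
      by (simp add: matrix_add_ldistrib matrix_add_rdistrib')
  next
    fix c show "transpose ((a + b) c) = - (a + b) c"
      using bivector_skew[OF v, of c] bivector_skew[OF w, of c] by (simp add: skew_def transpose_add)
  qed (simp add: bivector_zero[OF v] bivector_zero[OF w])
next
  assume v: "a \<in> bivectors \<A> p"
  show "r *\<^sub>R a \<in> bivectors \<A> p"
    unfolding bivectors_def
  proof (intro CollectI conjI ballI allI impI)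
    fix c d assume "c \<in> \<A>" "d \<in> \<A>" "p \<in> fst c \<inter> fst d"
    then show "(r *\<^sub>R a) d = jacobian c d p ** (r *\<^sub>R a) c ** transpose (jacobian c d p)"
      using bivector_transform[OF v, of c d] by (simp add: matrix_scaleR_left matrix_scaleR_right)
  next
    fix c show "transpose ((r *\<^sub>R a) c) = - (r *\<^sub>R a) c"
      using bivector_skew[OF v, of c] by (simp add: skew_def transpose_scaleR)
  qed (simp add: bivector_zero[OF v])
qed

lemma bivector_sum: "(\<And>i. i \<in> I \<Longrightarrow> v i \<in> bivectors \<A> p) \<Longrightarrow> (\<Sum>i\<in>I. v i) \<in> bivectors \<A> p"
  by (induction I rule: infinite_finite_induct) (auto intro: bivector_subspace)

lemma wedge_apply: "wedge v w c = wedge4 (v c) (w c)"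
  by (simp add: wedge_def wedge4_def)

lemma wedge_bivectors:
  assumes "v \<in> tangent_space \<A> p" "w \<in> tangent_space \<A> p" "c \<in> \<A>" "p \<in> fst c"
  shows "wedge v w \<in> bivectors \<A> p"
proof (rule bivectorsI[where c=c and m="wedge4 (v c) (w c)"])
  fix d assume "d \<in> \<A>" "p \<in> fst d"
  then show "wedge v w d = jacobian c d p ** wedge4 (v c) (w c) ** transpose (jacobian c d p)"
    using tangent_transform[OF assms(1,3), of d] tangent_transform[OF assms(2,3), of d] assms(4)
    by (simp add: wedge_apply wedge4_conj)
next
  fix d assume "\<not> (d \<in> \<A> \<and> p \<in> fst d)"
  then have "v d = 0" "w d = 0" by (rule tangent_zero[OF assms(1)], rule tangent_zero[OF assms(2)])
  then show "wedge v w d = 0" by (simp add: wedge_apply wedge4_def vec_eq_iff)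
qed (use assms skew_wedge4 in auto)

section \<open>Smooth fields in charts and their global extension\<close>

lemma smooth_on_jacobian:
  assumes "c \<in> \<A>" "d \<in> \<A>"
  shows "smooth_on (\<lambda>x. jacobian c d (inv_chart c x)) (snd c ` (fst c \<inter> fst d))"
proof -
  have "smooth_on (\<lambda>x. jacobian c d (inv_chart c x) $ i $ j) (snd c ` (fst c \<inter> fst d))" for i j
  proof (rule smooth_on_cong[OF overlap_open[OF assms]])
    show "smooth_on (\<lambda>x. frechet_derivative (transition c d) (at x) (axis j 1) $ i) (snd c ` (fst c \<inter> fst d))"
      by (rule smooth_on_linear[OF bounded_linear_vec_nth overlap_open[OF assms]
            smooth_on_derivative[OF transition_smooth[OF assms]]])
    fix x assume "x \<in> snd c ` (fst c \<inter> fst d)"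
    then obtain p where p: "x = snd c p" "p \<in> fst c" "p \<in> fst d" by blast
    show "frechet_derivative (transition c d) (at x) (axis j 1) $ i = jacobian c d (inv_chart c x) $ i $ j"
      by (simp add: p inv_chart[OF assms(1)] jacobian_vector[OF assms p(2,3), symmetric] matrix_vector_mult_basis column_def)
  qed
  then show ?thesis by (simp add: smooth_on_vec_iff[OF overlap_open[OF assms]])
qed

text \<open>In the chart \<open>d\<close> the components are the Jacobian times \<open>f\<close>,
  composed with the transition from \<open>d\<close> back to \<open>c\<close>. The components
  \<open>f\<close> may vary with the point so that a bump function can be included.\<close>

lemma coord_smooth:
  assumes c: "c \<in> \<A>" and d: "d \<in> \<A>" and f: "smooth_on f (snd c ` fst c)"
  shows "smooth_on (\<lambda>x. coord_vec \<A> c (inv_chart d x) (f (snd c (inv_chart d x))) d) (snd d ` (fst c \<inter> fst d))"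
proof (rule smooth_on_cong)
  let ?S = "snd d ` (fst d \<inter> fst c)"
  show "open (snd d ` (fst c \<inter> fst d))" using overlap_open[OF d c] by (simp add: Int_commute)
  have "smooth_on (\<lambda>x. (\<lambda>y. jacobian c d (inv_chart c y) *v f y) (transition d c x)) ?S"
  proof (rule smooth_on_compose[OF overlap_open[OF d c] overlap_open[OF c d] _ _ transition_smooth[OF d c]])
    show "transition d c ` ?S \<subseteq> snd c ` (fst c \<inter> fst d)" by (auto simp: transition[OF d])
    show "smooth_on (\<lambda>y. jacobian c d (inv_chart c y) *v f y) (snd c ` (fst c \<inter> fst d))"
      by (rule smooth_on_matrix_vector[OF overlap_open[OF c d] smooth_on_jacobian[OF c d] smooth_on_subset'[OF f]]) blast
  qed
  then show "smooth_on (\<lambda>x. jacobian c d (inv_chart c (transition d c x)) *v f (transition d c x))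
      (snd d ` (fst c \<inter> fst d))"
    by (simp add: Int_commute)
  fix x assume "x \<in> snd d ` (fst c \<inter> fst d)"
  then show "jacobian c d (inv_chart c (transition d c x)) *v f (transition d c x) =
      coord_vec \<A> c (inv_chart d x) (f (snd c (inv_chart d x))) d"
    using c d by (auto simp: transition inv_chart coord_vec_def)
qed

lemma coord_vec_field:
  assumes c: "c \<in> \<A>"
  shows "vector_field \<A> (fst c) (\<lambda>p. coord_vec \<A> c p u)"
  unfolding vector_field_def
  using coord_vec_tangent[OF c] coord_smooth[OF c _ smooth_on_const[of u]] by simp

lemma coord_field_vector_field: "c \<in> \<A> \<Longrightarrow> vector_field \<A> (fst c) (coord_field \<A> c i)"
  unfolding coord_field_def by (rule coord_vec_field)

text \<open>A vector at one point is realised by a coordinate field with constant components times a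
  bump function, extended by zero. This provides the global fields on which integrability is
  tested.\<close>

lemma global_field_exists:
  assumes c: "c \<in> \<A>" and p: "p \<in> fst c"
  obtains X where "vector_field \<A> M X" "X p c = u"
proof -
  have "snd c p \<in> snd c ` fst c" using p by blast
  then obtain r where r: "r > 0" "cball (snd c p) r \<subseteq> snd c ` fst c"
    using chart_open[OF c] open_contains_cball by blast
  obtain \<phi> :: "real^4 \<Rightarrow> real" where \<phi>: "smooth_on \<phi> UNIV" "\<phi> (snd c p) = 1"
    "\<And>x. x \<notin> cball (snd c p) r \<Longrightarrow> \<phi> x = 0"
    by (rule smooth_bump[OF r(1), of "snd c p"]) blast
  define X where "X q = (if q \<in> fst c then coord_vec \<A> c q (\<phi> (snd c q) *\<^sub>R u) else 0)" for q
  \<comment> \<open>Together with the chart domain this open set covers \<open>M\<close>, and the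
    field vanishes on it, so smoothness is checked on the two sets separately.\<close>
  let ?N = "M - inv_chart c ` cball (snd c p) r"
  have N: "openin (manifold_topology M \<A>) ?N"
    by (rule chart_compact_complement[OF c compact_cball r(2)])
  have X0: "X q = 0" if "q \<in> ?N" for q
  proof (cases "q \<in> fst c")
    case True
    then have "snd c q \<notin> cball (snd c p) r" using that inv_chart[OF c True] by (metis DiffD2 imageI)
    then have "\<phi> (snd c q) = 0" by (rule \<phi>)
    then show ?thesis by (simp add: X_def True coord_vec_def fun_eq_iff)
  qed (simp add: X_def)
  have sm: "smooth_on (\<lambda>x. X (inv_chart d x) d) (snd d ` (M \<inter> fst d))" if d: "d \<in> \<A>" for d
  proof (rule smooth_on_local)
    fix x assume "x \<in> snd d ` (M \<inter> fst d)"
    then obtain q where q: "x = snd d q" "q \<in> M" "q \<in> fst d" by blast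
    show "\<exists>W. open W \<and> x \<in> W \<and> smooth_on (\<lambda>x. X (inv_chart d x) d) W"
    proof (cases "q \<in> fst c")
      case True
      have o: "open (snd d ` (fst c \<inter> fst d))" using overlap_open[OF d c] by (simp add: Int_commute)
      have "smooth_on (\<lambda>x. \<phi> x *\<^sub>R u) (snd c ` fst c)"
        by (rule smooth_on_scaleR[OF chart_open[OF c] smooth_on_subset'[OF \<phi>(1) subset_UNIV] smooth_on_const])
      then have "smooth_on (\<lambda>x. X (inv_chart d x) d) (snd d ` (fst c \<inter> fst d))"
        by (intro smooth_on_cong[OF o _ coord_smooth[OF c d]]) (auto simp: X_def inv_chart[OF d])
      then show ?thesis using o q True by (intro exI[of _ "snd d ` (fst c \<inter> fst d)"]) blast
    next
      case False
      then have "q \<notin> inv_chart c ` cball (snd c p) r"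
        using r(2) inv_chart[OF c] by fastforce
      then have qN: "q \<in> ?N" using q by blast
      have o: "open (snd d ` (?N \<inter> fst d))" using N d by (simp add: openin_manifold)
      have "smooth_on (\<lambda>x. X (inv_chart d x) d) (snd d ` (?N \<inter> fst d))"
        by (rule smooth_on_cong[OF o _ smooth_on_const[of 0]]) (use X0 inv_chart[OF d] in fastforce)
      then show ?thesis using o q qN by (intro exI[of _ "snd d ` (?N \<inter> fst d)"]) blast
    qed
  qed
  have "X q \<in> tangent_space \<A> q" for q
    using coord_vec_tangent[OF c] by (simp add: X_def tangent_subspace)
  then have "vector_field \<A> M X" using sm by (simp add: vector_field_def)
  moreover have "X p c = u" using p by (simp add: X_def coord_vec_self[OF c] \<phi>(2))
  ultimately show thesis by (rule that)
qed

end

lemma wedge4_inner: "m \<bullet> wedge4 x y = x \<bullet> (m *v y) - y \<bullet> (m *v x)"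
proof -
  have "m \<bullet> wedge4 x y = (\<Sum>i\<in>UNIV. \<Sum>j\<in>UNIV. x$i * (m$i$j * y$j)) - (\<Sum>i\<in>UNIV. \<Sum>j\<in>UNIV. y$i * (m$i$j * x$j))"
    by (simp add: inner_vec_def wedge4_def right_diff_distrib sum_subtractf mult_ac)
  then show ?thesis by (simp add: inner_vec_def matrix_vector_mult_def sum_distrib_left)
qed

lemma wedge4_vector: "wedge4 x y *v z = (y \<bullet> z) *\<^sub>R x - (x \<bullet> z) *\<^sub>R y"
  by (simp add: vec_eq_iff wedge4_def matrix_vector_mult_def inner_vec_def left_diff_distrib right_diff_distrib sum_subtractf
      sum_distrib_left mult_ac)

lemma matrix_vector_minus: "(- A) *v x = - (A *v x)" for A :: "real^'n^'m"
  by (simp add: matrix_vector_mult_def vec_eq_iff sum_negf)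

lemma inner_matrix_vector: "x \<bullet> (A *v y) = (transpose A *v x) \<bullet> y" for A :: "real^'n^'m"
  by (simp add: dot_lmul_matrix[symmetric])

text \<open>Ordered pairs form a single index \<open>k\<close>, so that
  \<open>linear_on_set_sum\<close> later applies to one sum instead of a nested one.\<close>

lemma skew_span_frame:
  assumes "skew a"
  shows "E ** a ** transpose E =
    (\<Sum>k\<in>UNIV. (a$(fst k)$(snd k) / 2) *\<^sub>R wedge4 (column (fst k) E) (column (snd k) E))"
proof -
  have lin: "linear (\<lambda>m. E ** m ** transpose E)"
    by (rule linearI) (simp_all add: matrix_linear_simps)
  have "a = (\<Sum>k\<in>UNIV. (a$(fst k)$(snd k) / 2) *\<^sub>R wedge4 (axis (fst k) 1) (axis (snd k) 1))"
    using skew_span[OF assms]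
    by (simp add: sum.cartesian_product split_beta UNIV_Times_UNIV)
  then have "E ** a ** transpose E =
      E ** (\<Sum>k\<in>UNIV. (a$(fst k)$(snd k) / 2) *\<^sub>R wedge4 (axis (fst k) 1) (axis (snd k) 1)) ** transpose E"
    by (rule arg_cong)
  also have "\<dots> = (\<Sum>k\<in>UNIV. E ** ((a$(fst k)$(snd k) / 2) *\<^sub>R wedge4 (axis (fst k) 1) (axis (snd k) 1)) ** transpose E)"
    by (rule linear_sum[OF lin])
  also have "\<dots> = (\<Sum>k\<in>UNIV. (a$(fst k)$(snd k) / 2) *\<^sub>R wedge4 (column (fst k) E) (column (snd k) E))"
    by (simp add: matrix_scaleR_left matrix_scaleR_right wedge4_conj matrix_vector_mult_basis)
  finally show ?thesis .
qed

lemma frame4_coords: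
  assumes "frame4 G E"
  shows "E ** (transpose E ** G ** a ** G ** E) ** transpose E = a"
    and "transpose E ** G ** (E ** a ** transpose E) ** G ** E = a"
proof -
  note i = frame4_inverse[OF assms]
  have "E ** (transpose E ** G ** a ** G ** E) ** transpose E
      = (E ** transpose E ** G) ** a ** (G ** E ** transpose E)"
    by (simp only: matrix_mul_assoc)
  then show "E ** (transpose E ** G ** a ** G ** E) ** transpose E = a" by (simp add: i)
  have "transpose E ** G ** (E ** a ** transpose E) ** G ** E
      = (transpose E ** G ** E) ** a ** (transpose E ** G ** E)"
    by (simp only: matrix_mul_assoc)
  then show "transpose E ** G ** (E ** a ** transpose E) ** G ** E = a" by (simp add: i)
qed

lemma star_frame_conj:
  assumes "frame4 G E"
  shows "star_frame G E (E ** a ** transpose E) = E ** star4 a ** transpose E"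
  by (simp add: star_frame_def frame4_coords[OF assms])

lemma frame4_cancel:
  assumes "frame4 G E"
  shows "E ** a ** transpose E = E ** b ** transpose E \<longleftrightarrow> a = b"
  by (metis frame4_coords(2)[OF assms])

section \<open>Metric, Hodge star and twistor fibres as matrices in a chart\<close>

locale riemannian_charts = oriented_manifold_charts M \<A>
  for M :: "'m set" and \<A> :: "'m chart set" +
  fixes g :: "'m metric" and D :: "'m connection"
  assumes metric: "riemannian_metric M \<A> g" and connection: "levi_civita_connection M \<A> g D"
begin

definition gram :: "'m chart \<Rightarrow> 'm \<Rightarrow> real^4^4" where
  "gram c p = (\<chi> i j. g p (coord_field \<A> c i p) (coord_field \<A> c j p))"

lemma linear_tangent_expand:
  assumes "linear_on_set (tangent_space \<A> p) f" "v \<in> tangent_space \<A> p" "c \<in> \<A>" "p \<in> fst c"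
  shows "f v = (\<Sum>i\<in>UNIV. (v c $ i) *\<^sub>R f (coord_field \<A> c i p))"
proof -
  have "f v = f (\<Sum>i\<in>UNIV. (v c $ i) *\<^sub>R coord_field \<A> c i p)"
    using tangent_basis[OF assms(2-4)] by (rule arg_cong)
  also have "\<dots> = (\<Sum>i\<in>UNIV. (v c $ i) *\<^sub>R f (coord_field \<A> c i p))"
    by (rule linear_on_set_sum[OF assms(1) tangent_subspace coord_field_tangent[OF assms(3,4)]])
  finally show ?thesis .
qed

lemma metric_facts:
  assumes "p \<in> M"
  shows "bilinear_on_set (tangent_space \<A> p) (g p)"
    "v \<in> tangent_space \<A> p \<Longrightarrow> w \<in> tangent_space \<A> p \<Longrightarrow> g p v w = g p w v"
    "v \<in> tangent_space \<A> p \<Longrightarrow> v \<noteq> 0 \<Longrightarrow> g p v v > 0"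
  using metric assms unfolding riemannian_metric_def by blast+

context
  fixes c p assumes c: "c \<in> \<A>" and p: "p \<in> fst c"
begin

lemma point_in_M: "p \<in> M" using chart_subset[OF c] p by blast

lemma metric_gram:
  assumes v: "v \<in> tangent_space \<A> p" and w: "w \<in> tangent_space \<A> p"
  shows "g p v w = v c \<bullet> (gram c p *v w c)"
proof -
  have bil: "bilinear_on_set (tangent_space \<A> p) (g p)" by (rule metric_facts[OF point_in_M])
  have 1: "g p v w = (\<Sum>i\<in>UNIV. (v c $ i) *\<^sub>R g p (coord_field \<A> c i p) w)"
    by (rule linear_tangent_expand[OF _ v c p]) (use bil w in \<open>auto simp: bilinear_on_set_def\<close>)
  have "g p (coord_field \<A> c i p) w = (\<Sum>j\<in>UNIV. (w c $ j) *\<^sub>R g p (coord_field \<A> c i p) (coord_field \<A> c j p))" for i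
    by (rule linear_tangent_expand[OF _ w c p])
      (use bil coord_field_tangent[OF c p] in \<open>auto simp: bilinear_on_set_def\<close>)
  then show ?thesis
    by (simp add: 1 inner_vec_def matrix_vector_mult_def gram_def mult_ac)
qed

lemma gram_sym: "transpose (gram c p) = gram c p"
  using metric_facts(2)[OF point_in_M coord_field_tangent[OF c p] coord_field_tangent[OF c p]]
  by (simp add: gram_def transpose_def vec_eq_iff)

lemma gram_pos:
  assumes "x \<noteq> 0" shows "x \<bullet> (gram c p *v x) > 0"
proof -
  have t: "coord_vec \<A> c p x \<in> tangent_space \<A> p" by (rule coord_vec_tangent[OF c p])
  have "coord_vec \<A> c p x \<noteq> 0" using coord_vec_self[OF c p, of x] assms by (metis zero_fun_apply)
  then show ?thesis using metric_facts(3)[OF point_in_M t] by (simp add: metric_gram[OF t t] coord_vec_self[OF c p])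
qed

lemma gram_frame_exists: "\<exists>E. frame4 (gram c p) E"
  by (rule frame4_exists[OF gram_sym gram_pos])

lemma gram_transform:
  assumes d: "d \<in> \<A>" "p \<in> fst d"
  shows "gram c p = transpose (jacobian c d p) ** gram d p ** jacobian c d p"
proof -
  have "gram c p $ i $ j = (transpose (jacobian c d p) ** gram d p ** jacobian c d p) $ i $ j" for i j
  proof -
    have col: "coord_field \<A> c k p d = column k (jacobian c d p)" for k
      using d by (simp add: coord_field_def coord_vec_def matrix_vector_mult_basis)
    have "gram c p $ i $ j = g p (coord_field \<A> c i p) (coord_field \<A> c j p)" by (simp add: gram_def)
    also have "\<dots> = column i (jacobian c d p) \<bullet> (gram d p *v column j (jacobian c d p))"
      using riemannian_charts.metric_gram[OF riemannian_charts_axioms d coord_field_tangent[OF c p] coord_field_tangent[OF c p]]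
      by (simp add: col)
    finally show ?thesis by (simp add: gram_entry)
  qed
  then show ?thesis by (simp add: vec_eq_iff)
qed

lemma bivector_span_frame:
  assumes E: "frame4 G E" and a: "a \<in> bivectors \<A> p"
  shows "a = (\<Sum>k\<in>UNIV. ((transpose E ** G ** a c ** G ** E)$(fst k)$(snd k) / 2) *\<^sub>R
    wedge (coord_vec \<A> c p (column (fst k) E)) (coord_vec \<A> c p (column (snd k) E)))" (is "a = ?s")
proof (rule bivector_eqI[OF a _ c p])
  show "?s \<in> bivectors \<A> p"
    by (intro bivector_sum bivector_subspace wedge_bivectors[OF _ _ c p] coord_vec_tangent[OF c p])
  have "skew (transpose E ** (G ** a c ** transpose G) ** transpose (transpose E))"
    by (intro skew_conj bivector_skew[OF a])
  then have "skew (transpose E ** G ** a c ** G ** E)"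
    by (simp add: matrix_mul_assoc frame4_sym[OF E])
  from skew_span_frame[OF this, of E]
  show "a c = ?s c"
    by (simp only: frame4_coords[OF E] sum_fun_apply scaleR_fun_apply wedge_apply coord_vec_self[OF c p])
qed

text \<open>The uniqueness half of the definite descriptions of the metric on bivectors and of the
  Hodge star. \<open>G\<close> is left general: the coordinate basis serves for the metric, an
  orthonormal frame for the star.\<close>

lemma bivector_linear_unique:
  fixes F F' :: "'m tensor2 \<Rightarrow> 'x::real_vector"
  assumes E: "frame4 G E" and a: "a \<in> bivectors \<A> p"
    and F: "linear_on_set (bivectors \<A> p) F" and F': "linear_on_set (bivectors \<A> p) F'"
    and eq: "\<And>i j. F (wedge (coord_vec \<A> c p (column i E)) (coord_vec \<A> c p (column j E)))
      = F' (wedge (coord_vec \<A> c p (column i E)) (coord_vec \<A> c p (column j E)))"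
  shows "F a = F' a"
proof -
  let ?w = "\<lambda>k. wedge (coord_vec \<A> c p (column (fst k) E)) (coord_vec \<A> c p (column (snd k) E))"
  let ?r = "\<lambda>k. (transpose E ** G ** a c ** G ** E)$(fst k)$(snd k) / 2"
  have w: "?w k \<in> bivectors \<A> p" for k
    by (intro wedge_bivectors[OF _ _ c p] coord_vec_tangent[OF c p])
  have e: "H a = (\<Sum>k\<in>UNIV. ?r k *\<^sub>R H (?w k))" if "linear_on_set (bivectors \<A> p) H" for H :: "'m tensor2 \<Rightarrow> 'x"
  proof -
    have "H a = H (\<Sum>k\<in>UNIV. ?r k *\<^sub>R ?w k)"
      using bivector_span_frame[OF E a] by (rule arg_cong)
    also have "\<dots> = (\<Sum>k\<in>UNIV. ?r k *\<^sub>R H (?w k))"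
      by (rule linear_on_set_sum[OF that bivector_subspace w])
    finally show ?thesis .
  qed
  show ?thesis by (simp only: e[OF F] e[OF F'] eq)
qed

text \<open>The description asks for the common value of all forms with the prescribed values on
  wedges, so it takes both a form that has them (\<open>B0\<close>) and agreement of any two. The
  entrywise product of two wedges is twice a Gram determinant, so the prescribed one half becomes
  one quarter.\<close>

lemma bivector_metric_gram:
  assumes a: "a \<in> bivectors \<A> p" and b: "b \<in> bivectors \<A> p"
  shows "bivector_metric \<A> g p a b = ((gram c p ** a c ** gram c p) \<bullet> b c) / 4"
proof -
  define B0 where "B0 a b = ((gram c p ** a c ** gram c p) \<bullet> b c) / 4" for a b :: "'m tensor2"
  let ?cond = "\<lambda>B. bilinear_on_set (bivectors \<A> p) B \<and>
     (\<forall>v1\<in>tangent_space \<A> p. \<forall>v2\<in>tangent_space \<A> p.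
      \<forall>v3\<in>tangent_space \<A> p. \<forall>v4\<in>tangent_space \<A> p.
        B (wedge v1 v2) (wedge v3 v4) = (g p v1 v3 * g p v2 v4 - g p v1 v4 * g p v2 v3) / 2)"
  have "bilinear_on_set (bivectors \<A> p) B0"
    unfolding bilinear_on_set_def linear_on_set_def
    by (simp add: B0_def matrix_linear_simps inner_add_left inner_add_right add_divide_distrib)
  moreover have "B0 (wedge v1 v2) (wedge v3 v4) = (g p v1 v3 * g p v2 v4 - g p v1 v4 * g p v2 v3) / 2"
    if v: "v1 \<in> tangent_space \<A> p" "v2 \<in> tangent_space \<A> p" "v3 \<in> tangent_space \<A> p" "v4 \<in> tangent_space \<A> p"
    for v1 v2 v3 v4
  proof -
    have "gram c p ** wedge4 (v1 c) (v2 c) ** gram c p = wedge4 (gram c p *v v1 c) (gram c p *v v2 c)"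
      using wedge4_conj[of "gram c p" "v1 c" "v2 c"] by (simp add: gram_sym)
    moreover have "(gram c p *v x) \<bullet> y = x \<bullet> (gram c p *v y)" for x y
      by (simp only: inner_matrix_vector gram_sym)
    ultimately show ?thesis
      by (simp add: B0_def wedge_apply wedge4_inner wedge4_vector metric_gram v inner_diff_right inner_commute field_simps)
  qed
  ultimately have cond0: "?cond B0" by blast
  \<comment> \<open>Uniqueness is tested on coordinate wedges: the standard basis is a frame for the
    Euclidean Gram matrix.\<close>
  have m1: "frame4 (mat 1) (mat 1)" by (simp add: frame4_def)
  show ?thesis
    unfolding bivector_metric_def B0_def[symmetric]
  proof (rule the_equality)
    show "\<forall>B. ?cond B \<longrightarrow> B0 a b = B a b"
    proof (intro allI impI)
      fix B assume B: "?cond B"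
      let ?e = "\<lambda>i. coord_vec \<A> c p (column i (mat 1))"
      have w: "wedge (?e i) (?e j) \<in> bivectors \<A> p" for i j
        by (intro wedge_bivectors[OF _ _ c p] coord_vec_tangent[OF c p])
      have l: "linear_on_set (bivectors \<A> p) (H x)" "linear_on_set (bivectors \<A> p) (\<lambda>x. H x y)"
        if "?cond H" "x \<in> bivectors \<A> p" "y \<in> bivectors \<A> p" for H x y
        using that unfolding bilinear_on_set_def by blast+
      have "B0 (wedge (?e i) (?e j)) (wedge (?e k) (?e l)) = B (wedge (?e i) (?e j)) (wedge (?e k) (?e l))" for i j k l
        using cond0 B coord_vec_tangent[OF c p] by metis
      then have "B0 (wedge (?e i) (?e j)) b = B (wedge (?e i) (?e j)) b" for i j
        by (rule bivector_linear_unique[OF m1 b l(1)[OF cond0 w w] l(1)[OF B w w]])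
      then show "B0 a b = B a b"
        by (rule bivector_linear_unique[OF m1 a l(2)[OF cond0 b b] l(2)[OF B b b]])
    qed
  next
    fix r assume "\<forall>B. ?cond B \<longrightarrow> r = B a b"
    then show "r = B0 a b" using cond0 by blast
  qed
qed

lemma basis_frame4:
  assumes "oriented_orthonormal_basis \<A> g p e"
  shows "frame4 (gram c p) (\<chi> r i. e i c $ r)" (is "frame4 _ ?E")
proof -
  have col: "column i ?E = e i c" for i by (simp add: column_def vec_eq_iff)
  have e: "e i \<in> tangent_space \<A> p" "g p (e i) (e j) = (if i = j then 1 else 0)" "det (\<chi> i. e i c) > 0" for i j
    using assms c p unfolding oriented_orthonormal_basis_def by blast+
  have "transpose ?E = (\<chi> i. e i c)" by (simp add: transpose_def vec_eq_iff)
  then have "det ?E > 0" using e(3) by (metis det_transpose)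
  moreover have "transpose ?E ** gram c p ** ?E = mat 1"
    using e(2) by (simp add: vec_eq_iff gram_entry col metric_gram[OF e(1) e(1)] mat_def)
  ultimately show ?thesis by (simp add: frame4_def)
qed

lemma frame4_basis:
  assumes E: "frame4 (gram c p) E"
  shows "oriented_orthonormal_basis \<A> g p (\<lambda>i. coord_vec \<A> c p (column i E))"
  unfolding oriented_orthonormal_basis_def
proof (intro conjI allI ballI impI)
  fix i show "coord_vec \<A> c p (column i E) \<in> tangent_space \<A> p" by (rule coord_vec_tangent[OF c p])
next
  fix i j
  have "g p (coord_vec \<A> c p (column i E)) (coord_vec \<A> c p (column j E)) = (transpose E ** gram c p ** E) $ i $ j"
    by (simp add: metric_gram coord_vec_tangent[OF c p] coord_vec_self[OF c p] gram_entry)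
  then show "g p (coord_vec \<A> c p (column i E)) (coord_vec \<A> c p (column j E)) = (if i = j then 1 else 0)"
    using E by (simp add: frame4_def mat_def)
next
  fix d assume d: "d \<in> \<A>" "p \<in> fst d"
  have "(\<chi> i. coord_vec \<A> c p (column i E) d) = transpose (jacobian c d p ** E)"
    using d by (simp add: coord_vec_def vec_eq_iff transpose_def matrix_vector_mult_def matrix_matrix_mult_def column_def)
  moreover have "det (jacobian c d p) > 0"
    using oriented c p d unfolding oriented_manifold_def by blast
  ultimately show "det (\<chi> i. coord_vec \<A> c p (column i E) d) > 0"
    using E by (simp add: det_mul frame4_def)
qed

text \<open>Existence is the frame independence of \<open>star_frame\<close>. For uniqueness, values
  on all wedges of frame vectors are required, whereas only the first two vectors of oriented frames
  are prescribed; so any two distinct frame vectors are made the beginning of another oriented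
  frame.\<close>

lemma hodge_star_frame:
  assumes E: "frame4 (gram c p) E" and a: "a \<in> bivectors \<A> p"
  shows "hodge_star \<A> g p a = bivec_of c p (star_frame (gram c p) E (a c))"
proof -
  define F0 where "F0 a = bivec_of c p (star_frame (gram c p) E (a c))" for a :: "'m tensor2"
  let ?cond = "\<lambda>F. linear_on_set (bivectors \<A> p) F \<and>
     (\<forall>e. oriented_orthonormal_basis \<A> g p e \<longrightarrow> F (wedge (e 1) (e 2)) = wedge (e 3) (e 4))"
  have "linear_on_set (bivectors \<A> p) F0"
    unfolding linear_on_set_def
    by (auto simp: F0_def bivec_of_def star_frame_def matrix_linear_simps star4_add star4_scaleR fun_eq_iff)
  moreover have "F0 (wedge (e 1) (e 2)) = wedge (e 3) (e 4)" if e: "oriented_orthonormal_basis \<A> g p e" for e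
  proof -
    have et: "e i \<in> tangent_space \<A> p" for i using e unfolding oriented_orthonormal_basis_def by blast
    have col: "column i (\<chi> r i. e i c $ r) = e i c" for i by (simp add: column_def vec_eq_iff)
    have s: "star_frame (gram c p) E (wedge4 (e 1 c) (e 2 c)) = wedge4 (e 3 c) (e 4 c)"
      using star_frame_wedge4[OF E basis_frame4[OF e]] by (simp only: col)
    show ?thesis
      by (rule bivector_eqI[OF _ wedge_bivectors[OF et et c p] c p])
        (simp_all add: F0_def wedge_apply s bivec_of_bivectors[OF c p] skew_wedge4 bivec_of_self[OF c p])
  qed
  ultimately have cond0: "?cond F0" by blast
  show ?thesis
    unfolding hodge_star_def F0_def[symmetric]
  proof (rule the_equality)
    show "\<forall>F. ?cond F \<longrightarrow> F0 a = F a"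
    proof (intro allI impI)
      fix F assume F: "?cond F"
      have zero: "H 0 = 0" if "?cond H" for H
      proof -
        have "H (0 *\<^sub>R 0) = 0 *\<^sub>R H 0"
          using that bivector_subspace(1) unfolding linear_on_set_def by blast
        then show ?thesis by simp
      qed
      show "F0 a = F a"
      proof (rule bivector_linear_unique[OF E a conjunct1[OF cond0] conjunct1[OF F]])
        fix i j
        show "F0 (wedge (coord_vec \<A> c p (column i E)) (coord_vec \<A> c p (column j E)))
          = F (wedge (coord_vec \<A> c p (column i E)) (coord_vec \<A> c p (column j E)))"
        proof (cases "i = j")
          case True
          have "wedge v v = 0" for v :: "'m chart \<Rightarrow> real^4"
            by (simp add: wedge_def fun_eq_iff vec_eq_iff)
          then show ?thesis using True zero[OF cond0] zero[OF F] by simp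
        next
          case False
          \<comment> \<open>A product of two transpositions carrying 1 and 2 to \<open>i\<close> and
            \<open>j\<close>. If its parity is wrong, \<open>orthonormal_frame4\<close> repairs the
            orientation in the last column.\<close>
          obtain \<pi> :: "4 \<Rightarrow> 4" where \<pi>: "inj \<pi>" "\<pi> 1 = i" "\<pi> 2 = j"
          proof
            let ?t = "Transposition.transpose (1::4) i"
            let ?u = "Transposition.transpose (2::4) (?t j)"
            show "inj (?t \<circ> ?u)" by (intro inj_compose) (auto intro: bij_is_inj)
            have "?t j \<noteq> 1" using False by (auto simp: Transposition.transpose_def)
            then have "?u 1 = 1" by (simp add: Transposition.transpose_def)
            then show "(?t \<circ> ?u) 1 = i" by (simp add: Transposition.transpose_def)
            show "(?t \<circ> ?u) 2 = j" by simp
          qed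
          have "column (\<pi> k) E \<bullet> (gram c p *v column (\<pi> l) E) = (if k = l then 1 else 0)" for k l
            using E \<pi>(1) by (simp add: gram_entry[symmetric] frame4_def mat_def inj_eq)
          then obtain E' where E': "frame4 (gram c p) E'" "\<And>k. k \<noteq> 4 \<Longrightarrow> column k E' = column (\<pi> k) E"
            by (rule orthonormal_frame4) blast
          then have "column 1 E' = column i E" "column 2 E' = column j E" using \<pi> by simp_all
          then show ?thesis
            using cond0 F frame4_basis[OF E'(1)] by metis
        qed
      qed
    qed
  next
    fix r assume "\<forall>F. ?cond F \<longrightarrow> r = F a"
    then show "r = F0 a" using cond0 by blast
  qed
qed

text \<open>In frame coordinates the condition involves neither the point nor the metric. The same
  coefficients \<open>\<alpha>\<close> can therefore be carried along moving frames.\<close>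

lemma hodge_eigenspace_frame:
  assumes E: "frame4 (gram c p) E"
  shows "a \<in> hodge_eigenspace \<A> g s p \<longleftrightarrow>
    a \<in> bivectors \<A> p \<and> (\<exists>\<alpha>. eigen4 s \<alpha> \<and> a c = E ** \<alpha> ** transpose E)"
proof (cases "a \<in> bivectors \<A> p")
  case True
  define \<alpha> where "\<alpha> = transpose E ** gram c p ** a c ** gram c p ** E"
  have ac: "a c = E ** \<alpha> ** transpose E" unfolding \<alpha>_def by (rule frame4_coords(1)[OF E, symmetric])
  have "skew (transpose E ** (gram c p ** a c ** transpose (gram c p)) ** transpose (transpose E))"
    by (intro skew_conj bivector_skew[OF True])
  then have sk: "skew \<alpha>" by (simp add: \<alpha>_def matrix_mul_assoc gram_sym)
  have "hodge_star \<A> g p a = s *\<^sub>R a \<longleftrightarrow> E ** star4 \<alpha> ** transpose E = s *\<^sub>R a c"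
  proof
    assume "hodge_star \<A> g p a = s *\<^sub>R a"
    then have "bivec_of c p (E ** star4 \<alpha> ** transpose E) c = (s *\<^sub>R a) c"
      by (simp only: hodge_star_frame[OF E True] ac star_frame_conj[OF E])
    then show "E ** star4 \<alpha> ** transpose E = s *\<^sub>R a c" by (simp add: bivec_of_self[OF c p])
  next
    assume *: "E ** star4 \<alpha> ** transpose E = s *\<^sub>R a c"
    show "hodge_star \<A> g p a = s *\<^sub>R a"
      unfolding hodge_star_frame[OF E True] ac star_frame_conj[OF E]
      by (rule bivector_eqI[OF bivec_of_bivectors[OF c p skew_conj[OF skew_star4[OF sk]]] bivector_subspace(3)[OF True] c p])
        (simp add: bivec_of_self[OF c p] *)
  qed
  also have "\<dots> \<longleftrightarrow> E ** star4 \<alpha> ** transpose E = E ** (s *\<^sub>R \<alpha>) ** transpose E"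
    by (simp add: ac matrix_linear_simps)
  also have "\<dots> \<longleftrightarrow> eigen4 s \<alpha>"
    by (simp add: frame4_cancel[OF E] eigen4_def sk)
  finally have "hodge_star \<A> g p a = s *\<^sub>R a \<longleftrightarrow> eigen4 s \<alpha>" .
  moreover have "(\<exists>\<beta>. eigen4 s \<beta> \<and> a c = E ** \<beta> ** transpose E) \<longleftrightarrow> eigen4 s \<alpha>"
    unfolding ac frame4_cancel[OF E] by blast
  ultimately show ?thesis using True by (simp add: hodge_eigenspace_def)
qed (simp add: hodge_eigenspace_def)

lemma bivector_metric_frame:
  assumes E: "frame4 (gram c p) E" and a: "a \<in> bivectors \<A> p" and b: "b \<in> bivectors \<A> p"
    and ac: "a c = E ** \<alpha> ** transpose E" and bc: "b c = E ** \<beta> ** transpose E"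
  shows "bivector_metric \<A> g p a b = (\<alpha> \<bullet> \<beta>) / 4"
proof -
  have "(gram c p ** a c ** gram c p) \<bullet> b c = (transpose E ** gram c p ** a c ** gram c p ** E) \<bullet> \<beta>"
    unfolding bc by (simp only: inner_matrix_mult_right[of _ "E ** \<beta>"] inner_matrix_mult_left[of _ E] transpose_transpose matrix_mul_assoc)
  then show ?thesis by (simp add: bivector_metric_gram[OF a b] ac frame4_coords(2)[OF E])
qed

lemma twistor_fibre_frame:
  assumes E: "frame4 (gram c p) E"
  shows "a \<in> twistor_fibre \<A> g s p \<longleftrightarrow>
    a \<in> bivectors \<A> p \<and> (\<exists>\<alpha>. eigen4 s \<alpha> \<and> \<alpha> \<bullet> \<alpha> = 4 \<and> a c = E ** \<alpha> ** transpose E)"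
proof -
  have "bivector_metric \<A> g p a a = 1 \<longleftrightarrow> \<alpha> \<bullet> \<alpha> = 4"
    if "a \<in> bivectors \<A> p" "a c = E ** \<alpha> ** transpose E" for \<alpha>
    by (simp add: bivector_metric_frame[OF E that(1,1,2,2)])
  then show ?thesis
    unfolding twistor_fibre_def mem_Collect_eq hodge_eigenspace_frame[OF E] by blast
qed

text \<open>In a chart \<open>K_endo\<close> is multiplication by minus \<open>a\<close> times the
  Gram matrix: by skewness of \<open>a\<close> the two terms of the wedge pairing coincide, and
  nondegeneracy removes the test vector. The sign drops out of products of two such maps.\<close>

lemma K_endo_gram:
  assumes a: "a \<in> bivectors \<A> p" and X: "X \<in> tangent_space \<A> p"
  shows "K_endo \<A> g p a X = coord_vec \<A> c p (- (a c *v (gram c p *v X c)))"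
proof -
  let ?Z = "coord_vec \<A> c p (- (a c *v (gram c p *v X c)))"
  have Z: "?Z \<in> tangent_space \<A> p" by (rule coord_vec_tangent[OF c p])
  have gZ: "g p ?Z Y = 2 * bivector_metric \<A> g p a (wedge X Y)" if Y: "Y \<in> tangent_space \<A> p" for Y
  proof -
    let ?m = "gram c p ** a c ** gram c p"
    have "transpose (a c) = - a c" using bivector_skew[OF a, of c] by (simp add: skew_def)
    then have m: "transpose ?m = - ?m"
      by (simp add: matrix_linear_simps gram_sym)
    have "2 * bivector_metric \<A> g p a (wedge X Y) = (X c \<bullet> (?m *v Y c) - Y c \<bullet> (?m *v X c)) / 2"
      by (simp add: bivector_metric_gram[OF a wedge_bivectors[OF X Y c p]] wedge_apply wedge4_inner)
    also have "X c \<bullet> (?m *v Y c) = - (Y c \<bullet> (?m *v X c))"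
    proof -
      have "X c \<bullet> (?m *v Y c) = (transpose ?m *v X c) \<bullet> Y c" by (rule inner_matrix_vector)
      also have "\<dots> = - (?m *v X c) \<bullet> Y c" by (simp only: m matrix_vector_minus)
      finally show ?thesis by (simp add: inner_commute)
    qed
    finally have 1: "2 * bivector_metric \<A> g p a (wedge X Y) = - (Y c \<bullet> (?m *v X c))" by simp
    have "g p ?Z Y = - ((a c *v (gram c p *v X c)) \<bullet> (gram c p *v Y c))"
      by (simp add: metric_gram[OF Z Y] coord_vec_self[OF c p])
    also have "\<dots> = - (Y c \<bullet> (?m *v X c))"
      by (simp only: inner_matrix_vector[of _ "gram c p"] gram_sym)
        (simp add: inner_commute matrix_vector_mul_assoc matrix_mul_assoc)
    finally show ?thesis using 1 by simp
  qed
  show ?thesis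
    unfolding K_endo_def
  proof (rule the_equality)
    show "?Z \<in> tangent_space \<A> p \<and> (\<forall>Y\<in>tangent_space \<A> p. g p ?Z Y = 2 * bivector_metric \<A> g p a (wedge X Y))"
      using Z gZ by blast
    fix W assume W: "W \<in> tangent_space \<A> p \<and> (\<forall>Y\<in>tangent_space \<A> p. g p W Y = 2 * bivector_metric \<A> g p a (wedge X Y))"
    have "W c = ?Z c"
    proof (rule ccontr)
      assume ne: "W c \<noteq> ?Z c"
      define y where "y = W c - ?Z c"
      have WT: "W \<in> tangent_space \<A> p" using W by blast
      have Y: "coord_vec \<A> c p y \<in> tangent_space \<A> p" by (rule coord_vec_tangent[OF c p])
      have "g p W (coord_vec \<A> c p y) = g p ?Z (coord_vec \<A> c p y)" using W gZ Y by simp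
      then have "W c \<bullet> (gram c p *v y) = ?Z c \<bullet> (gram c p *v y)"
        by (simp only: metric_gram[OF WT Y] metric_gram[OF Z Y] coord_vec_self[OF c p, of y])
      then have "y \<bullet> (gram c p *v y) = 0"
        unfolding y_def by (simp only: inner_diff_left)
      then show False using gram_pos[of y] ne by (simp add: y_def)
    qed
    then show "W = ?Z" using tangent_eqI[OF _ Z c p] W by blast
  qed
qed

end

subsection \<open>The connection in a chart\<close>

abbreviation conn :: "'m chart \<Rightarrow> 'm \<Rightarrow> ('m chart \<Rightarrow> real^4) \<Rightarrow> real^4^4" where
  "conn \<equiv> connection_matrix \<A> D"

lemma gram_smooth:
  assumes c: "c \<in> \<A>"
  shows "smooth_on (\<lambda>x. gram c (inv_chart c x)) (snd c ` fst c)"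
proof -
  have "smooth_function \<A> (fst c) (\<lambda>p. g p (coord_field \<A> c i p) (coord_field \<A> c j p))" for i j
    by (rule metric[unfolded riemannian_metric_def, THEN conjunct2, rule_format,
          OF conjI[OF openin_chart[OF c] conjI[OF coord_field_vector_field[OF c] coord_field_vector_field[OF c]]]])
  then have "smooth_on ((\<lambda>p. g p (coord_field \<A> c i p) (coord_field \<A> c j p)) \<circ> inv_chart c) (snd c ` (fst c \<inter> fst c))" for i j
    using c unfolding smooth_function_def by blast
  then show ?thesis
    by (simp add: smooth_on_vec_iff[OF chart_open[OF c]] gram_def o_def)
qed

text \<open>A connection is linear in its direction, so the matrix of any direction is a combination
  of the Christoffel matrices of the coordinate directions. Their smoothness then gives horizontal
  lifts smooth representatives.\<close>

lemma conn_expand: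
  assumes c: "c \<in> \<A>" "p \<in> fst c" and v: "v \<in> tangent_space \<A> p"
  shows "conn c p v = (\<Sum>k\<in>UNIV. (v c $ k) *\<^sub>R conn c p (coord_field \<A> c k p))"
proof -
  have aff: "affine_connection M \<A> D" using connection by (simp add: levi_civita_connection_def)
  have lin: "linear_on_set (tangent_space \<A> p) (\<lambda>v. D p v (coord_field \<A> c j))" for j
    by (rule aff[unfolded affine_connection_def, rule_format, OF openin_chart[OF c(1)], THEN conjunct1,
          rule_format, OF c(2) coord_field_vector_field[OF c(1)], THEN conjunct1])
  have "D p v (coord_field \<A> c j) = (\<Sum>k\<in>UNIV. (v c $ k) *\<^sub>R D p (coord_field \<A> c k p) (coord_field \<A> c j))" for j
    by (rule linear_tangent_expand[OF lin v c])
  then show ?thesis by (simp add: connection_matrix_def vec_eq_iff)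
qed

lemma conn_smooth:
  assumes c: "c \<in> \<A>"
  shows "smooth_on (\<lambda>x. conn c (inv_chart c x) (coord_field \<A> c k (inv_chart c x))) (snd c ` fst c)"
proof -
  have aff: "affine_connection M \<A> D" using connection by (simp add: levi_civita_connection_def)
  have "vector_field \<A> (fst c) (\<lambda>p. D p (coord_field \<A> c k p) (coord_field \<A> c j))" for j
    by (rule aff[unfolded affine_connection_def, rule_format, OF openin_chart[OF c], THEN conjunct2,
          rule_format, OF conjI[OF coord_field_vector_field[OF c] coord_field_vector_field[OF c]]])
  then have "smooth_on (\<lambda>x. D (inv_chart c x) (coord_field \<A> c k (inv_chart c x)) (coord_field \<A> c j) c) (snd c ` (fst c \<inter> fst c))" for j
    using c unfolding vector_field_def by blast
  then have "smooth_on (\<lambda>x. D (inv_chart c x) (coord_field \<A> c k (inv_chart c x)) (coord_field \<A> c j) c $ i) (snd c ` fst c)" for i j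
    by (intro smooth_on_linear[OF bounded_linear_vec_nth chart_open[OF c]]) simp
  then show ?thesis
    by (simp add: smooth_on_vec_iff[OF chart_open[OF c]] connection_matrix_def)
qed

text \<open>Metric compatibility applied to pairs of coordinate fields. It says that minus the
  connection matrix is an infinitesimal isometry in the direction \<open>u\<close>.\<close>

lemma conn_metric:
  assumes c: "c \<in> \<A>" and p: "p \<in> fst c"
  shows "frechet_derivative (\<lambda>x. gram c (inv_chart c x)) (at (snd c p)) u =
    transpose (conn c p (coord_vec \<A> c p u)) ** gram c p + gram c p ** conn c p (coord_vec \<A> c p u)"
proof -
  let ?\<omega> = "conn c p (coord_vec \<A> c p u)"
  have aff: "affine_connection M \<A> D" using connection by (simp add: levi_civita_connection_def)
  have Dt: "D p (coord_vec \<A> c p u) (coord_field \<A> c j) \<in> tangent_space \<A> p" for j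
    by (rule aff[unfolded affine_connection_def, rule_format, OF openin_chart[OF c], THEN conjunct1,
          rule_format, OF p coord_field_vector_field[OF c], THEN conjunct2, rule_format,
          OF coord_vec_tangent[OF c p], THEN conjunct1])
  have col: "D p (coord_vec \<A> c p u) (coord_field \<A> c j) c = column j ?\<omega>" for j
    by (simp add: connection_matrix_def column_def vec_eq_iff)
  have gd: "((\<lambda>x. gram c (inv_chart c x)) has_derivative
      frechet_derivative (\<lambda>x. gram c (inv_chart c x)) (at (snd c p))) (at (snd c p))"
    using gram_smooth[OF c] p by (intro has_frechet_derivative) (auto intro: smooth_on_differentiable)
  have "frechet_derivative (\<lambda>x. gram c (inv_chart c x)) (at (snd c p)) u $ i $ j
      = (transpose ?\<omega> ** gram c p + gram c p ** ?\<omega>) $ i $ j" for i j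
  proof -
    let ?f = "\<lambda>q. g q (coord_field \<A> c i q) (coord_field \<A> c j q)"
    have "((\<lambda>x. gram c (inv_chart c x) $ i $ j) has_derivative
        (\<lambda>v. frechet_derivative (\<lambda>x. gram c (inv_chart c x)) (at (snd c p)) v $ i $ j)) (at (snd c p))"
      by (intro bounded_linear.has_derivative[OF bounded_linear_vec_nth] gd)
    then have "frechet_derivative (?f \<circ> inv_chart c) (at (snd c p))
        = (\<lambda>v. frechet_derivative (\<lambda>x. gram c (inv_chart c x)) (at (snd c p)) v $ i $ j)"
      by (intro frechet_derivative_at[symmetric]) (simp add: gram_def o_def)
    then have "frechet_derivative (\<lambda>x. gram c (inv_chart c x)) (at (snd c p)) u $ i $ j
        = dir_deriv c p (coord_vec \<A> c p u) ?f"
      by (simp add: dir_deriv_def coord_vec_self[OF c p])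
    also have "\<dots> = g p (D p (coord_vec \<A> c p u) (coord_field \<A> c i)) (coord_field \<A> c j p)
        + g p (coord_field \<A> c i p) (D p (coord_vec \<A> c p u) (coord_field \<A> c j))"
      by (rule connection[unfolded levi_civita_connection_def, THEN conjunct2, rule_format,
            OF conjI[OF openin_chart[OF c] conjI[OF coord_vec_field[OF c] conjI[OF coord_field_vector_field[OF c]
              coord_field_vector_field[OF c]]]] p, THEN conjunct2, rule_format, OF c p])
    also have "\<dots> = column i ?\<omega> \<bullet> (gram c p *v axis j 1) + axis i 1 \<bullet> (gram c p *v column j ?\<omega>)"
      by (simp add: metric_gram[OF c p] Dt coord_field_tangent[OF c p] coord_field_self[OF c p] col)
    also have "\<dots> = (transpose ?\<omega> ** gram c p ** mat 1) $ i $ j + (transpose (mat 1) ** gram c p ** ?\<omega>) $ i $ j"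
    proof -
      have "column k (mat 1) = (axis k 1 :: real^4)" for k
        by (simp add: column_def mat_def axis_def vec_eq_iff)
      then show ?thesis by (simp only: gram_entry)
    qed
    finally show ?thesis by simp
  qed
  then show ?thesis by (simp add: vec_eq_iff)
qed

end

section \<open>Derivatives along a subset\<close>

text \<open>Differentiability is demanded only at 0, so a curve may be continued by a constant
  wherever its construction breaks down.\<close>

definition velocity_in :: "'a::real_normed_vector set \<Rightarrow> 'a \<Rightarrow> 'a \<Rightarrow> bool" where
  "velocity_in S z w \<longleftrightarrow>
     (\<exists>\<gamma>. \<gamma> 0 = z \<and> (\<forall>t. \<gamma> t \<in> S) \<and> (\<gamma> has_vector_derivative w) (at (0::real)))"

text \<open>The derivative within a subset \<open>S\<close> is an arbitrary choice; only its values on velocities of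
  curves in \<open>S\<close> are determined.\<close>

lemma frechet_derivative_within_velocity:
  fixes F :: "'a::euclidean_space \<Rightarrow> 'b::real_normed_vector"
  assumes F: "(F has_derivative F') (at z)" and eq: "\<And>y. y \<in> S \<Longrightarrow> f y = F y"
    and w: "velocity_in S z w"
  shows "frechet_derivative f (at z within S) w = F' w"
proof -
  obtain \<gamma> :: "real \<Rightarrow> 'a" where \<gamma>: "\<gamma> 0 = z" "\<And>t. \<gamma> t \<in> S" "(\<gamma> has_vector_derivative w) (at 0)"
    using w unfolding velocity_in_def by blast
  have zS: "z \<in> S" using \<gamma>(1,2) by metis
  have "(f has_derivative F') (at z within S)"
    by (rule has_derivative_transform[OF zS eq has_derivative_at_withinI[OF F]])
  then have "f differentiable (at z within S)" by (auto simp: differentiable_def)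
  then have L: "(f has_derivative frechet_derivative f (at z within S)) (at z within S)"
    by (simp add: frechet_derivative_works)
  define L where "L = frechet_derivative f (at z within S)"
  have lin: "linear L" unfolding L_def using L has_derivative_linear by blast
  have "(f has_derivative L) (at (\<gamma> 0) within range \<gamma>)"
    by (rule has_derivative_subset[of _ _ _ S]) (use L \<gamma> in \<open>auto simp: L_def\<close>)
  then have "(f \<circ> \<gamma> has_derivative L \<circ> (\<lambda>t. t *\<^sub>R w)) (at 0)"
    using diff_chain_within[of \<gamma> "\<lambda>t. t *\<^sub>R w" 0 UNIV f L] \<gamma>(3)
    by (simp add: has_vector_derivative_def)
  then have "(f \<circ> \<gamma> has_vector_derivative L w) (at 0)"
    by (simp add: has_vector_derivative_def o_def linear_scale[OF lin])
  moreover have "(F has_derivative F') (at (\<gamma> 0))" using F \<gamma>(1) by simp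
  then have "(F \<circ> \<gamma> has_derivative F' \<circ> (\<lambda>t. t *\<^sub>R w)) (at 0)"
    using diff_chain_at[of \<gamma> "\<lambda>t. t *\<^sub>R w" 0 F F'] \<gamma>(3) by (simp add: has_vector_derivative_def)
  then have "(F \<circ> \<gamma> has_vector_derivative F' w) (at 0)"
    using has_derivative_linear[OF F] by (simp add: has_vector_derivative_def o_def linear_scale)
  moreover have "f \<circ> \<gamma> = F \<circ> \<gamma>" using eq \<gamma>(2) by auto
  ultimately show ?thesis
    unfolding L_def by (metis vector_derivative_unique_at)
qed

lemma derivative_along_line:
  assumes "(F has_derivative F') (at z)"
  shows "((\<lambda>s. F (z + s *\<^sub>R w)) has_vector_derivative F' w) (at 0)"
proof -
  have "((\<lambda>s. z + s *\<^sub>R w) has_derivative (\<lambda>s. s *\<^sub>R w)) (at 0)"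
    by (auto intro!: derivative_eq_intros)
  moreover have "(F has_derivative F') (at (z + 0 *\<^sub>R w))" using assms by simp
  ultimately have "(F \<circ> (\<lambda>s. z + s *\<^sub>R w) has_derivative F' \<circ> (\<lambda>s. s *\<^sub>R w)) (at 0)"
    by (rule diff_chain_at)
  then show ?thesis
    using has_derivative_linear[OF assms] by (simp add: has_vector_derivative_def o_def linear_scale)
qed

text \<open>Meant for a function \<open>R\<close> picked pointwise without known regularity:
  bounding its increments by those of a function with vanishing derivative already makes it
  differentiable at 0.\<close>

lemma has_vector_derivative_zero_dominated:
  fixes P :: "real \<Rightarrow> 'a::real_normed_vector" and R :: "real \<Rightarrow> 'b::real_normed_vector"
  assumes P: "(P has_vector_derivative 0) (at 0)"
    and le: "eventually (\<lambda>t. norm (R t - R 0) \<le> C * norm (P t - P 0)) (at 0)"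
  shows "(R has_vector_derivative 0) (at 0)"
proof -
  have "((\<lambda>t. norm (P t - P 0) / norm t) \<longlongrightarrow> 0) (at 0)"
    using P by (simp add: has_vector_derivative_def has_derivative_iff_norm)
  then have "((\<lambda>t. C * (norm (P t - P 0) / norm t)) \<longlongrightarrow> 0) (at 0)"
    by (rule tendsto_mult_right_zero)
  then have "((\<lambda>t. norm (R t - R 0) / norm t) \<longlongrightarrow> 0) (at 0)"
  proof (rule Lim_null_comparison[rotated])
    show "eventually (\<lambda>t. norm (norm (R t - R 0) / norm t) \<le> C * (norm (P t - P 0) / norm t)) (at 0)"
      using le by (rule eventually_mono) (simp add: divide_right_mono)
  qed
  then show ?thesis
    by (simp add: has_vector_derivative_def has_derivative_iff_norm)
qed

lemmas matrix_mult_has_vector_derivative =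
  bounded_bilinear.has_vector_derivative[OF bounded_bilinear_matrix_mult]

lemmas transpose_has_vector_derivative =
  bounded_linear.has_vector_derivative[OF bounded_linear_transpose]

text \<open>If \<open>N\<close> is an infinitesimal isometry along \<open>G\<close>, then the frames \<open>(1 + t N) E\<close> are orthonormal up to
  \<open>o(t)\<close>, and orthonormalising them does not change their velocity.\<close>

lemma frame4_curve:
  fixes G :: "real \<Rightarrow> real^4^4"
  assumes E: "frame4 (G 0) E" and G: "(G has_vector_derivative G') (at 0)"
    and sym: "eventually (\<lambda>t. transpose (G t) = G t) (nhds 0)"
    and N: "transpose N ** G 0 + G 0 ** N + G' = 0"
  obtains F where "F 0 = E" "(F has_vector_derivative (N ** E)) (at 0)"
    "eventually (\<lambda>t. frame4 (G t) (F t)) (nhds 0)"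
proof -
  define f where "f t = E + t *\<^sub>R (N ** E)" for t :: real
  define P where "P t = transpose (f t) ** G t ** f t" for t
  have f0: "f 0 = E" by (simp add: f_def)
  have P0: "P 0 = mat 1" using E by (simp add: P_def f0 frame4_def)
  have df: "(f has_vector_derivative (N ** E)) (at 0)"
    unfolding f_def by (auto intro!: derivative_eq_intros)
  have "(P has_vector_derivative
      ((transpose (f 0) ** G 0) ** (N ** E) + (transpose (f 0) ** G' + transpose (N ** E) ** G 0) ** f 0)) (at 0)"
    unfolding P_def
    by (intro matrix_mult_has_vector_derivative transpose_has_vector_derivative df G)
  \<comment> \<open>The hypothesis on \<open>N\<close> is the vanishing of the first-order change of
    the Gram matrix of \<open>f t\<close>.\<close>
  moreover have "(transpose (f 0) ** G 0) ** (N ** E) + (transpose (f 0) ** G' + transpose (N ** E) ** G 0) ** f 0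
      = transpose E ** (transpose N ** G 0 + G 0 ** N + G') ** E"
    by (simp add: f0 matrix_linear_simps)
  ultimately have dP: "(P has_vector_derivative 0) (at 0)"
    by (simp add: N)
  obtain r C where r: "r > 0" and RC: "\<And>Q :: real^4^4. transpose Q = Q \<Longrightarrow> norm (Q - mat 1) \<le> r \<Longrightarrow>
      \<exists>R. transpose R ** Q ** R = mat 1 \<and> norm (R - mat 1) \<le> C * norm (Q - mat 1)"
    by (rule inverse_sqrt_near_identity) blast
  define good where "good t \<longleftrightarrow> transpose (P t) = P t \<and> norm (P t - mat 1) \<le> r" for t
  \<comment> \<open>An arbitrary choice for each \<open>t\<close>, with the identity where none is
    guaranteed. Its derivative at 0 comes only from the estimate by
    \<open>P t - mat 1\<close>.\<close>
  define R where "R t = (if good t then SOME R. transpose R ** P t ** R = mat 1 \<and> norm (R - mat 1) \<le> C * norm (P t - mat 1) else mat 1)" for t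
  have R: "transpose (R t) ** P t ** R t = mat 1" "norm (R t - mat 1) \<le> C * norm (P t - mat 1)" if "good t" for t
    using someI_ex[OF RC[of "P t"]] that by (simp_all add: R_def good_def)
  have contP: "(P \<longlongrightarrow> P 0) (at 0)"
    using has_vector_derivative_continuous[OF dP] by (simp add: isCont_def)
  then have "(P \<longlongrightarrow> P 0) (nhds 0)" by (simp add: tendsto_at_iff_tendsto_nhds)
  then have "eventually (\<lambda>t. dist (P t) (P 0) < r) (nhds 0)" using r by (rule tendstoD)
  moreover have "eventually (\<lambda>t. transpose (P t) = P t) (nhds 0)"
    using sym by (rule eventually_mono) (simp add: P_def matrix_linear_simps)
  ultimately have good: "eventually good (nhds 0)"
    by eventually_elim (simp add: good_def P0 dist_norm)
  then have "good 0" by (rule eventually_nhds_x_imp_x)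
  from R(2)[OF this] have R0: "R 0 = mat 1" by (simp add: P0)
  have dR: "(R has_vector_derivative 0) (at 0)"
  proof (rule has_vector_derivative_zero_dominated[OF dP])
    show "eventually (\<lambda>t. norm (R t - R 0) \<le> C * norm (P t - P 0)) (at 0)"
      unfolding R0 P0
      by (rule eventually_mono[OF filter_leD[OF at_within_le_nhds good]]) (rule R)
  qed
  define F where "F t = f t ** R t" for t
  have F0: "F 0 = E" by (simp add: F_def f0 R0)
  have dF: "(F has_vector_derivative (N ** E)) (at 0)"
  proof -
    have "(F has_vector_derivative (f 0 ** 0 + (N ** E) ** R 0)) (at 0)"
      unfolding F_def by (rule matrix_mult_has_vector_derivative[OF df dR])
    moreover have "f 0 ** (0 :: real^4^4) = 0" by (simp add: matrix_matrix_mult_def vec_eq_iff)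
    ultimately show ?thesis by (simp add: R0)
  qed
  have "(F \<longlongrightarrow> F 0) (at 0)"
    using has_vector_derivative_continuous[OF dF] by (simp add: isCont_def)
  then have "(F \<longlongrightarrow> E) (nhds 0)" using F0 tendsto_at_iff_tendsto_nhds[of F 0] by simp
  \<comment> \<open>Orientation is an open condition, so it persists near 0 by continuity.\<close>
  then have "((\<lambda>t. det (F t)) \<longlongrightarrow> det E) (nhds 0)"
    unfolding det_4 by (intro tendsto_intros)
  then have "eventually (\<lambda>t. det (F t) > 0) (nhds 0)"
    using E by (intro order_tendstoD(1)) (auto simp: frame4_def)
  then have "eventually (\<lambda>t. frame4 (G t) (F t)) (nhds 0)"
    using good
  proof eventually_elim
    case (elim t)
    have "transpose (F t) ** G t ** F t = transpose (R t) ** P t ** R t"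
      by (simp add: F_def P_def matrix_transpose_mul matrix_mul_assoc)
    then show ?case using R(1) elim by (simp add: frame4_def)
  qed
  with F0 dF show thesis by (rule that)
qed

lemma smooth_on_fst:
  assumes "open T" "smooth_on h T"
  shows "smooth_on (\<lambda>z. h (fst z)) (T \<times> UNIV)"
proof (rule smooth_on_compose[OF _ assms(1) _ assms(2)])
  show o: "open (T \<times> UNIV)" using assms(1) by (simp add: open_Times)
  show "smooth_on fst (T \<times> UNIV)"
    by (rule smooth_on_linear[OF bounded_linear_fst o smooth_on_ident[OF o]])
qed auto

lemma bounded_bilinear_wedge4: "bounded_bilinear wedge4"
proof -
  have "linear (wedge4 x)" "linear (\<lambda>x. wedge4 x y)" for x y
    by (rule linearI; simp add: wedge4_def vec_eq_iff algebra_simps)+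
  then have "bilinear wedge4" unfolding bilinear_def by (simp add: eta_contract_eq)
  then show ?thesis by (simp add: bilinear_conv_bounded_bilinear)
qed

section \<open>The product of twistor spaces in a chart\<close>

context riemannian_charts
begin

abbreviation "gramx c \<equiv> \<lambda>x. gram c (inv_chart c x)"

lemma twistor_inv_chart:
  assumes c: "c \<in> \<A>" and \<kappa>: "\<kappa> \<in> twistor_dom M \<A> g c"
  shows "twistor_inv M \<A> g c (bundle_chart c \<kappa>) = \<kappa>"
proof -
  have "inj_on (bundle_chart c) (twistor_dom M \<A> g c)"
  proof (rule inj_onI)
    fix x y assume x: "x \<in> twistor_dom M \<A> g c" and y: "y \<in> twistor_dom M \<A> g c"
      and eq: "bundle_chart c x = bundle_chart c y"
    obtain p a b where xp: "x = (p, a, b)" by (cases x)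
    obtain q a' b' where yq: "y = (q, a', b')" by (cases y)
    have p: "p \<in> fst c" "q \<in> fst c" using x y by (simp_all add: xp yq twistor_dom_def)
    have "snd c p = snd c q" using eq by (simp add: xp yq bundle_chart_def)
    then have pq: "p = q" using inj_onD[OF chart_inj[OF c]] p by blast
    have biv: "a \<in> bivectors \<A> p" "b \<in> bivectors \<A> p" "a' \<in> bivectors \<A> p" "b' \<in> bivectors \<A> p"
      using x y by (simp_all add: xp yq pq twistor_dom_def twistor_product_def twistor_fibre_def hodge_eigenspace_def)
    have "a c = a' c" "b c = b' c" using eq by (simp_all add: xp yq bundle_chart_def)
    then show "x = y" using pq bivector_eqI[OF biv(1,3) c p(1)] bivector_eqI[OF biv(2,4) c p(1)] by (simp add: xp yq)
  qed
  then show ?thesis unfolding twistor_inv_def using \<kappa> by (rule inv_into_f_f)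
qed

lemma gram_line_derivative:
  assumes c: "c \<in> \<A>" and p: "p \<in> fst c"
  shows "((\<lambda>t. gramx c (snd c p + t *\<^sub>R u)) has_vector_derivative
    frechet_derivative (gramx c) (at (snd c p)) u) (at 0)"
  by (rule derivative_along_line[OF has_frechet_derivative[OF smooth_on_differentiable[OF gram_smooth[OF c]]]])
    (use p in blast)

text \<open>Moving the point with velocity \<open>u\<close> and a frame \<open>E\<close> with
  velocity \<open>N ** E\<close> keeps the frame orthonormal to first order. Three instances are
  used: zero, a rotation of one tangent space, and minus the connection matrix.\<close>

definition isometric_at :: "'m chart \<Rightarrow> 'm \<Rightarrow> real^4 \<Rightarrow> real^4^4 \<Rightarrow> bool" where
  "isometric_at c p u N \<longleftrightarrow>
     transpose N ** gram c p + gram c p ** N + frechet_derivative (gramx c) (at (snd c p)) u = 0"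

text \<open>The coefficients \<open>\<alpha>\<close> and \<open>\<beta>\<close> are kept constant in
  moving orthonormal frames, so the curve stays in the twistor fibres; differentiating the
  conjugation by the frame gives the stated components. Separate matrices \<open>N\<close> and
  \<open>N'\<close> let one bivector turn while the other rests.\<close>

lemma twistor_velocity:
  assumes c: "c \<in> \<A>" and \<kappa>: "(p, a, b) \<in> twistor_dom M \<A> g c"
    and N: "isometric_at c p u N" "isometric_at c p u N'"
  shows "velocity_in (twistor_image M \<A> g c) (bundle_chart c (p, a, b))
    (u, N ** a c + a c ** transpose N, N' ** b c + b c ** transpose N')"
proof -
  let ?x = "\<lambda>t::real. snd c p + t *\<^sub>R u"
  let ?G = "\<lambda>t. gramx c (?x t)"
  have p: "p \<in> fst c" and a: "a \<in> twistor_fibre \<A> g 1 p" and b: "b \<in> twistor_fibre \<A> g (-1) p"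
    using \<kappa> by (auto simp: twistor_dom_def twistor_product_def)
  obtain E where E: "frame4 (gram c p) E" using gram_frame_exists[OF c p] by blast
  obtain \<alpha> where \<alpha>: "eigen4 1 \<alpha>" "\<alpha> \<bullet> \<alpha> = 4" "a c = E ** \<alpha> ** transpose E"
    using a twistor_fibre_frame[OF c p E] by blast
  obtain \<beta> where \<beta>: "eigen4 (-1) \<beta>" "\<beta> \<bullet> \<beta> = 4" "b c = E ** \<beta> ** transpose E"
    using b twistor_fibre_frame[OF c p E] by blast
  have "((\<lambda>t. snd c p + t *\<^sub>R u) \<longlongrightarrow> snd c p + 0 *\<^sub>R u) (nhds 0)"
    by (intro tendsto_intros filterlim_ident)
  then have inside: "eventually (\<lambda>t. ?x t \<in> snd c ` fst c) (nhds 0)"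
    using chart_open[OF c] p by (intro topological_tendstoD) auto
  have sym: "eventually (\<lambda>t. transpose (?G t) = ?G t) (nhds 0)"
    using inside by (rule eventually_mono) (auto simp: inv_chart[OF c] intro!: gram_sym[OF c])
  have G0: "?G 0 = gram c p" by (simp add: inv_chart[OF c p])
  have curve: "\<exists>F. F 0 = E \<and> (F has_vector_derivative (N ** E)) (at 0) \<and>
      eventually (\<lambda>t. frame4 (?G t) (F t)) (nhds 0)" if "isometric_at c p u N" for N
    by (rule frame4_curve[OF _ gram_line_derivative[OF c p] sym, of E N])
      (use E that in \<open>auto simp: G0 isometric_at_def inv_chart[OF c p]\<close>)
  obtain F where F: "F 0 = E" "(F has_vector_derivative (N ** E)) (at 0)"
      "eventually (\<lambda>t. frame4 (?G t) (F t)) (nhds 0)" using curve[OF N(1)] by blast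
  obtain F' where F': "F' 0 = E" "(F' has_vector_derivative (N' ** E)) (at 0)"
      "eventually (\<lambda>t. frame4 (?G t) (F' t)) (nhds 0)" using curve[OF N(2)] by blast
  define good where "good t \<longleftrightarrow> ?x t \<in> snd c ` fst c \<and> frame4 (?G t) (F t) \<and> frame4 (?G t) (F' t)" for t
  define \<delta> where "\<delta> t = (?x t, F t ** \<alpha> ** transpose (F t), F' t ** \<beta> ** transpose (F' t))" for t
  \<comment> \<open>The frames are available only near 0; elsewhere the curve is set to its starting
    point.\<close>
  define \<gamma> where "\<gamma> t = (if good t then \<delta> t else bundle_chart c (p, a, b))" for t
  have \<delta>0: "\<delta> 0 = bundle_chart c (p, a, b)" by (simp add: \<delta>_def bundle_chart_def F F' \<alpha> \<beta>)
  have "\<gamma> t \<in> twistor_image M \<A> g c" for t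
  proof (cases "good t")
    case True
    then obtain q where q: "q \<in> fst c" "?x t = snd c q" by (auto simp: good_def)
    have Fq: "frame4 (gram c q) (F t)" "frame4 (gram c q) (F' t)"
      using True by (simp_all add: good_def q inv_chart[OF c q(1)])
    let ?a = "bivec_of c q (F t ** \<alpha> ** transpose (F t))" and ?b = "bivec_of c q (F' t ** \<beta> ** transpose (F' t))"
    have sk: "skew \<alpha>" "skew \<beta>" using \<alpha>(1) \<beta>(1) by (simp_all add: eigen4_def)
    have "?a \<in> twistor_fibre \<A> g 1 q"
      unfolding twistor_fibre_frame[OF c q(1) Fq(1)]
      using bivec_of_bivectors[OF c q(1) skew_conj[OF sk(1)]] bivec_of_self[OF c q(1)] \<alpha>(1,2) by blast
    moreover have "?b \<in> twistor_fibre \<A> g (-1) q"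
      unfolding twistor_fibre_frame[OF c q(1) Fq(2)]
      using bivec_of_bivectors[OF c q(1) skew_conj[OF sk(2)]] bivec_of_self[OF c q(1)] \<beta>(1,2) by blast
    ultimately have "(q, ?a, ?b) \<in> twistor_dom M \<A> g c"
      using q(1) point_in_M[OF c q(1)] by (simp add: twistor_dom_def twistor_product_def)
    moreover have "bundle_chart c (q, ?a, ?b) = \<gamma> t"
      using True by (simp add: \<gamma>_def \<delta>_def bundle_chart_def q bivec_of_self[OF c q(1)])
    ultimately show ?thesis unfolding twistor_image_def by (metis imageI)
  next
    case False
    then show ?thesis using \<kappa> by (simp add: \<gamma>_def twistor_image_def)
  qed
  moreover have "\<gamma> 0 = bundle_chart c (p, a, b)" by (simp add: \<gamma>_def \<delta>0)
  moreover have "(\<gamma> has_vector_derivative (u, N ** a c + a c ** transpose N, N' ** b c + b c ** transpose N')) (at 0)"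
  proof -
    have conj: "((\<lambda>t. H t ** m ** transpose (H t)) has_vector_derivative
        (K ** (E ** m ** transpose E) + (E ** m ** transpose E) ** transpose K)) (at 0)"
      if "H 0 = E" "(H has_vector_derivative (K ** E)) (at 0)" for H K m
    proof -
      have "((\<lambda>t. H t ** m ** transpose (H t)) has_vector_derivative
          ((H 0 ** m) ** transpose (K ** E) + (H 0 ** 0 + (K ** E) ** m) ** transpose (H 0))) (at 0)"
        by (intro matrix_mult_has_vector_derivative transpose_has_vector_derivative
            has_vector_derivative_const that(2))
      moreover have "E ** (0 :: real^4^4) = 0" by (simp add: matrix_matrix_mult_def vec_eq_iff)
      ultimately show ?thesis by (simp add: that(1) matrix_linear_simps add.commute)
    qed
    have "(?x has_vector_derivative u) (at 0)"
      by (auto intro!: derivative_eq_intros)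
    then have d\<delta>: "(\<delta> has_vector_derivative (u, N ** a c + a c ** transpose N, N' ** b c + b c ** transpose N')) (at 0)"
      unfolding \<delta>_def \<alpha>(3) \<beta>(3) by (intro has_vector_derivative_Pair conj F(1,2) F'(1,2))
    have "eventually good (nhds 0)"
      using inside F(3) F'(3) by eventually_elim (simp add: good_def)
    then obtain T where T: "open T" "0 \<in> T" "\<And>t. t \<in> T \<Longrightarrow> good t" unfolding eventually_nhds by blast
    show ?thesis
      by (rule has_vector_derivative_transform_within_open[OF d\<delta> T(1,2)]) (simp add: \<gamma>_def T(3))
  qed
  ultimately show ?thesis unfolding velocity_in_def by blast
qed

lemma frechet_gram_linear:
  assumes c: "c \<in> \<A>" and p: "p \<in> fst c"
  shows "frechet_derivative (gramx c) (at (snd c p)) 0 = 0"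
  using linear_0[OF linear_frechet_derivative[OF smooth_on_differentiable[OF gram_smooth[OF c]]]] p by blast

lemma isometric_zero:
  assumes "c \<in> \<A>" "p \<in> fst c" shows "isometric_at c p 0 0"
  by (simp add: isometric_at_def frechet_gram_linear[OF assms] matrix_matrix_mult_def transpose_def vec_eq_iff)

text \<open>An infinitesimal rotation of one fixed tangent space; it drives the vertical
  curves.\<close>

lemma isometric_skew:
  assumes "c \<in> \<A>" "p \<in> fst c" "skew w" shows "isometric_at c p 0 (w ** gram c p)"
  using assms(3)
  by (simp add: isometric_at_def frechet_gram_linear[OF assms(1,2)] matrix_linear_simps gram_sym[OF assms(1,2)] skew_def)

lemma isometric_conn:
  assumes "c \<in> \<A>" "p \<in> fst c" shows "isometric_at c p u (- conn c p (coord_vec \<A> c p u))"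
  by (simp add: isometric_at_def conn_metric[OF assms] matrix_linear_simps)

subsection \<open>Vertical fields\<close>

text \<open>With an index lowered by the metric, this is the commutator of \<open>w\<close> and
  \<open>a\<close> as endomorphisms. A bivector field \<open>w\<close> on the base thus yields a
  vertical field depending smoothly on \<open>a\<close>.\<close>

definition bivec_comm :: "'m \<Rightarrow> 'm tensor2 \<Rightarrow> 'm tensor2 \<Rightarrow> 'm tensor2" where
  "bivec_comm p w a = (\<lambda>c. w c ** gram c p ** a c - a c ** gram c p ** w c)"

lemma bivec_comm_bivectors:
  assumes c: "c \<in> \<A>" "p \<in> fst c" and w: "w \<in> bivectors \<A> p" and a: "a \<in> bivectors \<A> p"
  shows "bivec_comm p w a \<in> bivectors \<A> p"
proof (rule bivectorsI[OF _ _ c])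
  show "skew (bivec_comm p w a c)"
    using bivector_skew[OF w, of c] bivector_skew[OF a, of c]
    by (simp add: bivec_comm_def skew_def matrix_linear_simps gram_sym[OF c])
  fix d
  assume "\<not> (d \<in> \<A> \<and> p \<in> fst d)"
  then have "w d = 0" by (rule bivector_zero[OF w])
  then show "bivec_comm p w a d = 0"
    by (simp add: bivec_comm_def matrix_matrix_mult_def vec_eq_iff)
next
  fix d assume d: "d \<in> \<A>" "p \<in> fst d"
  let ?J = "jacobian c d p"
  have t: "w d = ?J ** w c ** transpose ?J" "a d = ?J ** a c ** transpose ?J"
    using bivector_transform[OF w c(1) d(1) c(2) d(2)] bivector_transform[OF a c(1) d(1) c(2) d(2)] by blast+
  have G: "transpose ?J ** gram d p ** ?J = gram c p" by (rule gram_transform[OF c d, symmetric])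
  have *: "?J ** x ** transpose ?J ** gram d p ** (?J ** y ** transpose ?J)
      = ?J ** (x ** gram c p ** y) ** transpose ?J" for x y
    unfolding G[symmetric] by (simp only: matrix_mul_assoc)
  show "bivec_comm p w a d = ?J ** bivec_comm p w a c ** transpose ?J"
    unfolding bivec_comm_def t * by (simp add: matrix_diff_left matrix_diff_right)
qed

lemma bivec_comm_frame:
  assumes E: "frame4 (gram c p) E" and "w c = E ** \<gamma> ** transpose E" "a c = E ** \<alpha> ** transpose E"
  shows "bivec_comm p w a c = E ** (\<gamma> ** \<alpha> - \<alpha> ** \<gamma>) ** transpose E"
proof -
  have "E ** x ** transpose E ** gram c p ** (E ** y ** transpose E)
      = E ** x ** (transpose E ** gram c p ** E) ** y ** transpose E" for x y
    by (simp only: matrix_mul_assoc)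
  then have "E ** x ** transpose E ** gram c p ** (E ** y ** transpose E) = E ** (x ** y) ** transpose E" for x y
    by (simp add: frame4_inverse(1)[OF E] matrix_mul_assoc)
  then show ?thesis
    unfolding bivec_comm_def assms(2,3) by (simp add: matrix_diff_left matrix_diff_right)
qed

text \<open>Read in frame coordinates, both claims are those of
  \<open>eigen4_commutator\<close>.\<close>

lemma bivec_comm_vertical:
  assumes c: "c \<in> \<A>" "p \<in> fst c" and w: "w \<in> bivectors \<A> p" and a: "a \<in> twistor_fibre \<A> g 1 p"
  shows "bivec_comm p w a \<in> hodge_eigenspace \<A> g 1 p" "bivector_metric \<A> g p (bivec_comm p w a) a = 0"
proof -
  obtain E where E: "frame4 (gram c p) E" using gram_frame_exists[OF c] by blast
  obtain \<alpha> where \<alpha>: "a \<in> bivectors \<A> p" "eigen4 1 \<alpha>" "a c = E ** \<alpha> ** transpose E"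
    using a twistor_fibre_frame[OF c E] by blast
  define \<gamma> where "\<gamma> = transpose E ** gram c p ** w c ** gram c p ** E"
  have wc: "w c = E ** \<gamma> ** transpose E" unfolding \<gamma>_def by (rule frame4_coords(1)[OF E, symmetric])
  have "skew (transpose E ** (gram c p ** w c ** transpose (gram c p)) ** transpose (transpose E))"
    by (intro skew_conj bivector_skew[OF w])
  then have "skew \<gamma>" by (simp add: \<gamma>_def matrix_mul_assoc gram_sym[OF c])
  note e = eigen4_commutator[OF this \<alpha>(2)]
  have biv: "bivec_comm p w a \<in> bivectors \<A> p" by (rule bivec_comm_bivectors[OF c w \<alpha>(1)])
  note cf = bivec_comm_frame[where w=w and a=a, OF E wc \<alpha>(3)]
  show "bivec_comm p w a \<in> hodge_eigenspace \<A> g 1 p"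
    unfolding hodge_eigenspace_frame[OF c E] using biv cf e(1) by blast
  show "bivector_metric \<A> g p (bivec_comm p w a) a = 0"
    using e(2) by (simp add: bivector_metric_frame[OF c E biv \<alpha>(1) cf \<alpha>(3)])
qed

lemma zero_vertical:
  assumes c: "c \<in> \<A>" "p \<in> fst c" and b: "b \<in> bivectors \<A> p"
  shows "0 \<in> hodge_eigenspace \<A> g s p" "bivector_metric \<A> g p 0 b = 0"
proof -
  obtain E where E: "frame4 (gram c p) E" using gram_frame_exists[OF c] by blast
  have "eigen4 s 0" by (simp add: eigen4_def skew_zero star4_def vec_eq_iff)
  moreover have "(0 :: 'm tensor2) c = E ** 0 ** transpose E"
    by (simp add: matrix_matrix_mult_def vec_eq_iff)
  ultimately show "0 \<in> hodge_eigenspace \<A> g s p"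
    unfolding hodge_eigenspace_frame[OF c E] using bivector_subspace(1) by blast
  show "bivector_metric \<A> g p 0 b = 0"
    by (simp add: bivector_metric_gram[OF c bivector_subspace(1) b] matrix_matrix_mult_def inner_vec_def)
qed

end

lemma smooth_on_minus: "open S \<Longrightarrow> smooth_on f S \<Longrightarrow> smooth_on (\<lambda>x. - f x) S"
  using smooth_on_diff[of S "\<lambda>x. 0" f] by (simp add: smooth_on_const)

text \<open>The base component of a derivative is read off along a line on which it is affine, so
  the fibre components of a representative, which contain the connection, need no explicit
  derivative.\<close>

lemma fst_derivative_affine:
  fixes F :: "'a::real_normed_vector \<Rightarrow> 'b::real_normed_vector \<times> 'c::real_normed_vector"
  assumes F: "F differentiable (at z)" and line: "\<And>s. fst (F (z + s *\<^sub>R w)) = y0 + s *\<^sub>R y1"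
  shows "fst (frechet_derivative F (at z) w) = y1"
proof -
  have "(F has_derivative frechet_derivative F (at z)) (at z)"
    using F by (rule has_frechet_derivative)
  then have "((\<lambda>s. F (z + s *\<^sub>R w)) has_vector_derivative frechet_derivative F (at z) w) (at 0)"
    by (rule derivative_along_line)
  then have "((\<lambda>s. fst (F (z + s *\<^sub>R w))) has_vector_derivative fst (frechet_derivative F (at z) w)) (at 0)"
    by (rule bounded_linear.has_vector_derivative[OF bounded_linear_fst])
  moreover have "((\<lambda>s. y0 + s *\<^sub>R y1) has_vector_derivative y1) (at 0)"
    by (auto intro!: derivative_eq_intros)
  ultimately show ?thesis unfolding line by (rule vector_derivative_unique_at)
qed

context riemannian_charts
begin

section \<open>Smooth representatives of vector fields in bundle charts\<close>

abbreviation chart_bundle :: "'m chart \<Rightarrow> ((real^4) \<times> (real^4^4) \<times> (real^4^4)) set" where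
  "chart_bundle c \<equiv> (snd c ` fst c) \<times> UNIV"

lemma chart_bundle_open: "c \<in> \<A> \<Longrightarrow> open (chart_bundle c)"
  by (intro open_Times chart_open open_UNIV)

lemma twistor_domD:
  assumes "(p, a, b) \<in> twistor_dom M \<A> g c"
  shows "p \<in> fst c" "a \<in> twistor_fibre \<A> g 1 p" "b \<in> twistor_fibre \<A> g (-1) p"
    "a \<in> bivectors \<A> p" "b \<in> bivectors \<A> p" "bundle_chart c (p, a, b) \<in> chart_bundle c"
  using assms by (auto simp: twistor_dom_def twistor_product_def twistor_fibre_def hodge_eigenspace_def bundle_chart_def)

text \<open>The smooth function lives on an open set of pairs of arbitrary matrices and restricts to
  the field on the submanifold. Derivatives within the submanifold thereby become ordinary
  derivatives.\<close>

definition represents :: "'m chart \<Rightarrow> ('m twistor_point \<Rightarrow> 'm bundle_vec)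
    \<Rightarrow> ((real^4) \<times> (real^4^4) \<times> (real^4^4) \<Rightarrow> (real^4) \<times> (real^4^4) \<times> (real^4^4)) \<Rightarrow> bool" where
  "represents c A F \<longleftrightarrow> smooth_on F (chart_bundle c) \<and>
     (\<forall>\<kappa>\<in>twistor_dom M \<A> g c. A \<kappa> c = F (bundle_chart c \<kappa>))"

lemma represents_eq:
  assumes c: "c \<in> \<A>" and A: "represents c A F" and z: "z \<in> twistor_image M \<A> g c"
  shows "A (twistor_inv M \<A> g c z) c = F z" "z \<in> chart_bundle c"
proof -
  obtain \<kappa> where \<kappa>: "\<kappa> \<in> twistor_dom M \<A> g c" "z = bundle_chart c \<kappa>"
    using z unfolding twistor_image_def by blast
  show "A (twistor_inv M \<A> g c z) c = F z"
    using A \<kappa> twistor_inv_chart[OF c \<kappa>(1)] by (simp add: represents_def)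
  show "z \<in> chart_bundle c" using twistor_domD(6) \<kappa> by (cases \<kappa>) blast
qed

lemma represents_smooth:
  assumes c: "c \<in> \<A>" and A: "represents c A F"
  shows "smooth_on_subset (\<lambda>z. A (twistor_inv M \<A> g c z) c) (twistor_image M \<A> g c)"
  unfolding smooth_on_subset_def
proof
  fix z assume z: "z \<in> twistor_image M \<A> g c"
  show "\<exists>W F. open W \<and> z \<in> W \<and> smooth_on F W \<and>
      (\<forall>y\<in>twistor_image M \<A> g c \<inter> W. A (twistor_inv M \<A> g c y) c = F y)"
    using represents_eq[OF c A] z A chart_bundle_open[OF c]
    by (intro exI[of _ "chart_bundle c"] exI[of _ F]) (auto simp: represents_def)
qed

text \<open>Each derivative is applied to the value of the other field; since both values are
  velocities in the twistor product, the derivatives agree with those of the representatives.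
  Differentiability is recorded for \<open>fst_derivative_affine\<close>.\<close>

lemma bracket_represents:
  assumes c: "c \<in> \<A>" and \<kappa>: "\<kappa> \<in> twistor_dom M \<A> g c"
    and A: "represents c A F" and B: "represents c B H"
    and vA: "velocity_in (twistor_image M \<A> g c) (bundle_chart c \<kappa>) (A \<kappa> c)"
    and vB: "velocity_in (twistor_image M \<A> g c) (bundle_chart c \<kappa>) (B \<kappa> c)"
  shows "twistor_lie_bracket M \<A> g A B \<kappa> c =
    frechet_derivative H (at (bundle_chart c \<kappa>)) (A \<kappa> c) - frechet_derivative F (at (bundle_chart c \<kappa>)) (B \<kappa> c)"
    and "F differentiable (at (bundle_chart c \<kappa>))"
proof -
  have z: "bundle_chart c \<kappa> \<in> chart_bundle c" using twistor_domD(6) \<kappa> by (cases \<kappa>) blast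
  have d: "K differentiable (at (bundle_chart c \<kappa>))" if "represents c C K" for C K
    using that z by (auto simp: represents_def intro: smooth_on_differentiable)
  have eq: "frechet_derivative (\<lambda>z. C (twistor_inv M \<A> g c z) c)
      (at (bundle_chart c \<kappa>) within twistor_image M \<A> g c) w = frechet_derivative K (at (bundle_chart c \<kappa>)) w"
    if "represents c C K" "velocity_in (twistor_image M \<A> g c) (bundle_chart c \<kappa>) w" for C K w
    by (rule frechet_derivative_within_velocity[OF has_frechet_derivative[OF d[OF that(1)]]
          represents_eq(1)[OF c that(1)] that(2)])
  have "fst \<kappa> \<in> fst c" using \<kappa> by (simp add: twistor_dom_def)
  then show "twistor_lie_bracket M \<A> g A B \<kappa> c =
    frechet_derivative H (at (bundle_chart c \<kappa>)) (A \<kappa> c) - frechet_derivative F (at (bundle_chart c \<kappa>)) (B \<kappa> c)"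
    using c by (simp add: twistor_lie_bracket_def eq[OF A vB] eq[OF B vA])
  show "F differentiable (at (bundle_chart c \<kappa>))" by (rule d[OF A])
qed

text \<open>The factor \<open>r\<close> covers both the field and its image under the structure,
  which differs from it by a sign.\<close>

definition vertical_field :: "('m \<Rightarrow> 'm chart \<Rightarrow> real^4) \<Rightarrow> ('m \<Rightarrow> 'm chart \<Rightarrow> real^4) \<Rightarrow> real
    \<Rightarrow> 'm twistor_point \<Rightarrow> 'm bundle_vec" where
  "vertical_field X1 X2 r = (\<lambda>(p, a, b). vert (r *\<^sub>R bivec_comm p (wedge (X1 p) (X2 p)) a) 0)"

definition vertical_rep :: "('m \<Rightarrow> 'm chart \<Rightarrow> real^4) \<Rightarrow> ('m \<Rightarrow> 'm chart \<Rightarrow> real^4) \<Rightarrow> real \<Rightarrow> 'm chart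
    \<Rightarrow> (real^4) \<times> (real^4^4) \<times> (real^4^4) \<Rightarrow> (real^4) \<times> (real^4^4) \<times> (real^4^4)" where
  "vertical_rep X1 X2 r c z = (0,
     r *\<^sub>R (wedge4 (X1 (inv_chart c (fst z)) c) (X2 (inv_chart c (fst z)) c) ** gram c (inv_chart c (fst z)) ** fst (snd z)
       - fst (snd z) ** gram c (inv_chart c (fst z)) ** wedge4 (X1 (inv_chart c (fst z)) c) (X2 (inv_chart c (fst z)) c)), 0)"

text \<open>The base components \<open>y\<close> are a free argument because, for the image of a
  lift under the structure, they also depend on the fibre coordinates.\<close>

definition lift_rep :: "'m chart \<Rightarrow> (real^4) \<times> (real^4^4) \<times> (real^4^4) \<Rightarrow> real^4 \<Rightarrow> (real^4) \<times> (real^4^4) \<times> (real^4^4)" where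
  "lift_rep c z y =
     (let \<omega> = \<Sum>k\<in>UNIV. (y $ k) *\<^sub>R conn c (inv_chart c (fst z)) (coord_field \<A> c k (inv_chart c (fst z)))
      in (y, horizontal_component \<omega> (fst (snd z)), horizontal_component \<omega> (snd (snd z))))"

context
  fixes c assumes c: "c \<in> \<A>"
begin

lemma field_smooth_chart:
  assumes "vector_field \<A> M X"
  shows "smooth_on (\<lambda>x. X (inv_chart c x) c) (snd c ` fst c)"
proof -
  have "M \<inter> fst c = fst c" using chart_subset[OF c] by blast
  then show ?thesis using assms c unfolding vector_field_def by metis
qed

lemma smooth_on_fibre:
  "smooth_on (\<lambda>z. fst (snd z)) (chart_bundle c)" "smooth_on (\<lambda>z. snd (snd z)) (chart_bundle c)"
  using smooth_on_linear[OF bounded_linear_compose[OF bounded_linear_fst bounded_linear_snd]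
      chart_bundle_open[OF c] smooth_on_ident[OF chart_bundle_open[OF c]]]
    smooth_on_linear[OF bounded_linear_compose[OF bounded_linear_snd bounded_linear_snd]
      chart_bundle_open[OF c] smooth_on_ident[OF chart_bundle_open[OF c]]]
  by simp_all

lemmas chart_smooth_intros =
  smooth_on_Pair[OF chart_bundle_open[OF c]] smooth_on_scaleR[OF chart_bundle_open[OF c]]
  smooth_on_diff[OF chart_bundle_open[OF c]] smooth_on_add[OF chart_bundle_open[OF c]]
  smooth_on_minus[OF chart_bundle_open[OF c]]
  smooth_on_matrix_mult[OF chart_bundle_open[OF c]] smooth_on_matrix_vector[OF chart_bundle_open[OF c]]
  smooth_on_transpose[OF chart_bundle_open[OF c]] smooth_on_const smooth_on_fibre
  smooth_on_fst[OF chart_open[OF c] gram_smooth[OF c]]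

lemma vertical_represents:
  assumes X1: "vector_field \<A> M X1" and X2: "vector_field \<A> M X2"
  shows "represents c (vertical_field X1 X2 r) (vertical_rep X1 X2 r c)"
  unfolding represents_def
proof (intro conjI ballI)
  have w: "smooth_on (\<lambda>z. wedge4 (X1 (inv_chart c (fst z)) c) (X2 (inv_chart c (fst z)) c)) (chart_bundle c)"
    by (rule smooth_on_fst[OF chart_open[OF c] smooth_on_bilinear[OF bounded_bilinear_wedge4 chart_open[OF c]
            field_smooth_chart[OF X1] field_smooth_chart[OF X2]]])
  show "smooth_on (vertical_rep X1 X2 r c) (chart_bundle c)"
    unfolding vertical_rep_def[abs_def] by (intro chart_smooth_intros w)
  fix \<kappa> assume \<kappa>: "\<kappa> \<in> twistor_dom M \<A> g c"
  obtain p a b where e: "\<kappa> = (p, a, b)" by (cases \<kappa>)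
  have "p \<in> fst c" using twistor_domD(1) \<kappa> e by blast
  then show "vertical_field X1 X2 r \<kappa> c = vertical_rep X1 X2 r c (bundle_chart c \<kappa>)"
    by (simp add: e vertical_field_def vertical_rep_def vert_def bivec_comm_def wedge_apply bundle_chart_def inv_chart[OF c])
qed

lemma lift_rep_smooth:
  assumes "smooth_on y (chart_bundle c)"
  shows "smooth_on (\<lambda>z. lift_rep c z (y z)) (chart_bundle c)"
proof -
  have "smooth_on (\<lambda>z. y z $ k) (chart_bundle c)" for k
    by (rule smooth_on_linear[OF bounded_linear_vec_nth chart_bundle_open[OF c] assms])
  then have "smooth_on (\<lambda>z. \<Sum>k\<in>UNIV. (y z $ k) *\<^sub>R conn c (inv_chart c (fst z)) (coord_field \<A> c k (inv_chart c (fst z)))) (chart_bundle c)"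
    by (intro smooth_on_sum[OF chart_bundle_open[OF c]] smooth_on_scaleR[OF chart_bundle_open[OF c]]
        smooth_on_fst[OF chart_open[OF c] conn_smooth[OF c]])
  then show ?thesis
    unfolding lift_rep_def Let_def horizontal_component_def
    by (intro chart_smooth_intros assms)
qed

lemma hlift_rep:
  assumes p: "p \<in> fst c" and X: "X \<in> tangent_space \<A> p"
  shows "hlift \<A> D (p, a, b) X c = lift_rep c (bundle_chart c (p, a, b)) (X c)"
  using c p by (simp add: hlift_def lift_rep_def Let_def bundle_chart_def inv_chart[OF c] flip: conn_expand[OF c p X])

lemma vertical_velocity:
  assumes \<kappa>: "(p, a, b) \<in> twistor_dom M \<A> g c" and w: "w \<in> bivectors \<A> p"
  shows "velocity_in (twistor_image M \<A> g c) (bundle_chart c (p, a, b)) (vert (r *\<^sub>R bivec_comm p w a) 0 c)"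
proof -
  note d = twistor_domD[OF \<kappa>]
  let ?N = "(r *\<^sub>R w c) ** gram c p"
  have sk: "skew (r *\<^sub>R w c)" using bivector_skew[OF w, of c] by (simp add: skew_def transpose_scaleR)
  have "?N ** a c + a c ** transpose ?N = r *\<^sub>R bivec_comm p w a c"
    using bivector_skew[OF w, of c]
    by (simp add: bivec_comm_def skew_def matrix_linear_simps gram_sym[OF c d(1)] scaleR_diff_right)
  moreover have "0 ** b c + b c ** transpose 0 = 0"
    by (simp add: matrix_matrix_mult_def transpose_def vec_eq_iff)
  ultimately show ?thesis
    using twistor_velocity[OF c \<kappa> isometric_skew[OF c d(1) sk] isometric_zero[OF c d(1)]]
    by (simp add: vert_def)
qed

lemma horizontal_velocity:
  assumes \<kappa>: "(p, a, b) \<in> twistor_dom M \<A> g c" and X: "X \<in> tangent_space \<A> p"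
  shows "velocity_in (twistor_image M \<A> g c) (bundle_chart c (p, a, b)) (hlift \<A> D (p, a, b) X c)"
proof -
  note d = twistor_domD[OF \<kappa>]
  have "coord_vec \<A> c p (X c) = X"
    by (rule tangent_eqI[OF coord_vec_tangent[OF c d(1)] X c d(1) coord_vec_self[OF c d(1)]])
  then have i: "isometric_at c p (X c) (- conn c p X)"
    using isometric_conn[OF c d(1), of "X c"] by simp
  have "(- conn c p X) ** m + m ** transpose (- conn c p X) = horizontal_component (conn c p X) m" for m
    by (simp add: horizontal_component_def matrix_linear_simps)
  then show ?thesis
    using twistor_velocity[OF c \<kappa> i i] c d(1) by (simp add: hlift_def)
qed

lemma K_endo_chart:
  assumes p: "p \<in> fst c" and a: "a \<in> bivectors \<A> p" and X: "X \<in> tangent_space \<A> p"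
  shows "K_endo \<A> g p a X \<in> tangent_space \<A> p" "K_endo \<A> g p a X c = - (a c *v (gram c p *v X c))"
  by (simp_all add: K_endo_gram[OF c p a X] coord_vec_tangent[OF c p] coord_vec_self[OF c p])

lemma K_endo2_chart:
  assumes p: "p \<in> fst c" and a: "a \<in> bivectors \<A> p" and b: "b \<in> bivectors \<A> p" and X: "X \<in> tangent_space \<A> p"
  shows "K_endo \<A> g p a (K_endo \<A> g p b X) \<in> tangent_space \<A> p"
    "K_endo \<A> g p a (K_endo \<A> g p b X) c = a c *v (gram c p *v (b c *v (gram c p *v X c)))"
  using K_endo_chart(1)[OF p a K_endo_chart(1)[OF p b X]]
    K_endo_chart(2)[OF p a K_endo_chart(1)[OF p b X]] K_endo_chart(2)[OF p b X]
  by (simp_all add: linear_neg[OF matrix_vector_mul_linear])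

lemma K_endo2_zero:
  assumes p: "p \<in> fst c" and a: "a \<in> bivectors \<A> p" and b: "b \<in> bivectors \<A> p"
  shows "K_endo \<A> g p a (K_endo \<A> g p b 0) = 0"
  by (rule tangent_eqI[OF K_endo2_chart(1)[OF p a b tangent_subspace(1)] tangent_subspace(1) c p])
    (simp add: K_endo2_chart(2)[OF p a b tangent_subspace(1)])

end

text \<open>Presents vertical vectors as sums with a zero lift, the form expected by
  \<open>almost_product_hlift_vert\<close> and by the tangent space.\<close>

lemma hlift_zero: "hlift \<A> D (p, a, b) 0 = 0"
proof
  fix c show "hlift \<A> D (p, a, b) 0 c = 0 c"
  proof (cases "c \<in> \<A> \<and> p \<in> fst c")
    case True
    then have "conn c p 0 = 0"
      using conn_expand[OF _ _ tangent_subspace(1), of c p] by simp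
    then show ?thesis
      by (simp add: hlift_def horizontal_component_def matrix_matrix_mult_def transpose_def vec_eq_iff zero_prod_def)
  next
    case False
    then show ?thesis by (simp only: hlift_def prod.case if_False zero_fun_apply)
  qed
qed

lemma vertical_field_vector_field:
  assumes X1: "vector_field \<A> M X1" and X2: "vector_field \<A> M X2"
  shows "twistor_vector_field M \<A> g D (vertical_field X1 X2 1)"
  unfolding twistor_vector_field_def
proof (intro conjI ballI)
  fix \<kappa> assume \<kappa>: "\<kappa> \<in> twistor_product M \<A> g"
  obtain p a b where e: "\<kappa> = (p, a, b)" by (cases \<kappa>)
  have pM: "p \<in> M" using \<kappa> by (simp add: e twistor_product_def)
  obtain c where c: "c \<in> \<A>" "p \<in> fst c" using chart_exists[OF pM] by blast
  have "(p, a, b) \<in> twistor_dom M \<A> g c" using \<kappa> c by (simp add: e twistor_dom_def)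
  note d = twistor_domD[OF this]
  have w: "wedge (X1 p) (X2 p) \<in> bivectors \<A> p"
    using X1 X2 pM by (intro wedge_bivectors[OF _ _ c]) (auto simp: vector_field_def)
  let ?v = "bivec_comm p (wedge (X1 p) (X2 p)) a"
  have "vertical_field X1 X2 1 \<kappa> = hlift \<A> D \<kappa> 0 + vert ?v 0"
    by (simp add: e hlift_zero vertical_field_def)
  moreover have "hlift \<A> D \<kappa> 0 \<in> horizontal_space \<A> D \<kappa>"
    unfolding horizontal_space_def using tangent_subspace(1) by blast
  moreover have "vert ?v 0 \<in> vertical_space \<A> g \<kappa>"
    unfolding vertical_space_def e prod.case
    using bivec_comm_vertical[OF c w d(2)] zero_vertical[OF c d(5)] by blast
  ultimately show "vertical_field X1 X2 1 \<kappa> \<in> twistor_tangent_space \<A> g D \<kappa>"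
    unfolding twistor_tangent_space_def by blast
next
  fix c assume c: "c \<in> \<A>"
  show "smooth_on_subset (\<lambda>z. vertical_field X1 X2 1 (twistor_inv M \<A> g c z) c) (twistor_image M \<A> g c)"
    by (rule represents_smooth[OF c vertical_represents[OF c X1 X2]])
qed

lemma hlift_represents:
  assumes c: "c \<in> \<A>" and Y: "vector_field \<A> M Y"
  shows "represents c (\<lambda>\<kappa>. hlift \<A> D \<kappa> (Y (fst \<kappa>))) (\<lambda>z. lift_rep c z (Y (inv_chart c (fst z)) c))"
  unfolding represents_def
proof (intro conjI ballI)
  show "smooth_on (\<lambda>z. lift_rep c z (Y (inv_chart c (fst z)) c)) (chart_bundle c)"
    by (rule lift_rep_smooth[OF c smooth_on_fst[OF chart_open[OF c] field_smooth_chart[OF c Y]]])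
  fix \<kappa> assume \<kappa>: "\<kappa> \<in> twistor_dom M \<A> g c"
  obtain p a b where e: "\<kappa> = (p, a, b)" by (cases \<kappa>)
  have p: "p \<in> fst c" using twistor_domD(1) \<kappa> e by blast
  have "Y p \<in> tangent_space \<A> p" using Y point_in_M[OF c p] by (simp add: vector_field_def)
  then show "hlift \<A> D \<kappa> (Y (fst \<kappa>)) c = lift_rep c (bundle_chart c \<kappa>) (Y (inv_chart c (fst (bundle_chart c \<kappa>))) c)"
    using hlift_rep[OF c p] by (simp add: e bundle_chart_def inv_chart[OF c p])
qed

lemma hlift_vector_field:
  assumes Y: "vector_field \<A> M Y"
  shows "twistor_vector_field M \<A> g D (\<lambda>\<kappa>. hlift \<A> D \<kappa> (Y (fst \<kappa>)))"
  unfolding twistor_vector_field_def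
proof (intro conjI ballI)
  fix \<kappa> assume \<kappa>: "\<kappa> \<in> twistor_product M \<A> g"
  obtain p a b where e: "\<kappa> = (p, a, b)" by (cases \<kappa>)
  have pM: "p \<in> M" using \<kappa> by (simp add: e twistor_product_def)
  obtain c where c: "c \<in> \<A>" "p \<in> fst c" using chart_exists[OF pM] by blast
  have "(p, a, b) \<in> twistor_dom M \<A> g c" using \<kappa> c by (simp add: e twistor_dom_def)
  note d = twistor_domD[OF this]
  have "hlift \<A> D \<kappa> (Y (fst \<kappa>)) = hlift \<A> D \<kappa> (Y (fst \<kappa>)) + vert 0 0"
    by (simp add: vert_def fun_eq_iff zero_prod_def[symmetric])
  moreover have "hlift \<A> D \<kappa> (Y (fst \<kappa>)) \<in> horizontal_space \<A> D \<kappa>"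
    unfolding horizontal_space_def using Y pM by (auto simp: vector_field_def e)
  moreover have "vert 0 0 \<in> vertical_space \<A> g \<kappa>"
    unfolding vertical_space_def e prod.case
    using zero_vertical[OF c d(4)] zero_vertical[OF c d(5)] by blast
  ultimately show "hlift \<A> D \<kappa> (Y (fst \<kappa>)) \<in> twistor_tangent_space \<A> g D \<kappa>"
    unfolding twistor_tangent_space_def by blast
next
  fix c assume "c \<in> \<A>"
  then show "smooth_on_subset (\<lambda>z. hlift \<A> D (twistor_inv M \<A> g c z) (Y (fst (twistor_inv M \<A> g c z))) c) (twistor_image M \<A> g c)"
    using represents_smooth[OF _ hlift_represents[OF _ Y]] by blast
qed

text \<open>With \<open>A\<close> vertical in the first factor and \<open>B\<close> horizontal, only the derivatives of
  \<open>K\<^sub>a K\<^sub>b Y\<close> in the direction of \<open>A\<close> contribute to the base part of the Nijenhuis tensor.\<close>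

lemma integrable_obstruction:
  fixes \<nu> :: nat
  defines "e \<equiv> fst (vertical_signs \<nu>)"
  assumes int: "integrable_structure M \<A> g D (almost_product \<A> g D \<nu>)"
    and X1: "vector_field \<A> M X1" and X2: "vector_field \<A> M X2" and Y: "vector_field \<A> M Y"
    and c: "c \<in> \<A>" and \<kappa>: "(p, a, b) \<in> twistor_dom M \<A> g c"
  defines "v \<equiv> bivec_comm p (wedge (X1 p) (X2 p)) a"
  shows "e *\<^sub>R (v c *v (gram c p *v (b c *v (gram c p *v Y p c)))) =
    a c *v (gram c p *v (b c *v (gram c p *v (v c *v (gram c p *v (b c *v (gram c p *v Y p c)))))))"
proof -
  let ?P = "almost_product \<A> g D \<nu>"
  let ?A = "vertical_field X1 X2 1" and ?PA = "vertical_field X1 X2 e"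
  let ?B = "\<lambda>\<kappa>. hlift \<A> D \<kappa> (Y (fst \<kappa>))"
  let ?K = "\<lambda>q a b y. K_endo \<A> g q a (K_endo \<A> g q b y)"
  have Yt: "Y q \<in> tangent_space \<A> q" if "q \<in> M" for q using Y that by (simp add: vector_field_def)
  have PA: "?P \<tau> (?A \<tau>) = ?PA \<tau>" if \<tau>: "\<tau> \<in> twistor_dom M \<A> g d" and d: "d \<in> \<A>" for \<tau> d
  proof -
    obtain q a' b' where t: "\<tau> = (q, a', b')" by (cases \<tau>)
    note dd = twistor_domD[OF \<tau>[unfolded t]]
    show ?thesis
      using almost_product_hlift_vert[OF tangent_subspace(1), of g D \<nu> q a' b' "bivec_comm q (wedge (X1 q) (X2 q)) a'" 0]
      by (simp add: t vertical_field_def hlift_zero K_endo2_zero[OF d dd(1,4,5)] e_def)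
  qed
  have PB: "?P (q, a', b') (?B (q, a', b')) = hlift \<A> D (q, a', b') (?K q a' b' (Y q))" if "q \<in> M" for q a' b'
  proof -
    have v0: "vert 0 0 = (0 :: 'm bundle_vec)" by (simp add: vert_def fun_eq_iff zero_prod_def)
    show ?thesis
      using almost_product_hlift_vert[OF Yt[OF that], of g D \<nu> a' b' 0 0] by (simp add: v0)
  qed
  have P_base: "fst (?P (p, a, b) \<xi> d) = ?K p a b (base_part \<xi>) d" if "d \<in> \<A>" "p \<in> fst d" for \<xi> d
    using that by (simp add: almost_product_def Let_def hlift_def vert_def)
  let ?br = "twistor_lie_bracket M \<A> g"
  let ?PAf = "\<lambda>\<tau>. ?P \<tau> (?A \<tau>)" and ?PBf = "\<lambda>\<tau>. ?P \<tau> (?B \<tau>)"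
  have pc: "p \<in> fst c" and pM: "p \<in> M" using twistor_domD(1)[OF \<kappa>] point_in_M[OF c] by blast+
  note biv = twistor_domD(4,5)[OF \<kappa>]
  have w: "wedge (X1 p) (X2 p) \<in> bivectors \<A> p"
    using X1 X2 pM by (intro wedge_bivectors[OF _ _ c pc]) (auto simp: vector_field_def)
  have v: "v \<in> bivectors \<A> p" unfolding v_def by (rule bivec_comm_bivectors[OF c pc w biv(1)])
  \<comment> \<open>All charts at \<open>p\<close> are treated, because the structure is applied to
    a bracket as a family over charts and uses its whole base part.\<close>
  have brackets: "fst (?br ?A ?B (p, a, b) d) = 0"
    "fst (?br ?PAf ?PBf (p, a, b) d) = e *\<^sub>R (v d *v (gram d p *v (b d *v (gram d p *v Y p d))))"
    "fst (?br ?PAf ?B (p, a, b) d) = 0"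
    "fst (?br ?A ?PBf (p, a, b) d) = v d *v (gram d p *v (b d *v (gram d p *v Y p d)))"
    if d: "d \<in> \<A>" "p \<in> fst d" for d
  proof -
    have \<kappa>d: "(p, a, b) \<in> twistor_dom M \<A> g d" using \<kappa> d by (simp add: twistor_dom_def)
    let ?z = "bundle_chart d (p, a, b)"
    let ?S = "twistor_image M \<A> g d"
    let ?FA = "\<lambda>r. vertical_rep X1 X2 r d"
    let ?FB = "\<lambda>z. lift_rep d z (Y (inv_chart d (fst z)) d)"
    let ?G = "\<lambda>z. gram d (inv_chart d (fst z))"
    let ?k = "\<lambda>z. fst (snd z) *v (?G z *v (snd (snd z) *v (?G z *v Y (inv_chart d (fst z)) d)))"
    let ?FPB = "\<lambda>z. lift_rep d z (?k z)"
    have rA: "represents d ?A (?FA 1)" by (rule vertical_represents[OF d(1) X1 X2])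
    have rPA: "represents d ?PAf (?FA e)"
      using vertical_represents[OF d(1) X1 X2, of e] PA d(1) by (simp add: represents_def)
    have rB: "represents d ?B ?FB" by (rule hlift_represents[OF d(1) Y])
    have rPB: "represents d ?PBf ?FPB"
      unfolding represents_def
    proof (intro conjI ballI)
      have "smooth_on ?k (chart_bundle d)"
        by (intro chart_smooth_intros[OF d(1)] smooth_on_fst[OF chart_open[OF d(1)] field_smooth_chart[OF d(1) Y]])
      then show "smooth_on ?FPB (chart_bundle d)" by (rule lift_rep_smooth[OF d(1)])
      fix \<tau> assume \<tau>: "\<tau> \<in> twistor_dom M \<A> g d"
      obtain q a' b' where t: "\<tau> = (q, a', b')" by (cases \<tau>)
      note dd = twistor_domD[OF \<tau>[unfolded t]]
      have qM: "q \<in> M" by (rule point_in_M[OF d(1) dd(1)])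
      show "?P \<tau> (?B \<tau>) d = ?FPB (bundle_chart d \<tau>)"
        unfolding t PB[OF qM] hlift_rep[OF d(1) dd(1) K_endo2_chart(1)[OF d(1) dd(1,4,5) Yt[OF qM]]]
          K_endo2_chart(2)[OF d(1) dd(1,4,5) Yt[OF qM]]
        by (simp add: bundle_chart_def inv_chart[OF d(1) dd(1)])
    qed
    have A_at: "?A (p, a, b) d = (0, v d, 0)" by (simp add: vertical_field_def vert_def v_def)
    have PA_at: "?PAf (p, a, b) d = (0, e *\<^sub>R v d, 0)"
      using PA[OF \<kappa>d d(1)] by (simp add: vertical_field_def vert_def v_def)
    have vel_A: "velocity_in ?S ?z (?A (p, a, b) d)"
      using vertical_velocity[OF d(1) \<kappa>d w, of 1] by (simp add: vertical_field_def)
    have vel_PA: "velocity_in ?S ?z (?PAf (p, a, b) d)"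
      using vertical_velocity[OF d(1) \<kappa>d w, of e] PA[OF \<kappa>d d(1)] by (simp add: vertical_field_def)
    have vel_B: "velocity_in ?S ?z (?B (p, a, b) d)"
      using horizontal_velocity[OF d(1) \<kappa>d Yt[OF pM]] by simp
    have vel_PB: "velocity_in ?S ?z (?PBf (p, a, b) d)"
      using horizontal_velocity[OF d(1) \<kappa>d K_endo2_chart(1)[OF d biv Yt[OF pM]]] PB[OF pM] by simp
    have dA: "fst (frechet_derivative (?FA r) (at ?z) w) = 0"
      if "?FA r differentiable (at ?z)" for r w
      by (rule fst_derivative_affine[OF that, where ?y0.0=0]) (simp add: vertical_rep_def)
    \<comment> \<open>A lift of a field from the base has constant base components along the
      fibre.\<close>
    have dB: "fst (frechet_derivative ?FB (at ?z) (0, m, 0)) = 0" for m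
      by (rule fst_derivative_affine[OF bracket_represents(2)[OF d(1) \<kappa>d rB rA vel_B vel_A], where ?y0.0="Y p d"])
        (simp add: lift_rep_def Let_def bundle_chart_def inv_chart[OF d])
    \<comment> \<open>Along \<open>(0, m, 0)\<close> only \<open>a\<close> moves, and the base
      components are linear in it; the derivative puts \<open>m\<close> in its place.\<close>
    have dPB: "fst (frechet_derivative ?FPB (at ?z) (0, m, 0)) = m *v (gram d p *v (b d *v (gram d p *v Y p d)))" for m
      by (rule fst_derivative_affine[OF bracket_represents(2)[OF d(1) \<kappa>d rPB rA vel_PB vel_A],
            where ?y0.0="a d *v (gram d p *v (b d *v (gram d p *v Y p d)))"])
        (simp add: lift_rep_def Let_def bundle_chart_def inv_chart[OF d] matrix_vector_mult_add_rdistrib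
          scaleR_matrix_vector_assoc[symmetric])
    show "fst (?br ?A ?B (p, a, b) d) = 0"
      unfolding bracket_represents(1)[OF d(1) \<kappa>d rA rB vel_A vel_B]
      by (simp add: dA[OF bracket_represents(2)[OF d(1) \<kappa>d rA rB vel_A vel_B]] A_at dB)
    show "fst (?br ?PAf ?PBf (p, a, b) d) = e *\<^sub>R (v d *v (gram d p *v (b d *v (gram d p *v Y p d))))"
      unfolding bracket_represents(1)[OF d(1) \<kappa>d rPA rPB vel_PA vel_PB] fst_diff PA_at dPB
      by (simp add: dA[OF bracket_represents(2)[OF d(1) \<kappa>d rPA rPB vel_PA vel_PB]]
          scaleR_matrix_vector_assoc[symmetric])
    show "fst (?br ?PAf ?B (p, a, b) d) = 0"
      unfolding bracket_represents(1)[OF d(1) \<kappa>d rPA rB vel_PA vel_B] fst_diff PA_at dB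
      by (simp add: dA[OF bracket_represents(2)[OF d(1) \<kappa>d rPA rB vel_PA vel_B]])
    show "fst (?br ?A ?PBf (p, a, b) d) = v d *v (gram d p *v (b d *v (gram d p *v Y p d)))"
      unfolding bracket_represents(1)[OF d(1) \<kappa>d rA rPB vel_A vel_PB] fst_diff A_at dPB
      by (simp add: dA[OF bracket_represents(2)[OF d(1) \<kappa>d rA rPB vel_A vel_PB]])
  qed
  \<comment> \<open>Brackets and tangent vectors are both 0 in charts that do not contain
    \<open>p\<close>, so whole families can be compared.\<close>
  have outside: "?br F H (p, a, b) d = 0" if "\<not> (d \<in> \<A> \<and> p \<in> fst d)" for F H d
    using that unfolding twistor_lie_bracket_def fst_conv by (simp only: if_False)
  have b1: "base_part (?br ?PAf ?B (p, a, b)) = 0"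
  proof
    fix d show "base_part (?br ?PAf ?B (p, a, b)) d = 0 d"
      using brackets(3)[of d] outside[of d ?PAf ?B] by (cases "d \<in> \<A> \<and> p \<in> fst d") (simp_all add: base_part_def)
  qed
  let ?Z = "?K p v b (Y p)"
  have Zt: "?Z \<in> tangent_space \<A> p" by (rule K_endo2_chart(1)[OF c pc v biv(2) Yt[OF pM]])
  have b2: "base_part (?br ?A ?PBf (p, a, b)) = ?Z"
  proof
    fix d show "base_part (?br ?A ?PBf (p, a, b)) d = ?Z d"
    proof (cases "d \<in> \<A> \<and> p \<in> fst d")
      case True
      then show ?thesis
        using brackets(4)[of d] K_endo2_chart(2)[OF _ _ v biv(2) Yt[OF pM], of d] by (simp add: base_part_def)
    next
      case False
      then show ?thesis using outside[OF False] tangent_zero[OF Zt False] by (simp add: base_part_def)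
    qed
  qed
  have "nijenhuis M \<A> g ?P ?A ?B (p, a, b) = 0"
    using int vertical_field_vector_field[OF X1 X2] hlift_vector_field[OF Y] \<kappa>
    unfolding integrable_structure_def twistor_dom_def by blast
  then have "fst (nijenhuis M \<A> g ?P ?A ?B (p, a, b) c) = 0" by simp
  \<comment> \<open>The first and third terms have no base component. What remains is
    \<open>e\<close> times \<open>?Z\<close> minus the image of \<open>?Z\<close> under the two
    endomorphisms of \<open>a\<close> and \<open>b\<close>.\<close>
  then have "fst (?br ?A ?B (p, a, b) c) + fst (?br ?PAf ?PBf (p, a, b) c)
      - fst (?P (p, a, b) (?br ?PAf ?B (p, a, b)) c) - fst (?P (p, a, b) (?br ?A ?PBf (p, a, b)) c) = 0"
    unfolding nijenhuis_def by simp
  then show ?thesis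
    by (simp add: brackets(1,2)[OF c pc] P_base[OF c pc] b1 b2 K_endo2_zero[OF c pc biv]
        K_endo2_chart(2)[OF c pc biv Zt] K_endo2_chart(2)[OF c pc v biv(2) Yt[OF pM]])
qed

text \<open>One point suffices. With the bivectors chosen by their coefficients in an orthonormal
  frame there, the identity of \<open>integrable_obstruction\<close> becomes an equation between
  constant matrices, which \<open>eigen4_obstruction\<close> excludes.\<close>

lemma not_integrable: "\<not> integrable_structure M \<A> g D (almost_product \<A> g D \<nu>)"
proof
  assume int: "integrable_structure M \<A> g D (almost_product \<A> g D \<nu>)"
  let ?e = "fst (vertical_signs \<nu>)"
  obtain p where pM: "p \<in> M" using oriented unfolding oriented_manifold_def by blast
  obtain c where c: "c \<in> \<A>" "p \<in> fst c" using chart_exists[OF pM] by blast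
  obtain E where E: "frame4 (gram c p) E" using gram_frame_exists[OF c] by blast
  obtain \<alpha> where \<alpha>: "eigen4 1 \<alpha>" "\<alpha> \<bullet> \<alpha> = 4" using standard_eigen4[of 1] by blast
  obtain \<beta> where \<beta>: "eigen4 (-1) \<beta>" "\<beta> \<bullet> \<beta> = 4" using standard_eigen4[of "-1"] by blast
  have "?e = 1 \<or> ?e = -1" by (simp add: vertical_signs_def)
  then obtain x y u where ne:
    "?e *\<^sub>R ((wedge4 x y ** \<alpha> - \<alpha> ** wedge4 x y) ** \<beta> *v u)
      \<noteq> \<alpha> ** \<beta> ** (wedge4 x y ** \<alpha> - \<alpha> ** wedge4 x y) ** \<beta> *v u"
    by (rule eigen4_obstruction[OF \<alpha> \<beta>])
  define m where "m = wedge4 x y ** \<alpha> - \<alpha> ** wedge4 x y"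
  define a where "a = bivec_of c p (E ** \<alpha> ** transpose E)"
  define b where "b = bivec_of c p (E ** \<beta> ** transpose E)"
  have sk: "skew \<alpha>" "skew \<beta>" using \<alpha> \<beta> by (simp_all add: eigen4_def)
  have ac: "a c = E ** \<alpha> ** transpose E" and bc: "b c = E ** \<beta> ** transpose E"
    by (simp_all add: a_def b_def bivec_of_self[OF c])
  have biv: "a \<in> bivectors \<A> p" "b \<in> bivectors \<A> p"
    unfolding a_def b_def by (intro bivec_of_bivectors[OF c] skew_conj sk)+
  have "a \<in> twistor_fibre \<A> g 1 p" "b \<in> twistor_fibre \<A> g (-1) p"
    unfolding twistor_fibre_frame[OF c E] using biv ac bc \<alpha> \<beta> by blast+
  then have \<kappa>: "(p, a, b) \<in> twistor_dom M \<A> g c"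
    using pM c by (simp add: twistor_dom_def twistor_product_def)
  \<comment> \<open>The prescribed components make the frame coordinates of the three fields at
    \<open>p\<close> equal to the witnesses \<open>x\<close>, \<open>y\<close> and
    \<open>u\<close>.\<close>
  obtain X1 where X1: "vector_field \<A> M X1" "X1 p c = E *v x" by (rule global_field_exists[OF c])
  obtain X2 where X2: "vector_field \<A> M X2" "X2 p c = E *v y" by (rule global_field_exists[OF c])
  obtain Y where Y: "vector_field \<A> M Y" "Y p c = E *v u" by (rule global_field_exists[OF c])
  let ?v = "bivec_comm p (wedge (X1 p) (X2 p)) a"
  have "wedge (X1 p) (X2 p) c = E ** wedge4 x y ** transpose E"
    by (simp add: wedge_apply X1 X2 wedge4_conj)
  then have vc: "?v c = E ** m ** transpose E"
    unfolding m_def by (rule bivec_comm_frame[where a=a, OF E _ ac])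
  \<comment> \<open>In frame coordinates a bivector followed by lowering an index acts as its
    coefficient matrix, so all Gram matrices disappear from the identity.\<close>
  have mv: "(E ** n ** transpose E) *v (gram c p *v (E *v w)) = E *v (n *v w)" for n w
  proof -
    have "(E ** n ** transpose E) *v (gram c p *v (E *v w)) = (E ** n ** (transpose E ** gram c p ** E)) *v w"
      by (simp only: matrix_vector_mul_assoc matrix_mul_assoc)
    then show ?thesis by (simp add: frame4_inverse(1)[OF E] matrix_vector_mul_assoc)
  qed
  have "?e *\<^sub>R (E *v (m *v (\<beta> *v u))) = E *v (\<alpha> *v (\<beta> *v (m *v (\<beta> *v u))))"
    using integrable_obstruction[OF int X1(1) X2(1) Y(1) c(1) \<kappa>]
    unfolding vc ac bc Y(2) mv .
  then have "E *v (?e *\<^sub>R (m *v (\<beta> *v u))) = E *v (\<alpha> *v (\<beta> *v (m *v (\<beta> *v u))))"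
    by (simp add: matrix_vector_mult_scaleR)
  then have "(transpose E ** gram c p) *v (E *v (?e *\<^sub>R (m *v (\<beta> *v u))))
      = (transpose E ** gram c p) *v (E *v (\<alpha> *v (\<beta> *v (m *v (\<beta> *v u)))))"
    by (rule arg_cong)
  then have "?e *\<^sub>R (m *v (\<beta> *v u)) = \<alpha> *v (\<beta> *v (m *v (\<beta> *v u)))"
    by (simp only: matrix_vector_mul_assoc[of "transpose E ** gram c p" E] frame4_inverse(1)[OF E]
        matrix_vector_mul_lid)
  then have "?e *\<^sub>R (m ** \<beta> *v u) = \<alpha> ** \<beta> ** m ** \<beta> *v u"
    by (simp only: matrix_vector_mul_assoc matrix_mul_assoc)
  then show False using ne by (simp add: m_def)
qed

end

theorem proposition1:
  fixes M :: "'m set" and \<A> :: "'m chart set" and g :: "'m metric" and D :: "'m connection"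
    and \<nu> :: nat
  assumes "oriented_manifold M \<A>"
    and "riemannian_metric M \<A> g"
    and "levi_civita_connection M \<A> g D"
    and "\<nu> \<in> {1, 2, 3, 4}"
  shows "\<not> integrable_structure M \<A> g D (almost_product \<A> g D \<nu>)"
proof -
  interpret riemannian_charts M \<A> g D
    using assms by unfold_locales
  show ?thesis by (rule not_integrable)
qed

end
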